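(* Let $\mathfrak g$ be a finite-dimensional semisimple Lie algebra over $K$ possessing a nontrivial action $\theta$ on $K[t]$, let $E=K[t]\otimes\mathfrak g$ be the crossed product and let $L$ be the kernel of $\theta:K[t]\otimes\mathfrak g\to K[t]$. There exists $\tau\in K[t]\otimes\wedge^2\mathfrak g$ such that: 1) $\mathcal Dt=[\tau,t]$, and $\tau$ is unique (with this property) up to an element of $\wedge^2_{K[t]}L$. 2) The operator $\Omega:=\mathcal D-[\tau,\cdot]:E\to\wedge^2_{K[t]}L$ is a $1$-cocycle with respect to the adjoint representation. 3) One can take such $\tau$ in $K[t]\otimes\wedge^2\mathfrak{sl}(2,K)$ which is also an $\varepsilon$-dynamical $r$-matrix for $\varepsilon=-1$.
   Context: $K=\mathbb R$ or $\mathbb C$. $\operatorname{Der}K[t]$ is identified with $K[t]$ via $f\leftrightarrow f\frac d{dt}$ (bracket $[f,g]=fg'-f'g$). An action of $\mathfrak g$ on $K[t]$ is a Lie algebra morphism $\theta:\mathfrak g\to\operatorname{Der}K[t]$. The crossed product $E=K[t]\otimes\mathfrak g$ is the Lie Rinehart algebra over $A=K[t]$ with anchor the $K[t]$-linear extension of $\theta$ and bracket $[aX,bY]=ab[X,Y]+a(\theta(X)b)Y-b(\theta(Y)a)X$. The Schouten bracket on $\wedge_A^\bullet E=K[t]\otimes\wedge^\bullet\mathfrak g$ (with $\wedge^0_AE=A$, $[\wedge^k,\wedge^l]\subset\wedge^{k+l-1}$) is the $K$-bilinear graded Lie bracket ($[x,y]=-(-1)^{(|x|-1)(|y|-1)}[y,x]$)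 extending the bracket of $E$, with $[x,f]=\theta(x)f$ for $x\in E,f\in A$, and $[x,y\wedge z]=[x,y]\wedge z+(-1)^{(|x|-1)|y|}y\wedge[x,z]$. The adjoint representation of $E$ on $\wedge^k_{K[t]}L$ is $x.l=[x,l]$. A $1$-cocycle $E\to\wedge^2_{K[t]}L$ with respect to it is a $K[t]$-linear map $\Omega$ with $\Omega[x,y]=x.\Omega(y)-y.\Omega(x)$ for all $x,y\in E$. Since $\mathfrak g$ is semisimple and $\theta\neq 0$, one has $\mathfrak g=\mathfrak{sl}(2,K)\oplus\mathfrak l$ with $\mathfrak l=\operatorname{Ker}(\theta|_{\mathfrak g})$ a semisimple ideal. Let $\mathbf H,\mathbf E_+,\mathbf E_-$ be a basis of the ideal $\mathfrak{sl}(2,K)$ with $[\mathbf H,\mathbf E_+]=\mathbf E_+$, $[\mathbf H,\mathbf E_-]=-\mathbf E_-$, $[\mathbf E_+,\mathbf E_-]=-2\mathbf H$, and put $\Omega_{sl(2)}=4\,\mathbf H\wedge\mathbf E_+\wedge\mathbf E_-$ (independent of the choice of such basis). Let $(\cdot,\cdot)$ be the Killing form of $\mathfrak g$, extended $K[t]$-bilinearly to $K[t]\otimes\mathfrak g$. For $f\in K[t]$, $(d_\theta f)^\#\in K[t]\otimes\mathfrak g$ is determined by $((d_\theta f)^\#,X)=\theta(X)f$ for all $X\in\mathfrak g$. The operator $\mathcal D:K[t]\otimes\wedge^k\mathfrak g\to K[t]\otimes\wedge^{k+1}\mathfrak g$ is $\mathcal D(fX_1\wedge\cdots\wedge X_k)=(d_\theta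 f)^\#\wedge X_1\wedge\cdots\wedge X_k$ for $f\in K[t]$, $X_i\in\mathfrak g$. For $\varepsilon\in K$, $\Lambda\in K[t]\otimes\wedge^2\mathfrak g$ is an $\varepsilon$-dynamical $r$-matrix if $\frac12[\Lambda,\Lambda]+\varepsilon\mathcal D\Lambda+\frac{\varepsilon^2}{32}\Omega_{sl(2)}=\omega$ for some Casimir element $\omega\in(\wedge^3\mathfrak l)^{\mathfrak l}$ (an $\mathfrak l$-invariant element of $\wedge^3\mathfrak l$). *)

theory Defs
  imports
    Complex_Main
    "HOL-Computational_Algebra.Polynomial"
    "HOL-Library.Function_Algebras"
begin

text \<open>The ground field \<open>K\<close>: a field that is (isomorphic to) \<open>\<real>\<close> or \<open>\<complex>\<close>.  A field embedding into
  \<open>\<complex>\<close> with image \<open>\<real>\<close> or \<open>\<complex>\<close> says exactly this.\<close>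

class real_or_complex_field = field_char_0 +
  assumes real_or_complex:
    "\<exists>\<phi> :: 'a \<Rightarrow> complex. inj \<phi> \<and> (\<forall>x y. \<phi> (x + y) = \<phi> x + \<phi> y) \<and> (\<forall>x y. \<phi> (x * y) = \<phi> x * \<phi> y)
       \<and> (range \<phi> = \<real> \<or> range \<phi> = UNIV)"

instance real :: real_or_complex_field
  by standard (rule exI[of _ complex_of_real], auto simp: inj_on_def Reals_def)

instance complex :: real_or_complex_field
  by standard (rule exI[of _ id], auto)


section \<open>Exterior algebra over \<open>K[t]\<close>\<close>

text \<open>\<open>K[t] \<otimes> \<And>\<^sup>kV\<close> (\<open>V\<close> a finite-dimensional \<open>K\<close>-vector space on the type \<open>'g\<close>) is realised through the
  canonical identification of \<open>\<And>\<^sup>kV\<close> with the alternating \<open>k\<close>-linear forms on \<open>V\<^sup>*\<close>,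
  \<open>X\<^sub>1 \<and> \<dots> \<and> X\<^sub>k \<mapsto> ((\<alpha>\<^sub>1, \<dots>, \<alpha>\<^sub>k) \<mapsto> det (\<alpha>\<^sub>i(X\<^sub>j)))\<close>, with values extended to \<open>K[t]\<close>.  A multivector (possibly
  inhomogeneous) is a function on lists of functionals; its degree \<open>k\<close> part is its restriction to
  lists of length \<open>k\<close>.  The algebra itself is cut out below as the span of the wedge monomials.\<close>

type_synonym ('k, 'g) multivector = "('g \<Rightarrow> 'k) list \<Rightarrow> 'k poly"

definition amult :: "'k::field poly \<Rightarrow> ('k, 'g) multivector \<Rightarrow> ('k, 'g) multivector" where
  "amult f u = (\<lambda>\<alpha>s. f * u \<alpha>s)"

definition of_fun :: "'k::field poly \<Rightarrow> ('k, 'g) multivector" where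
  "of_fun f = (\<lambda>\<alpha>s. if \<alpha>s = [] then f else 0)"

text \<open>The second equation says that the contraction \<open>i\<^sub>\<alpha> u = (\<lambda>\<alpha>s. u (\<alpha> # \<alpha>s))\<close> is an antiderivation,
  \<open>i\<^sub>\<alpha>(u \<and> v) = i\<^sub>\<alpha> u \<and> v + (-1)\<^bsup>|u|\<^esup> u \<and> i\<^sub>\<alpha> v\<close>.\<close>

fun wedge :: "('k::field, 'g) multivector \<Rightarrow> ('k, 'g) multivector \<Rightarrow> ('k, 'g) multivector"
  (infixr "\<and>\<^sub>A" 70) where
  "(u \<and>\<^sub>A v) [] = u [] * v []"
| "(u \<and>\<^sub>A v) (\<alpha> # \<alpha>s) =
     ((\<lambda>\<beta>s. u (\<alpha> # \<beta>s)) \<and>\<^sub>A v) \<alpha>s + ((\<lambda>\<beta>s. (-1) ^ length \<beta>s * u \<beta>s) \<and>\<^sub>A (\<lambda>\<beta>s. v (\<alpha> # \<beta>s))) \<alpha>s"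

definition wedges :: "('k::field, 'g) multivector list \<Rightarrow> ('k, 'g) multivector" where
  "wedges us = foldr (\<and>\<^sub>A) us (of_fun 1)"

text \<open>\<open>wedge_power M k\<close> is \<open>\<And>\<^sup>k\<^bsub>K[t]\<^esub>M\<close>, seen inside the big exterior algebra, and
  \<open>wedge_power_const M k\<close> is its version over \<open>K\<close>.\<close>

definition wedge_power :: "('k::field, 'g) multivector set \<Rightarrow> nat \<Rightarrow> ('k, 'g) multivector set" where
  "wedge_power M k = module.span amult {wedges us | us. length us = k \<and> set us \<subseteq> M}"

definition wedge_power_const :: "('k::field, 'g) multivector set \<Rightarrow> nat \<Rightarrow> ('k, 'g) multivector set" where
  "wedge_power_const M k =
     module.span (\<lambda>c. amult [:c:]) {wedges us | us. length us = k \<and> set us \<subseteq> M}"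


section \<open>Finite-dimensional Lie algebras\<close>

locale fd_lie_algebra = vector_space scale
  for scale :: "'k::field \<Rightarrow> 'g::ab_group_add \<Rightarrow> 'g" +
  fixes br :: "'g \<Rightarrow> 'g \<Rightarrow> 'g"
  assumes finite_dimensional: "\<exists>B. finite B \<and> span B = UNIV"
    and br_add_left: "br (x + y) z = br x z + br y z"
    and br_add_right: "br x (y + z) = br x y + br x z"
    and br_scale_left: "br (scale c x) y = scale c (br x y)"
    and br_scale_right: "br x (scale c y) = scale c (br x y)"
    and br_self: "br x x = 0"
    and jacobi: "br x (br y z) + br y (br z x) + br z (br x y) = 0"
begin

definition ideal :: "'g set \<Rightarrow> bool" where
  "ideal I \<longleftrightarrow> subspace I \<and> (\<forall>x. \<forall>y\<in>I. br x y \<in> I)"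

primrec derived_series :: "'g set \<Rightarrow> nat \<Rightarrow> 'g set" where
  "derived_series I 0 = I"
| "derived_series I (Suc n) =
     span {br x y | x y. x \<in> derived_series I n \<and> y \<in> derived_series I n}"

definition solvable :: "'g set \<Rightarrow> bool" where
  "solvable I \<longleftrightarrow> (\<exists>n. derived_series I n = {0})"

definition semisimple :: bool where
  "semisimple \<longleftrightarrow> (\<forall>I. ideal I \<and> solvable I \<longrightarrow> I = {0})"

text \<open>Traces and \<open>K[t]\<close>-linear extensions are written in an arbitrarily chosen basis; none of them
  depends on the choice.\<close>

definition some_basis :: "'g set" where
  "some_basis = (SOME B. independent B \<and> span B = UNIV)"

definition coord :: "'g \<Rightarrow> 'g \<Rightarrow> 'k" where
  "coord b = (\<lambda>x. representation some_basis x b)"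

definition trace :: "('g \<Rightarrow> 'g) \<Rightarrow> 'k" where
  "trace f = (\<Sum>b\<in>some_basis. coord b (f b))"

definition killing :: "'g \<Rightarrow> 'g \<Rightarrow> 'k" where
  "killing x y = trace (\<lambda>z. br x (br y z))"

text \<open>Only linear functionals count as elements of the dual space.\<close>

definition vec :: "'g \<Rightarrow> ('k, 'g) multivector" where
  "vec X = (\<lambda>\<alpha>s. case \<alpha>s of
      [\<alpha>] \<Rightarrow> if Vector_Spaces.linear scale (*) \<alpha> then [:\<alpha> X:] else 0
    | _ \<Rightarrow> 0)"

text \<open>\<open>mvec k\<close> is \<open>K[t] \<otimes> \<And>\<^sup>k\<gg>\<close>, and \<open>mvecs\<close> the sum of all of these.  In particular
  \<open>mvec 1\<close> is \<open>E = K[t] \<otimes> \<gg>\<close>, and \<open>mvec 0\<close> consists of the \<open>of_fun f\<close>.\<close>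

definition mvec :: "nat \<Rightarrow> ('k, 'g) multivector set" where
  "mvec k = wedge_power (range vec) k"

definition mvecs :: "('k, 'g) multivector set" where
  "mvecs = module.span amult (\<Union>k. mvec k)"

definition killing_ext :: "('k, 'g) multivector \<Rightarrow> ('k, 'g) multivector \<Rightarrow> 'k poly" where
  "killing_ext u v =
     (\<Sum>b\<in>some_basis. \<Sum>c\<in>some_basis. u [coord b] * v [coord c] * [:killing b c:])"

end


section \<open>Actions on \<open>K[t]\<close>\<close>

text \<open>\<open>Der K[t]\<close> is identified with \<open>K[t]\<close>, a polynomial \<open>p\<close> acting as \<open>p d/dt\<close>.\<close>

locale fd_lie_action = fd_lie_algebra scale br
  for scale :: "'k::field_char_0 \<Rightarrow> 'g::ab_group_add \<Rightarrow> 'g" and br :: "'g \<Rightarrow> 'g \<Rightarrow> 'g" +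
  fixes \<theta> :: "'g \<Rightarrow> 'k poly"
  assumes action_add: "\<theta> (x + y) = \<theta> x + \<theta> y"
    and action_scale: "\<theta> (scale c x) = smult c (\<theta> x)"
    and action_br: "\<theta> (br x y) = \<theta> x * pderiv (\<theta> y) - pderiv (\<theta> x) * \<theta> y"
begin

definition anchor :: "('k, 'g) multivector \<Rightarrow> 'k poly" where
  "anchor x = (\<Sum>b\<in>some_basis. x [coord b] * \<theta> b)"

definition anchor_kernel :: "('k, 'g) multivector set" where
  "anchor_kernel = {x \<in> mvec 1. anchor x = 0}"

text \<open>In the exponents below \<open>|x| - 1\<close> is replaced by \<open>|x| + 1\<close>, which has the same parity and does
  not suffer from truncated subtraction.  On \<open>E\<close> the bracket is prescribed on the elements \<open>aX\<close>, which
  span \<open>E\<close> additively.\<close>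

definition is_schouten_bracket ::
  "(('k, 'g) multivector \<Rightarrow> ('k, 'g) multivector \<Rightarrow> ('k, 'g) multivector) \<Rightarrow> bool" where
  "is_schouten_bracket S \<longleftrightarrow>
     (\<forall>x\<in>mvecs. \<forall>y\<in>mvecs. \<forall>z\<in>mvecs. S (x + y) z = S x z + S y z \<and> S z (x + y) = S z x + S z y) \<and>
     (\<forall>c. \<forall>x\<in>mvecs. \<forall>y\<in>mvecs.
        S (amult [:c:] x) y = amult [:c:] (S x y) \<and> S x (amult [:c:] y) = amult [:c:] (S x y)) \<and>
     (\<forall>k l. \<forall>x\<in>mvec k. \<forall>y\<in>mvec l. if k + l = 0 then S x y = 0 else S x y \<in> mvec (k + l - 1)) \<and>
     (\<forall>k l. \<forall>x\<in>mvec k. \<forall>y\<in>mvec l. S x y = - amult ((-1) ^ ((k + 1) * (l + 1))) (S y x)) \<and>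
     (\<forall>k l m. \<forall>x\<in>mvec k. \<forall>y\<in>mvec l. \<forall>z\<in>mvec m.
        S x (S y z) = S (S x y) z + amult ((-1) ^ ((k + 1) * (l + 1))) (S y (S x z))) \<and>
     (\<forall>a b X Y. S (amult a (vec X)) (amult b (vec Y)) =
        amult (a * b) (vec (br X Y)) + amult (a * (\<theta> X * pderiv b)) (vec Y)
          - amult (b * (\<theta> Y * pderiv a)) (vec X)) \<and>
     (\<forall>x\<in>mvec 1. \<forall>f. S x (of_fun f) = of_fun (anchor x * pderiv f)) \<and>
     (\<forall>k l m. \<forall>x\<in>mvec k. \<forall>y\<in>mvec l. \<forall>z\<in>mvec m.
        S x (y \<and>\<^sub>A z) = S x y \<and>\<^sub>A z + amult ((-1) ^ ((k + 1) * l)) (y \<and>\<^sub>A S x z))"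

text \<open>The conditions determine the bracket uniquely on \<open>mvecs\<close>; its values elsewhere are irrelevant.
  Explicitly, it is
  \<open>[P,Q] = \<Sum>\<^sub>b (P \<lfloor> b\<^sup>*) \<and> (\<L>\<^sub>b Q) - (\<theta>(b)P) \<and> (b\<^sup>* \<rfloor> Q)\<close>, the sum being over a basis of \<open>\<gg>\<close> with dual basis
  \<open>b\<^sup>*\<close>, where \<open>(P \<lfloor> \<alpha>)(\<alpha>s) = P(\<alpha>s @ [\<alpha>])\<close>, \<open>(\<alpha> \<rfloor> Q)(\<alpha>s) = Q(\<alpha> # \<alpha>s)\<close>, \<open>\<theta>(b)\<close> acts on the coefficients and
  \<open>\<L>\<^sub>b\<close> is the Lie derivative.\<close>

definition schouten ::
  "('k, 'g) multivector \<Rightarrow> ('k, 'g) multivector \<Rightarrow> ('k, 'g) multivector" where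
  "schouten = (SOME S. is_schouten_bracket S)"

definition sharp :: "'k poly \<Rightarrow> ('k, 'g) multivector" where
  "sharp f = (THE v. v \<in> mvec 1 \<and> (\<forall>X. killing_ext v (vec X) = \<theta> X * pderiv f))"

text \<open>As for the bracket, only the values of \<open>\<D>\<close> on \<open>mvecs\<close> matter, and they are determined.\<close>

definition is_D_operator :: "(('k, 'g) multivector \<Rightarrow> ('k, 'g) multivector) \<Rightarrow> bool" where
  "is_D_operator D \<longleftrightarrow>
     (\<forall>x\<in>mvecs. \<forall>y\<in>mvecs. D (x + y) = D x + D y) \<and>
     (\<forall>c. \<forall>x\<in>mvecs. D (amult [:c:] x) = amult [:c:] (D x)) \<and>
     (\<forall>f Xs. D (amult f (wedges (map vec Xs))) = sharp f \<and>\<^sub>A wedges (map vec Xs))"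

definition D_op :: "('k, 'g) multivector \<Rightarrow> ('k, 'g) multivector" where
  "D_op = (SOME D. is_D_operator D)"

definition is_cocycle :: "(('k, 'g) multivector \<Rightarrow> ('k, 'g) multivector) \<Rightarrow> bool" where
  "is_cocycle \<Omega> \<longleftrightarrow>
     (\<forall>x\<in>mvec 1. \<Omega> x \<in> wedge_power anchor_kernel 2) \<and>
     (\<forall>x\<in>mvec 1. \<forall>y\<in>mvec 1. \<Omega> (x + y) = \<Omega> x + \<Omega> y) \<and>
     (\<forall>f. \<forall>x\<in>mvec 1. \<Omega> (amult f x) = amult f (\<Omega> x)) \<and>
     (\<forall>x\<in>mvec 1. \<forall>y\<in>mvec 1. \<Omega> (schouten x y) = schouten x (\<Omega> y) - schouten y (\<Omega> x))"

definition kernel :: "'g set" where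
  "kernel = {X. \<theta> X = 0}"

text \<open>For semisimple \<open>\<gg>\<close> an ideal has exactly one complementary ideal; for \<open>\<theta> \<noteq> 0\<close> the complement of
  \<open>kernel\<close> is the copy of \<open>\<ss>\<ll>(2,K)\<close> in \<open>\<gg>\<close>.\<close>

definition sl2_ideal :: "'g set" where
  "sl2_ideal =
     (THE s. ideal s \<and> s \<inter> kernel = {0} \<and> {x + y | x y. x \<in> s \<and> y \<in> kernel} = UNIV)"

definition is_sl2_basis :: "'g \<Rightarrow> 'g \<Rightarrow> 'g \<Rightarrow> bool" where
  "is_sl2_basis H Ep Em \<longleftrightarrow>
     distinct [H, Ep, Em] \<and> independent {H, Ep, Em} \<and> span {H, Ep, Em} = sl2_ideal \<and>
     br H Ep = Ep \<and> br H Em = - Em \<and> br Ep Em = scale (-2) H"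

definition Omega_sl2 :: "('k, 'g) multivector" where
  "Omega_sl2 = (THE w. \<exists>H Ep Em. is_sl2_basis H Ep Em \<and>
     w = amult 4 (vec H \<and>\<^sub>A vec Ep \<and>\<^sub>A vec Em))"

definition casimir :: "('k, 'g) multivector \<Rightarrow> bool" where
  "casimir \<omega> \<longleftrightarrow>
     \<omega> \<in> wedge_power_const (vec ` kernel) 3 \<and> (\<forall>X\<in>kernel. schouten (vec X) \<omega> = 0)"

definition dynamical_r_matrix :: "'k \<Rightarrow> ('k, 'g) multivector \<Rightarrow> bool" where
  "dynamical_r_matrix \<epsilon> \<Lambda> \<longleftrightarrow> \<Lambda> \<in> mvec 2 \<and>
     (\<exists>\<omega>. casimir \<omega> \<and>
        amult [:1/2:] (schouten \<Lambda> \<Lambda>) + amult [:\<epsilon>:] (D_op \<Lambda>) + amult [:\<epsilon>\<^sup>2 / 32:] Omega_sl2 = \<omega>)"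

end

end

theory Submission
  imports Defs "Jordan_Normal_Form.Jordan_Normal_Form_Existence"
begin

text \<open>Three ingredients. (1) The Killing form of \<open>\<gg>\<close> is non-degenerate. For \<open>X\<close> in the derived algebra of its
  radical, complexify and let \<open>y\<close> act by the complex conjugate of the eigenvalue on each generalized
  eigenspace of \<open>ad X\<close>; then \<open>y\<close> is a derivation, and pairing it with \<open>ad X\<close> under the trace gives both \<open>0\<close>
  and the sum of the squared moduli of the eigenvalues. So \<open>ad X\<close> is nilpotent, and Engel's argument makes the
  radical a solvable ideal. (2) On the exterior algebra the explicit formula for the Schouten bracket is
  a graded derivation in each argument, so its Jacobi identity only has to be checked on functions and on
  elements of \<open>\<gg>\<close>. (3) The image of \<open>\<theta>\<close> is the space of polynomials of degree at most \<open>2\<close>, so that one may choose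
  \<open>\<theta>(H) = t\<close>, \<open>\<theta>(E\<^sub>+) = t\<^sup>2\<close>, \<open>\<theta>(E\<^sub>-) = 1\<close>. Then \<open>(d t)\<^sup># = v = t/2 H - 1/4 E\<^sub>+ - t\<^sup>2/4 E\<^sub>-\<close>, the operator \<open>\<D>\<close> is \<open>v \<and> d/dt\<close>,
  and \<open>\<tau> = (t/2 H - 1/4 E\<^sub>+) \<and> E\<^sub>-\<close> satisfies \<open>[\<tau>, t] = v\<close>, \<open>[\<tau>, \<tau>] = 0\<close>, \<open>\<D>\<tau> = 1/8 H \<and> E\<^sub>+ \<and> E\<^sub>-\<close>.
  Uniqueness and the cocycle property hold because \<open>[u, t] = 0\<close> characterizes \<open>\<And>\<^sup>2L\<close> in \<open>\<And>\<^sup>2E\<close>.\<close>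

section \<open>Killing form and semisimplicity\<close>

text \<open>The eigenvalues of \<open>ad X\<close> lie in the complex numbers even if K is real, and
  the usual criterion applies functionals linear over the rationals to them. Conjugation does this
  work in one step: it is additive, which makes \<open>y\<close> a derivation, and it turns the
  trace into a sum of nonnegative reals. Only coordinates are pushed along the embedding of K; the
  Lie algebra itself is never complexified. The bracket is chosen by \<open>SOME\<close>: the
  explicit formula shows that a bracket exists, and from then on only the defining axioms are used.
  The element \<tau> is v \<and> E_-: whenever \<theta>(e) = 1 and v is in L, [v \<and> e, t] =
  \<theta>(e) v - \<theta>(v) e = v, and the E_- component of v drops out of the wedge. The
  coefficients of v come from the Killing form, in which H pairs with itself to 2 and E_+ with E_-
  to -4. The coefficient 1/8 of \<open>D_op \<tau>\<close> is cancelled by 4/32, so the Casimir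
  element is zero.\<close>

lemma jordan_matrix_entry:
  assumes "i < sum_list (map fst n_as)" "j < sum_list (map fst n_as)" "i \<noteq> j"
    and "jordan_matrix n_as $$ (i, j) \<noteq> (0 :: 'a :: zero_neq_one)"
  shows "j = Suc i \<and> jordan_matrix n_as $$ (i, i) = jordan_matrix n_as $$ (j, j)"
  using assms
proof (induction n_as arbitrary: i j)
  case Nil
  then show ?case by simp
next
  case (Cons na n_as)
  obtain n a where na: "na = (n, a)" by force
  let ?J = "jordan_matrix n_as" and ?d = "sum_list (map fst n_as)"
  \<comment> \<open>Peeling off the first block leaves a block diagonal matrix: an index pair with
    nonzero entry lies in that block, or is a shift by \<open>n\<close> of a pair in the
    rest.\<close>
  have J: "jordan_matrix (na # n_as) =
      four_block_mat (jordan_block n a) (0\<^sub>m n ?d) (0\<^sub>m ?d n) ?J"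
    by (simp add: jordan_matrix_def na Let_def) (simp flip: jordan_matrix_def)
  have idx: "jordan_matrix (na # n_as) $$ (k, l) =
      (if k < n then if l < n then jordan_block n a $$ (k, l) else 0
       else if l < n then 0 else ?J $$ (k - n, l - n))"
    if "k < n + ?d" "l < n + ?d" for k l
    unfolding J using that by (subst index_mat_four_block) auto
  have ij: "i < n + ?d" "j < n + ?d" using Cons.prems na by auto
  consider "i < n" "j < n" | "\<not> i < n" "\<not> j < n"
    using Cons.prems(4) unfolding idx[OF ij] by (auto split: if_splits)
  then show ?case
  proof cases
    case 1
    then show ?thesis
      using Cons.prems(3,4) unfolding idx[OF ij] idx[OF ij(1) ij(1)] idx[OF ij(2) ij(2)]
      by (auto split: if_splits)
  next
    case 2
    have "j - n = Suc (i - n) \<and> ?J $$ (i - n, i - n) = ?J $$ (j - n, j - n)"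
      using 2 ij Cons.prems(3,4) idx[OF ij] by (intro Cons.IH) auto
    then show ?thesis
      using 2 unfolding idx[OF ij(1) ij(1)] idx[OF ij(2) ij(2)] by auto
  qed
qed

text \<open>Jordan normal form without blocks: \<open>A\<close> sends column \<open>k\<close> of
  \<open>P\<close> to \<open>a k\<close> times itself plus \<open>\<epsilon> k\<close> times its
  predecessor. That a nonzero \<open>\<epsilon> k\<close> joins equal eigenvalues is all that is
  kept of the block structure.\<close>

lemma jordan_basis:
  fixes A :: "nat \<Rightarrow> nat \<Rightarrow> complex"
  obtains P Q a \<epsilon> where
    "\<And>i j. i < n \<Longrightarrow> j < n \<Longrightarrow> (\<Sum>k<n. P i k * Q k j) = (if i = j then 1 else 0)"
    "\<And>i j. i < n \<Longrightarrow> j < n \<Longrightarrow> (\<Sum>k<n. Q i k * P k j) = (if i = j then 1 else 0)"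
    "\<And>i k. i < n \<Longrightarrow> k < n \<Longrightarrow>
       (\<Sum>j<n. A i j * P j k) = a k * P i k + (if k = 0 then 0 else \<epsilon> k * P i (k - 1))"
    "\<And>k. 0 < k \<Longrightarrow> k < n \<Longrightarrow> \<epsilon> k \<noteq> 0 \<Longrightarrow> a (k - 1) = a k"
proof -
  define M where "M = mat n n (\<lambda>(i, j). A i j)"
  have M: "M \<in> carrier_mat n n" by (simp add: M_def)
  obtain as where "char_poly M = (\<Prod>a\<leftarrow>as. [:- a, 1:])"
    using char_poly_factorized[OF M] by auto
  then obtain n_as where "jordan_nf M n_as" using jordan_nf_exists[OF M] by blast
  then obtain P Q where w: "similar_mat_wit M (jordan_matrix n_as) P Q"
    by (auto simp: jordan_nf_def similar_mat_def)
  let ?J = "jordan_matrix n_as"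
  note w' = similar_mat_witD2[OF M w]
  have dJ: "sum_list (map fst n_as) = n" using w'(5) by (metis carrier_matD(1) jordan_matrix_dim(1))
  have sumprod: "(X * Y) $$ (i, j) = (\<Sum>k<n. X $$ (i, k) * Y $$ (k, j))"
    if "X \<in> carrier_mat n n" "Y \<in> carrier_mat n n" "i < n" "j < n" for X Y :: "complex mat" and i j
    using that by (simp add: scalar_prod_def lessThan_atLeast0)
  have MP: "M * P = P * ?J"
  proof -
    have "M * P = P * ?J * (Q * P)"
      using w' by (simp add: assoc_mult_mat[of _ n n _ n _ n])
    then show ?thesis using w' by (simp add: right_mult_one_mat[of _ n n])
  qed
  show thesis
  proof (rule that[of "\<lambda>i j. P $$ (i, j)" "\<lambda>i j. Q $$ (i, j)" "\<lambda>k. ?J $$ (k, k)" "\<lambda>k. ?J $$ (k - 1, k)"])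
    fix i j assume ij: "i < n" "j < n"
    show "(\<Sum>k<n. P $$ (i, k) * Q $$ (k, j)) = (if i = j then 1 else 0)"
      using sumprod[OF w'(6) w'(7) ij] w'(1) ij by simp
    show "(\<Sum>k<n. Q $$ (i, k) * P $$ (k, j)) = (if i = j then 1 else 0)"
      using sumprod[OF w'(7) w'(6) ij] w'(2) ij by simp
  next
    fix i k assume ik: "i < n" "k < n"
    have "(\<Sum>j<n. A i j * P $$ (j, k)) = (M * P) $$ (i, k)"
      unfolding sumprod[OF M w'(6) ik] using ik by (simp add: M_def)
    also have "\<dots> = (\<Sum>j<n. P $$ (i, j) * ?J $$ (j, k))"
      unfolding MP sumprod[OF w'(6) w'(5) ik] ..
    also have "\<dots> = P $$ (i, k) * ?J $$ (k, k) + (\<Sum>j\<in>{..<n} - {k}. P $$ (i, j) * ?J $$ (j, k))"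
      using ik by (subst sum.remove[of _ k]) auto
    also have "(\<Sum>j\<in>{..<n} - {k}. P $$ (i, j) * ?J $$ (j, k)) =
        (\<Sum>j\<in>{..<n} - {k}. if k \<noteq> 0 \<and> j = k - 1 then P $$ (i, j) * ?J $$ (j, k) else 0)"
    proof (rule sum.cong[OF refl])
      fix j assume j: "j \<in> {..<n} - {k}"
      show "P $$ (i, j) * ?J $$ (j, k) = (if k \<noteq> 0 \<and> j = k - 1 then P $$ (i, j) * ?J $$ (j, k) else 0)"
        using jordan_matrix_entry[of j n_as k] j ik dJ by auto
    qed
    also have "\<dots> = (if k = 0 then 0 else ?J $$ (k - 1, k) * P $$ (i, k - 1))"
    proof (cases "k = 0")
      case False
      then have "k - 1 \<in> {..<n} - {k}" using ik by auto
      then show ?thesis using False by (simp add: sum.delta)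
    qed simp
    finally show "(\<Sum>j<n. A i j * P $$ (j, k)) =
        ?J $$ (k, k) * P $$ (i, k) + (if k = 0 then 0 else ?J $$ (k - 1, k) * P $$ (i, k - 1))"
      by simp
  next
    fix k assume "0 < k" "k < n" "?J $$ (k - 1, k) \<noteq> 0"
    then show "?J $$ (k - 1, k - 1) = ?J $$ (k, k)"
      using jordan_matrix_entry[of "k - 1" n_as k] dJ by simp
  qed
qed

text \<open>\<open>B\<close> is any bilinear product with structure constants \<open>c\<close>. As
  \<open>A\<close> is a derivation, the product of \<open>U z\<close> and \<open>U w\<close> lies in
  \<open>U (z + w)\<close>, so acting on each \<open>U z\<close> by \<open>cnj z\<close> is again a
  derivation. Its trace pairing with \<open>A\<close> forces all eigenvalues to vanish, and then
  \<open>A\<close> shifts the Jordan basis until nothing is left.\<close>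

lemma nilpotent_if_orthogonal_to_derivations:
  fixes A :: "nat \<Rightarrow> nat \<Rightarrow> complex" and c :: "nat \<Rightarrow> nat \<Rightarrow> nat \<Rightarrow> complex" and n :: nat
  defines "app \<equiv> \<lambda>M u i. \<Sum>j<n. M i j * u j"
  defines "B \<equiv> \<lambda>u v l. \<Sum>i<n. \<Sum>j<n. u i * v j * c i j l"
  defines "derivation \<equiv> \<lambda>M. \<forall>u v. \<forall>l<n. app M (B u v) l = B (app M u) v l + B u (app M v) l"
  assumes A: "derivation A"
    and tr: "\<And>Y. derivation Y \<Longrightarrow> (\<Sum>i<n. \<Sum>j<n. A i j * Y j i) = 0"
    and i: "i < n"
  shows "(app A ^^ n) u i = 0"
proof -
  obtain P Q a \<epsilon> where
    PQ: "\<And>i j. i < n \<Longrightarrow> j < n \<Longrightarrow> (\<Sum>k<n. P i k * Q k j) = (if i = j then 1 else 0)" and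
    QP: "\<And>i j. i < n \<Longrightarrow> j < n \<Longrightarrow> (\<Sum>k<n. Q i k * P k j) = (if i = j then 1 else 0)" and
    AP: "\<And>i k. i < n \<Longrightarrow> k < n \<Longrightarrow>
       (\<Sum>j<n. A i j * P j k) = a k * P i k + (if k = 0 then 0 else \<epsilon> k * P i (k - 1))" and
    \<epsilon>: "\<And>k. 0 < k \<Longrightarrow> k < n \<Longrightarrow> \<epsilon> k \<noteq> 0 \<Longrightarrow> a (k - 1) = a k"
    using jordan_basis[of n A] by blast
  \<comment> \<open>\<open>p k\<close> is the \<open>k\<close>-th Jordan basis vector and
    \<open>q u k\<close> the \<open>k\<close>-th coordinate of \<open>u\<close>; \<open>Y\<close> is
    diagonal in this basis, with the conjugate eigenvalues.\<close>
  define p where "p = (\<lambda>k i. P i k)"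
  define q where "q = (\<lambda>u k. \<Sum>i<n. Q k i * u i)"
  define Y where "Y = (\<lambda>i j. \<Sum>k<n. P i k * cnj (a k) * Q k j)"
  have expand: "(\<Sum>k<n. q u k * p k i) = u i" if "i < n" for u i
  proof -
    have "(\<Sum>k<n. q u k * p k i) = (\<Sum>k<n. \<Sum>j<n. P i k * Q k j * u j)"
      by (simp add: q_def p_def sum_distrib_left sum_distrib_right mult_ac)
    also have "\<dots> = (\<Sum>j<n. (\<Sum>k<n. P i k * Q k j) * u j)"
      by (subst sum.swap) (simp add: sum_distrib_right)
    also have "\<dots> = (\<Sum>j<n. if i = j then u j else 0)"
      using that by (intro sum.cong) (auto simp: PQ)
    finally show ?thesis using that by simp
  qed
  have app_cong: "app M u l = app M v l" if "\<And>i. i < n \<Longrightarrow> u i = v i" for M u v l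
    using that by (simp add: app_def)
  have B_cong: "B u v l = B u' v' l"
    if "\<And>i. i < n \<Longrightarrow> u i = u' i" "\<And>i. i < n \<Longrightarrow> v i = v' i" for u v u' v' l
    using that by (simp add: B_def)
  have app_sum: "app M (\<lambda>i. \<Sum>k<n. x k * f k i) l = (\<Sum>k<n. x k * app M (f k) l)" for M x f l
    unfolding app_def sum_distrib_left by (subst sum.swap) (simp add: mult_ac)
  have B_sum_left: "B (\<lambda>i. \<Sum>k<n. x k * f k i) v l = (\<Sum>k<n. x k * B (f k) v l)" for x f v l
  proof -
    have "B (\<lambda>i. \<Sum>k<n. x k * f k i) v l = (\<Sum>i<n. \<Sum>k<n. \<Sum>j<n. x k * (f k i * v j * c i j l))"
      unfolding B_def sum_distrib_right
      by (rule sum.cong[OF refl], subst sum.swap) (simp add: mult_ac)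
    also have "\<dots> = (\<Sum>k<n. x k * B (f k) v l)"
      unfolding B_def sum_distrib_left by (subst sum.swap) simp
    finally show ?thesis .
  qed
  have B_swap: "B u v l = (\<Sum>j<n. \<Sum>i<n. v j * u i * c i j l)" for u v l
    unfolding B_def by (subst sum.swap) (simp add: mult_ac)
  have B_sum_right: "B v (\<lambda>i. \<Sum>k<n. x k * f k i) l = (\<Sum>k<n. x k * B v (f k) l)" for x f v l
  proof -
    have "B v (\<lambda>i. \<Sum>k<n. x k * f k i) l = (\<Sum>i<n. \<Sum>k<n. \<Sum>j<n. x k * (f k i * v j * c j i l))"
      unfolding B_swap sum_distrib_right
      by (rule sum.cong[OF refl], subst sum.swap) (simp add: mult_ac)
    also have "\<dots> = (\<Sum>k<n. x k * B v (f k) l)"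
      unfolding B_swap sum_distrib_left by (subst sum.swap) simp
    finally show ?thesis .
  qed
  have app_lin: "app M (\<lambda>i. x * u i + y * v i) l = x * app M u l + y * app M v l" for M x y u v l
    by (simp add: app_def algebra_simps sum.distrib sum_distrib_left)
  have B_lin_left: "B (\<lambda>i. x * u i + y * v i) w l = x * B u w l + y * B v w l" for x y u v w l
    by (simp add: B_def algebra_simps sum.distrib sum_distrib_left)
  have B_lin_right: "B w (\<lambda>i. x * u i + y * v i) l = x * B w u l + y * B w v l" for x y u v w l
    by (simp add: B_def algebra_simps sum.distrib sum_distrib_left)
  have q_cong: "q u k = q v k" if "\<And>i. i < n \<Longrightarrow> u i = v i" for u v k
    using that by (simp add: q_def)
  have q_lin: "q (\<lambda>i. x * u i + y * v i) k = x * q u k + y * q v k" for x y u v k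
    by (simp add: q_def algebra_simps sum.distrib sum_distrib_left)
  have q_sum: "q (\<lambda>i. \<Sum>k<n. x k * f k i) m = (\<Sum>k<n. x k * q (f k) m)" for x f m
    unfolding q_def sum_distrib_left by (subst sum.swap) (simp add: mult_ac)
  have qp: "q (p k) m = (if m = k then 1 else 0)" if "k < n" "m < n" for k m
    using QP[OF that(2,1)] by (simp add: q_def p_def)
  \<comment> \<open>The predecessor of \<open>p k\<close>, with zero before the first one, so that
    the formula for \<open>A\<close> needs no case distinction.\<close>
  define p' where "p' = (\<lambda>k. if k = 0 then (\<lambda>i. 0) else p (k - 1))"
  define \<epsilon>' where "\<epsilon>' = (\<lambda>k. if k = 0 then 0 else \<epsilon> k)"
  have Ap: "app A (p k) i = a k * p k i + \<epsilon>' k * p' k i" if "k < n" "i < n" for k i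
    using AP[OF that(2,1)] by (simp add: app_def p_def p'_def \<epsilon>'_def)
  have qA: "q (app A w) k = a k * q w k + (if Suc k < n then \<epsilon> (Suc k) * q w (Suc k) else 0)"
    if k: "k < n" for w k
  proof -
    have "q (app A w) k = q (\<lambda>i. \<Sum>m<n. q w m * app A (p m) i) k"
    proof (rule q_cong)
      fix i assume "i < n"
      have "app A w i = app A (\<lambda>i. \<Sum>k<n. q w k * p k i) i"
        by (rule app_cong) (simp add: expand)
      then show "app A w i = (\<Sum>m<n. q w m * app A (p m) i)"
        by (simp add: app_sum)
    qed
    also have "\<dots> = (\<Sum>m<n. q w m * (a m * q (p m) k + \<epsilon>' m * q (p' m) k))"
      unfolding q_sum
    proof (intro sum.cong refl)
      fix m assume "m \<in> {..<n}"
      then have "q (app A (p m)) k = q (\<lambda>i. a m * p m i + \<epsilon>' m * p' m i) k"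
        by (intro q_cong) (simp add: Ap)
      then show "q w m * q (app A (p m)) k = q w m * (a m * q (p m) k + \<epsilon>' m * q (p' m) k)"
        by (simp add: q_lin)
    qed
    also have "\<dots> = (\<Sum>m<n. (if m = k then q w m * a m else 0) +
        (if m = Suc k then q w m * \<epsilon> m else 0))"
      using k by (intro sum.cong) (auto simp: qp p'_def \<epsilon>'_def algebra_simps)
    also have "\<dots> = a k * q w k + (if Suc k < n then \<epsilon> (Suc k) * q w (Suc k) else 0)"
      using k by (simp add: sum.distrib)
    finally show ?thesis .
  qed
  \<comment> \<open>The generalized eigenspace for \<open>z\<close>, as the span of the
    \<open>p k\<close> with \<open>a k = z\<close>.\<close>
  define U where "U = (\<lambda>z. {w. \<forall>k<n. a k \<noteq> z \<longrightarrow> q w k = 0})"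
  \<comment> \<open>\<open>A - z\<close> is injective modulo \<open>U z\<close>: coordinate
    \<open>k\<close> of the image involves only coordinates \<open>k\<close> and
    \<open>k + 1\<close> of \<open>w\<close>, so those with \<open>a k\<close> different from
    \<open>z\<close> vanish one by one from the last down.\<close>
  have U_top: "w \<in> U z" if "(\<lambda>i. 1 * app A w i + (- z) * w i) \<in> U z" for w z
  proof -
    have "\<forall>k<n. k \<ge> n - d \<longrightarrow> a k \<noteq> z \<longrightarrow> q w k = 0" for d
    proof (induction d)
      case (Suc d)
      show ?case
      proof (intro allI impI)
        fix k assume k: "k < n" "k \<ge> n - Suc d" "a k \<noteq> z"
        have "(if Suc k < n then \<epsilon> (Suc k) * q w (Suc k) else 0) = 0"
        proof (cases "Suc k < n \<and> \<epsilon> (Suc k) \<noteq> 0")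
          case True
          then have "a (Suc k) \<noteq> z" using \<epsilon>[of "Suc k"] k(3) by simp
          then show ?thesis using Suc.IH True k by auto
        qed auto
        moreover have "q (\<lambda>i. 1 * app A w i + (- z) * w i) k = 0"
          using that k by (auto simp: U_def)
        ultimately have "(a k - z) * q w k = 0"
          unfolding q_lin qA[OF k(1)] by (simp add: algebra_simps)
        then show "q w k = 0" using k(3) by simp
      qed
    qed auto
    from this[of n] show ?thesis by (auto simp: U_def)
  qed
  have U_lin: "(\<lambda>i. x * u i + y * v i) \<in> U z"
    if "x \<noteq> 0 \<Longrightarrow> u \<in> U z" "y \<noteq> 0 \<Longrightarrow> v \<in> U z" for x y u v z
    unfolding U_def mem_Collect_eq q_lin using that by (cases "x = 0"; cases "y = 0") (auto simp: U_def)
  have U_cong: "u \<in> U z \<longleftrightarrow> v \<in> U z" if "\<And>i. i < n \<Longrightarrow> u i = v i" for u v z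
    using q_cong[of u v] that by (simp add: U_def)
  \<comment> \<open>\<open>A - (a i + a j)\<close> sends this product to products in which
    \<open>i\<close> or \<open>j\<close> is lowered by one without changing the eigenvalue, so the
    induction hypothesis and \<open>U_top\<close> apply.\<close>
  have pp: "i < n \<Longrightarrow> j < n \<Longrightarrow> B (p i) (p j) \<in> U (a i + a j)" for i j
  proof (induction "i + j" arbitrary: i j rule: less_induct)
    case less
    have rhs: "(\<lambda>l. \<epsilon>' i * B (p' i) (p j) l + \<epsilon>' j * B (p i) (p' j) l) \<in> U (a i + a j)"
    proof (rule U_lin)
      assume "\<epsilon>' i \<noteq> 0"
      then have "0 < i" "a (i - 1) = a i" using \<epsilon>[of i] less.prems by (auto simp: \<epsilon>'_def split: if_splits)
      then show "B (p' i) (p j) \<in> U (a i + a j)"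
        using less.hyps[of "i - 1" j] less.prems by (simp add: p'_def)
    next
      assume "\<epsilon>' j \<noteq> 0"
      then have "0 < j" "a (j - 1) = a j" using \<epsilon>[of j] less.prems by (auto simp: \<epsilon>'_def split: if_splits)
      then show "B (p i) (p' j) \<in> U (a i + a j)"
        using less.hyps[of i "j - 1"] less.prems by (simp add: p'_def)
    qed
    have lhs: "1 * app A (B (p i) (p j)) l + (- (a i + a j)) * B (p i) (p j) l =
        \<epsilon>' i * B (p' i) (p j) l + \<epsilon>' j * B (p i) (p' j) l" if "l < n" for l
    proof -
      have "app A (B (p i) (p j)) l = B (app A (p i)) (p j) l + B (p i) (app A (p j)) l"
        using A that by (simp add: derivation_def)
      also have "B (app A (p i)) (p j) l = B (\<lambda>l. a i * p i l + \<epsilon>' i * p' i l) (p j) l"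
        using less.prems by (intro B_cong) (auto simp: Ap)
      also have "B (p i) (app A (p j)) l = B (p i) (\<lambda>l. a j * p j l + \<epsilon>' j * p' j l) l"
        using less.prems by (intro B_cong) (auto simp: Ap)
      finally show ?thesis by (simp add: B_lin_left B_lin_right algebra_simps)
    qed
    show ?case
      by (rule U_top, rule iffD2[OF U_cong rhs], rule lhs)
  qed
  have Y_app: "app Y w l = (\<Sum>k<n. cnj (a k) * q w k * P l k)" for w l
    unfolding app_def Y_def q_def sum_distrib_left sum_distrib_right
    by (subst sum.swap) (simp add: mult_ac)
  have YU: "app Y w l = cnj z * w l" if "w \<in> U z" "l < n" for w z l
  proof -
    have "app Y w l = (\<Sum>k<n. cnj z * (q w k * p k l))"
      unfolding Y_app using that(1)
      by (intro sum.cong refl) (auto simp: U_def p_def mult_ac)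
    then show ?thesis using expand[OF that(2), of w] by (simp flip: sum_distrib_left)
  qed
  have Yp: "app Y (p k) l = cnj (a k) * p k l" if "k < n" "l < n" for k l
  proof (rule YU)
    show "p k \<in> U (a k)" using that by (auto simp: U_def qp)
  qed fact
  have Ypp: "app Y (B (p i) (p j)) l = B (app Y (p i)) (p j) l + B (p i) (app Y (p j)) l"
    if "i < n" "j < n" "l < n" for i j l
  proof -
    have "B (app Y (p i)) (p j) l = B (\<lambda>l. cnj (a i) * p i l + 0 * p i l) (p j) l"
      using that by (intro B_cong) (auto simp: Yp)
    moreover have "B (p i) (app Y (p j)) l = B (p i) (\<lambda>l. cnj (a j) * p j l + 0 * p j l) l"
      using that by (intro B_cong) (auto simp: Yp)
    ultimately show ?thesis
      using YU[OF pp[OF that(1,2)] that(3)]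
      by (simp only: B_lin_left B_lin_right) (simp add: algebra_simps)
  qed
  have "derivation Y"
    unfolding derivation_def
  proof (intro allI impI)
    fix u v l assume l: "l < n"
    have BB: "B u' v' m = (\<Sum>i<n. q u i * (\<Sum>j<n. q v j * B (f i) (g j) m))"
      if "\<And>i. i < n \<Longrightarrow> u' i = (\<Sum>k<n. q u k * f k i)" "\<And>i. i < n \<Longrightarrow> v' i = (\<Sum>k<n. q v k * g k i)"
      for u' v' f g m
    proof -
      have "B u' v' m = B (\<lambda>i. \<Sum>k<n. q u k * f k i) (\<lambda>i. \<Sum>k<n. q v k * g k i) m"
        using that by (rule B_cong)
      then show ?thesis by (simp add: B_sum_left B_sum_right)
    qed
    have Yexp: "app Y w i = (\<Sum>k<n. q w k * app Y (p k) i)" if "i < n" for w i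
      using app_cong[of w "\<lambda>i. \<Sum>k<n. q w k * p k i" Y i] by (simp add: expand app_sum)
    have "app Y (B u v) l = app Y (\<lambda>m. \<Sum>i<n. q u i * (\<Sum>j<n. q v j * B (p i) (p j) m)) l"
      by (intro app_cong BB) (simp_all add: expand)
    also have "\<dots> = (\<Sum>i<n. q u i * (\<Sum>j<n. q v j * app Y (B (p i) (p j)) l))"
      by (simp add: app_sum)
    also have "\<dots> = (\<Sum>i<n. q u i * (\<Sum>j<n. q v j * B (app Y (p i)) (p j) l)) +
        (\<Sum>i<n. q u i * (\<Sum>j<n. q v j * B (p i) (app Y (p j)) l))"
    proof -
      have "q v j * app Y (B (p i) (p j)) l =
          q v j * B (app Y (p i)) (p j) l + q v j * B (p i) (app Y (p j)) l" if "i < n" "j < n" for i j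
        unfolding Ypp[OF that l] by (rule distrib_left)
      then have "(\<Sum>j<n. q v j * app Y (B (p i) (p j)) l) =
          (\<Sum>j<n. q v j * B (app Y (p i)) (p j) l) + (\<Sum>j<n. q v j * B (p i) (app Y (p j)) l)"
        if "i < n" for i
        unfolding sum.distrib[symmetric] using that by (intro sum.cong) auto
      then show ?thesis
        unfolding sum.distrib[symmetric] distrib_left[symmetric] by (intro sum.cong) auto
    qed
    also have "\<dots> = B (app Y u) v l + B u (app Y v) l"
    proof -
      have "B (app Y u) v l = (\<Sum>i<n. q u i * (\<Sum>j<n. q v j * B (app Y (p i)) (p j) l))"
        by (rule BB[OF Yexp expand[symmetric]])
      moreover have "B u (app Y v) l = (\<Sum>i<n. q u i * (\<Sum>j<n. q v j * B (p i) (app Y (p j)) l))"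
        by (rule BB[OF expand[symmetric] Yexp])
      ultimately show ?thesis by simp
    qed
    finally show "app Y (B u v) l = B (app Y u) v l + B u (app Y v) l" .
  qed
  then have "0 = (\<Sum>i<n. \<Sum>j<n. A i j * Y j i)" using tr by simp
  also have "\<dots> = (\<Sum>i<n. \<Sum>j<n. \<Sum>k<n. cnj (a k) * (Q k i * (A i j * P j k)))"
    unfolding Y_def sum_distrib_left by (simp add: mult_ac)
  also have "\<dots> = (\<Sum>i<n. \<Sum>k<n. \<Sum>j<n. cnj (a k) * (Q k i * (A i j * P j k)))"
    by (rule sum.cong[OF refl], rule sum.swap)
  also have "\<dots> = (\<Sum>k<n. \<Sum>i<n. \<Sum>j<n. cnj (a k) * (Q k i * (A i j * P j k)))"
    by (rule sum.swap)
  also have "\<dots> = (\<Sum>k<n. cnj (a k) * q (app A (p k)) k)"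
    by (simp add: q_def app_def p_def sum_distrib_left)
  \<comment> \<open>The diagonal entries of \<open>A\<close> in the Jordan basis are the
    \<open>a k\<close>; the entries above the diagonal do not contribute.\<close>
  also have "\<dots> = (\<Sum>k<n. cnj (a k) * a k)"
  proof (intro sum.cong refl)
    fix k assume "k \<in> {..<n}"
    then show "cnj (a k) * q (app A (p k)) k = cnj (a k) * a k"
      by (simp add: qA qp)
  qed
  also have "\<dots> = of_real (\<Sum>k<n. (cmod (a k))\<^sup>2)"
    by (simp add: complex_norm_square[symmetric] mult.commute[of "cnj _"] flip: of_real_power)
  finally have "(\<Sum>k<n. (cmod (a k))\<^sup>2) = 0" by (metis of_real_eq_0_iff)
  then have a0: "a k = 0" if "k < n" for k
    using that by (simp add: sum_nonneg_eq_0_iff)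
  \<comment> \<open>With all \<open>a k\<close> zero, each application of \<open>A\<close> moves the
    coordinates down by one, so after \<open>d\<close> steps the last \<open>d\<close>
    vanish.\<close>
  have "\<forall>k<n. n \<le> k + d \<longrightarrow> q ((app A ^^ d) u) k = 0" for d
  proof (induction d)
    case (Suc d)
    then show ?case by (simp add: qA a0)
  qed simp
  from this[of n] have "q ((app A ^^ n) u) k = 0" if "k < n" for k using that by simp
  then show ?thesis using expand[OF i, of "(app A ^^ n) u"] by simp
qed

section \<open>Coordinates, trace and Killing form\<close>

context fd_lie_algebra
begin

lemma some_basis: "independent some_basis" "span some_basis = UNIV"
proof -
  obtain B where "independent B" "span B = UNIV"
    using maximal_independent_subset_extend[of "{}" UNIV] by (metis UNIV_I empty_subsetI independent_empty subsetI subset_antisym)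
  then have "\<exists>B. independent B \<and> span B = UNIV" by blast
  from someI_ex[OF this] show "independent some_basis" "span some_basis = UNIV"
    unfolding some_basis_def by auto
qed

lemma finite_some_basis [simp]: "finite some_basis"
proof -
  obtain B where "finite B" "span B = UNIV" using finite_dimensional by blast
  then show ?thesis using independent_span_bound[of B some_basis] some_basis by auto
qed

sublocale fdv: finite_dimensional_vector_space scale some_basis
  by unfold_locales (simp_all add: some_basis)

lemma coord_linear [simp]:
  "coord b (x + y) = coord b x + coord b y" "coord b (scale c x) = c * coord b x"
  "coord b 0 = 0" "coord b (x - y) = coord b x - coord b y" "coord b (- x) = - coord b x"
  using some_basis
  by (simp_all add: coord_def representation_add representation_scale representation_zero
      representation_diff representation_neg)

lemma coord_sum: "coord b (sum f A) = (\<Sum>a\<in>A. coord b (f a))"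
  by (induction A rule: infinite_finite_induct) auto

lemma sum_coord: "(\<Sum>b\<in>some_basis. scale (coord b x) b) = x"
  unfolding coord_def using some_basis by (intro sum_representation_eq) auto

lemma coord_basis: "c \<in> some_basis \<Longrightarrow> coord b c = (if b = c then 1 else 0)"
  using some_basis by (auto simp: coord_def representation_basis)

lemma coord_eqI: "(\<And>b. b \<in> some_basis \<Longrightarrow> coord b x = coord b y) \<Longrightarrow> x = y"
  using sum_coord[of x] sum_coord[of y] by (metis (no_types, lifting) sum.cong)

lemma br_linear [simp]:
  "br 0 x = 0" "br x 0 = 0" "br (- x) y = - br x y" "br x (- y) = - br x y"
  "br (x - y) z = br x z - br y z" "br x (y - z) = br x y - br x z"
proof -
  show [simp]: "br 0 x = 0" "br x 0 = 0" for x
    using br_scale_left[of 0 0 x] br_scale_right[of x 0 0] by auto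
  show "br (- x) y = - br x y" for x y using br_add_left[of x "- x" y] by (simp add: eq_neg_iff_add_eq_0 add.commute)
  show "br x (- y) = - br x y" for x y using br_add_right[of x y "- y"] by (simp add: eq_neg_iff_add_eq_0 add.commute)
  show "br (x - y) z = br x z - br y z"
    using br_add_left[of "x - y" y z] by (simp add: algebra_simps)
  show "br x (y - z) = br x y - br x z"
    using br_add_right[of x "y - z" z] by (simp add: algebra_simps)
qed

lemma br_anti: "br y x = - br x y"
proof -
  have "br x y + br y x = 0"
    using br_self[of "x + y"] unfolding br_add_left br_add_right by (simp add: br_self add.commute)
  then show ?thesis by (simp add: add_eq_0_iff)
qed

lemma br_sum_left: "br (sum f A) x = (\<Sum>a\<in>A. br (f a) x)"
  by (induction A rule: infinite_finite_induct) (auto simp: br_add_left)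

lemma br_sum_right: "br x (sum f A) = (\<Sum>a\<in>A. br x (f a))"
  by (induction A rule: infinite_finite_induct) (auto simp: br_add_right)

lemma jacobi': "br (br x y) z = br x (br y z) - br y (br x z)"
  using jacobi[of x y z] br_anti[of z "br x y"] br_anti[of z x]
  by (simp add: algebra_simps eq_neg_iff_add_eq_0)

definition endo :: "('g \<Rightarrow> 'g) \<Rightarrow> bool" where
  "endo f \<longleftrightarrow> (\<forall>x y. f (x + y) = f x + f y) \<and> (\<forall>c x. f (scale c x) = scale c (f x))"

lemma endo_sum_scale: "endo f \<Longrightarrow> f (\<Sum>a\<in>A. scale (g a) (h a)) = (\<Sum>a\<in>A. scale (g a) (f (h a)))"
proof (induction A rule: infinite_finite_induct)
  case (insert x F)
  then show ?case by (simp add: endo_def)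
qed (metis endo_def scale_zero_left sum.infinite sum.empty)+

lemma coord_endo: "endo f \<Longrightarrow> coord b (f x) = (\<Sum>c\<in>some_basis. coord c x * coord b (f c))"
  by (subst sum_coord[of x, symmetric], subst endo_sum_scale) (auto simp: coord_sum)

lemma endo_br [simp]: "endo (br x)"
  by (simp add: endo_def br_add_right br_scale_right)

lemma endo_br_br [simp]: "endo (\<lambda>z. br x (br y z))"
  by (simp add: endo_def br_add_right br_scale_right)

lemma trace_comp_commute:
  assumes "endo f" "endo g"
  shows "trace (\<lambda>z. f (g z)) = trace (\<lambda>z. g (f z))"
proof -
  have "trace (\<lambda>z. f (g z)) = (\<Sum>b\<in>some_basis. \<Sum>c\<in>some_basis. coord c (g b) * coord b (f c))"
    unfolding trace_def by (simp add: coord_endo[OF assms(1), of _ "g _"])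
  also have "\<dots> = (\<Sum>c\<in>some_basis. \<Sum>b\<in>some_basis. coord b (f c) * coord c (g b))"
    by (subst sum.swap) (simp add: mult.commute)
  also have "\<dots> = trace (\<lambda>z. g (f z))"
    unfolding trace_def by (simp add: coord_endo[OF assms(2), of _ "f _"])
  finally show ?thesis .
qed

lemma trace_linear:
  "trace (\<lambda>z. f z + g z) = trace f + trace g" "trace (\<lambda>z. f z - g z) = trace f - trace g"
  "trace (\<lambda>z. scale c (f z)) = c * trace f"
  by (simp_all add: trace_def sum.distrib sum_subtractf sum_distrib_left)

text \<open>The adjoint actions of the basis vectors of the copy of sl(2) are sums of such
  operators, so their Killing form is read off without matrices.\<close>

lemma trace_rank_one:
  assumes "\<And>x y. \<alpha> (x + y) = \<alpha> x + \<alpha> y" "\<And>c x. \<alpha> (scale c x) = c * \<alpha> x"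
  shows "trace (\<lambda>z. scale (\<alpha> z) s) = \<alpha> s"
proof -
  have "\<alpha> 0 = 0" using assms(2)[of 0 0] by simp
  then have "\<alpha> (sum f A) = (\<Sum>a\<in>A. \<alpha> (f a))" for f :: "'g \<Rightarrow> 'g" and A
    by (induction A rule: infinite_finite_induct) (simp_all add: assms(1))
  then have "\<alpha> s = (\<Sum>b\<in>some_basis. coord b s * \<alpha> b)"
    by (subst sum_coord[of s, symmetric]) (simp add: assms(2))
  then show ?thesis by (simp add: trace_def mult.commute)
qed

lemma killing_linear [simp]:
  "killing (x + y) z = killing x z + killing y z" "killing x (y + z) = killing x y + killing x z"
  "killing (scale c x) y = c * killing x y" "killing x (scale c y) = c * killing x y"
  by (simp_all add: killing_def br_add_left br_add_right br_scale_left br_scale_right trace_linear)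

lemma killing_zero [simp]: "killing 0 x = 0" "killing x 0 = 0"
  by (simp_all add: killing_def trace_def)

lemma killing_diff [simp]: "killing (x - y) z = killing x z - killing y z"
  using killing_linear(1)[of "x - y" y z] by simp

lemma killing_sum: "killing (sum f A) y = (\<Sum>a\<in>A. killing (f a) y)" "killing y (sum f A) = (\<Sum>a\<in>A. killing y (f a))"
  by (induction A rule: infinite_finite_induct) auto

lemma killing_br: "killing (br x y) z = killing x (br y z)"
proof -
  have "trace (\<lambda>w. br y (br x (br z w))) = trace (\<lambda>w. br x (br z (br y w)))"
    by (rule trace_comp_commute[of "br y" "\<lambda>w. br x (br z w)"]) auto
  then show ?thesis
    by (simp add: killing_def jacobi' trace_linear)
qed

definition killing_radical :: "'g set" where
  "killing_radical = {x. \<forall>y. killing x y = 0}"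

text \<open>For \<open>X = [a, b]\<close> with \<open>a\<close> in the radical and a derivation
  \<open>Y\<close>, the trace of \<open>ad X\<close> times \<open>Y\<close> is minus the trace of
  \<open>ad a\<close> times \<open>[Y, ad b] = ad (Y b)\<close>, that is, minus the Killing form of
  \<open>a\<close> and \<open>Y b\<close>, hence zero. As \<open>Y b\<close> has complex
  coordinates, it is expanded in the basis and the form vanishes on each basis vector.\<close>

lemma ad_nilpotent_if_bracket_of_killing_radical:
  fixes \<phi> :: "'k \<Rightarrow> complex"
  assumes \<phi>: "inj \<phi>" "\<And>x y. \<phi> (x + y) = \<phi> x + \<phi> y" "\<And>x y. \<phi> (x * y) = \<phi> x * \<phi> y"
    and X: "X \<in> span {br a b | a b. a \<in> killing_radical}"
  shows "(br X ^^ card some_basis) x = 0"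
proof -
  define n where "n = card some_basis"
  obtain e where e: "bij_betw e {..<n} some_basis"
    using ex_bij_betw_nat_finite[OF finite_some_basis] by (auto simp: n_def lessThan_atLeast0)
  have \<phi>0 [simp]: "\<phi> 0 = 0" using \<phi>(2)[of 0 0] by simp
  have \<phi>sum: "\<phi> (sum f A) = (\<Sum>a\<in>A. \<phi> (f a))" for f :: "'c \<Rightarrow> 'k" and A
    by (induction A rule: infinite_finite_induct) (simp_all add: \<phi>)
  have \<phi>neg: "\<phi> (x - y) = \<phi> x - \<phi> y" for x y
    using \<phi>(2)[of "x - y" y] by simp
  define co where "co = (\<lambda>k x. \<phi> (coord (e k) x))"
  have co_add: "co k (x + y) = co k x + co k y" for k x y by (simp add: co_def \<phi>)
  have co_diff: "co k (x - y) = co k x - co k y" for k x y by (simp add: co_def \<phi>neg)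
  have co_scale: "co k (scale r x) = \<phi> r * co k x" for k r x by (simp add: co_def \<phi>)
  have co_endo: "co k (f x) = (\<Sum>j<n. co j x * co k (f (e j)))" if "endo f" for f k x
    by (simp add: co_def coord_endo[OF that, of _ x] \<phi>sum \<phi> sum.reindex_bij_betw[OF e, symmetric])
  have co_right: "co k (br x y) = (\<Sum>j<n. co j y * co k (br x (e j)))" for k x y
    using co_endo[of "br x" k y] by simp
  have "endo (\<lambda>x. br x y)" for y by (simp add: endo_def br_add_left br_scale_left)
  then have co_left: "co k (br x y) = (\<Sum>j<n. co j x * co k (br (e j) y))" for k x y
    using co_endo[of "\<lambda>x. br x y" k x] by simp
  have co_eqI: "x = y" if "\<And>k. k < n \<Longrightarrow> co k x = co k y" for x y
  proof (rule coord_eqI)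
    fix b assume "b \<in> some_basis"
    then obtain k where "k < n" "b = e k" using e by (auto simp: bij_betw_def)
    then show "coord b x = coord b y" using that[of k] \<phi>(1) by (simp add: co_def inj_eq)
  qed
  \<comment> \<open>\<open>c\<close> holds the structure constants and \<open>A X\<close> the matrix
    of \<open>ad X\<close>, both in complex coordinates.\<close>
  define c where "c = (\<lambda>i j k. co k (br (e i) (e j)))"
  define A where "A = (\<lambda>X i j. co i (br X (e j)))"
  define app where "app = (\<lambda>M u i. \<Sum>j<n. (M :: nat \<Rightarrow> nat \<Rightarrow> complex) i j * u j)"
  define B where "B = (\<lambda>u v l. \<Sum>i<n. \<Sum>j<n. u i * v j * c i j l)"
  define derivation where "derivation = (\<lambda>M. \<forall>u v. \<forall>l<n. app M (B u v) l = B (app M u) v l + B u (app M v) l)"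
  have B_co: "B (\<lambda>i. co i x) (\<lambda>i. co i y) l = co l (br x y)" for x y l
    by (simp add: co_left[of l x] co_right[of l "e _" y] B_def c_def sum_distrib_left mult_ac)
  have app_co: "app (A X) (\<lambda>i. co i x) l = co l (br X x)" for X x l
    by (simp add: co_right[of l X x] app_def A_def mult.commute)
  have A_der: "derivation (A X)" for X
    unfolding derivation_def
  proof (intro allI impI)
    fix u v l
    have *: "(\<Sum>k<n. A X l k * c i j k) = (\<Sum>k<n. A X k i * c k j l) + (\<Sum>k<n. A X k j * c i k l)" for i j
    proof -
      have "co l (br X (br (e i) (e j))) = co l (br (br X (e i)) (e j)) + co l (br (e i) (br X (e j)))"
        by (simp add: jacobi' co_diff)
      then show ?thesis
        by (simp add: co_right[of l X "br _ _"] co_left[of l "br X (e i)"] co_right[of l "e i" "br X _"]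
            A_def c_def mult_ac)
    qed
    have "app (A X) (B u v) l = (\<Sum>i<n. \<Sum>j<n. u i * v j * (\<Sum>k<n. A X l k * c i j k))"
    proof -
      have "app (A X) (B u v) l = (\<Sum>k<n. \<Sum>i<n. \<Sum>j<n. u i * v j * (A X l k * c i j k))"
        by (simp add: app_def B_def sum_distrib_left mult_ac)
      also have "\<dots> = (\<Sum>i<n. \<Sum>k<n. \<Sum>j<n. u i * v j * (A X l k * c i j k))" by (rule sum.swap)
      also have "\<dots> = (\<Sum>i<n. \<Sum>j<n. \<Sum>k<n. u i * v j * (A X l k * c i j k))"
        by (rule sum.cong[OF refl], rule sum.swap)
      finally show ?thesis by (simp add: sum_distrib_left)
    qed
    also have "\<dots> = (\<Sum>i<n. \<Sum>j<n. \<Sum>k<n. u i * v j * (A X k i * c k j l)) +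
        (\<Sum>i<n. \<Sum>j<n. \<Sum>k<n. u i * v j * (A X k j * c i k l))"
      by (simp add: * distrib_left sum.distrib sum_distrib_left)
    also have "(\<Sum>i<n. \<Sum>j<n. \<Sum>k<n. u i * v j * (A X k i * c k j l)) =
        (\<Sum>i<n. \<Sum>k<n. \<Sum>j<n. u i * v j * (A X k i * c k j l))"
      by (rule sum.cong[OF refl], rule sum.swap)
    also have "\<dots> = (\<Sum>k<n. \<Sum>i<n. \<Sum>j<n. u i * v j * (A X k i * c k j l))" by (rule sum.swap)
    also have "\<dots> = (\<Sum>k<n. \<Sum>j<n. \<Sum>i<n. u i * v j * (A X k i * c k j l))"
      by (rule sum.cong[OF refl], rule sum.swap)
    also have "\<dots> = B (app (A X) u) v l"
      by (simp add: B_def app_def sum_distrib_left sum_distrib_right mult_ac)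
    also have "(\<Sum>i<n. \<Sum>j<n. \<Sum>k<n. u i * v j * (A X k j * c i k l)) =
        (\<Sum>i<n. \<Sum>k<n. \<Sum>j<n. u i * v j * (A X k j * c i k l))"
      by (rule sum.cong[OF refl], rule sum.swap)
    also have "\<dots> = B u (app (A X) v) l"
      by (simp add: B_def app_def sum_distrib_left sum_distrib_right mult_ac)
    finally show "app (A X) (B u v) l = B (app (A X) u) v l + B u (app (A X) v) l" .
  qed
  have "(\<Sum>i<n. \<Sum>j<n. A X i j * Y j i) = 0" if Y: "derivation Y" for Y
    using X
  proof (induction rule: span_induct_alt)
    case base
    then show ?case by (simp add: A_def co_def)
  next
    case (step r z y)
    then obtain a b where z: "z = br a b" and a: "a \<in> killing_radical" by auto
    \<comment> \<open>Entry \<open>(k, i)\<close> of \<open>[Y, ad b] = ad (Y b)\<close>, from the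
      derivation rule applied to \<open>b\<close> and the \<open>i\<close>-th unit vector
      \<open>d\<close>.\<close>
    have bY: "(\<Sum>j<n. Y k j * A b j i) - (\<Sum>j<n. A b k j * Y j i) =
        (\<Sum>m<n. app Y (\<lambda>j. co j b) m * c m i k)" if ik: "i < n" "k < n" for i k
    proof -
      define d where "d = (\<lambda>j. if j = i then 1 else 0 :: complex)"
      have 1: "B u d m = (\<Sum>j<n. u j * c j i m)" for u m
      proof -
        have "u r * d j * c r j m = (if j = i then u r * c r j m else 0)" for r j
          by (simp add: d_def)
        then show ?thesis using ik by (simp add: B_def)
      qed
      have bA: "A b j m = (\<Sum>r<n. co r b * c r m j)" for j m
        by (simp add: A_def c_def co_left[of j b])
      have 2: "app Y d j = Y j i" for j
        using ik by (simp add: app_def d_def if_distrib cong: if_cong)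
      have "app Y (B (\<lambda>j. co j b) d) k = B (app Y (\<lambda>j. co j b)) d k + B (\<lambda>j. co j b) (app Y d) k"
        using Y ik by (simp add: derivation_def)
      moreover have "app Y (B (\<lambda>j. co j b) d) k = (\<Sum>j<n. Y k j * A b j i)"
        by (simp add: app_def 1 bA)
      moreover have "B (\<lambda>j. co j b) (app Y d) k = (\<Sum>j<n. A b k j * Y j i)"
        unfolding B_def 2 bA sum_distrib_right by (subst sum.swap) (simp add: mult_ac)
      ultimately show ?thesis by (simp add: 1)
    qed
    have Kil: "(\<Sum>i<n. \<Sum>k<n. A a i k * c m i k) = 0" if "m < n" for m
    proof -
      have "(\<Sum>i<n. \<Sum>k<n. A a i k * c m i k) = (\<Sum>i<n. co i (br a (br (e m) (e i))))"
        by (simp add: co_right[of _ a "br _ _"] A_def c_def mult.commute)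
      also have "\<dots> = \<phi> (killing a (e m))"
        by (simp add: killing_def trace_def \<phi>sum co_def sum.reindex_bij_betw[OF e, symmetric])
      finally show ?thesis using a by (simp add: killing_radical_def)
    qed
    have "(\<Sum>i<n. \<Sum>j<n. A z i j * Y j i) =
        (\<Sum>i<n. \<Sum>j<n. \<Sum>k<n. A a i k * (A b k j * Y j i)) - (\<Sum>i<n. \<Sum>j<n. \<Sum>k<n. A a k j * (Y j i * A b i k))"
      unfolding z
      by (simp add: A_def jacobi' co_diff co_right[of _ a "br b _"] co_right[of _ b "br a _"]
          sum_subtractf left_diff_distrib right_diff_distrib sum_distrib_left sum_distrib_right mult_ac)
    also have "(\<Sum>i<n. \<Sum>j<n. \<Sum>k<n. A a i k * (A b k j * Y j i)) =
        (\<Sum>i<n. \<Sum>k<n. A a i k * (\<Sum>j<n. A b k j * Y j i))"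
      unfolding sum_distrib_left by (rule sum.cong[OF refl], rule sum.swap)
    also have "(\<Sum>i<n. \<Sum>j<n. \<Sum>k<n. A a k j * (Y j i * A b i k)) =
        (\<Sum>k<n. \<Sum>j<n. A a k j * (\<Sum>i<n. Y j i * A b i k))"
    proof -
      have "(\<Sum>i<n. \<Sum>j<n. \<Sum>k<n. A a k j * (Y j i * A b i k)) =
          (\<Sum>j<n. \<Sum>i<n. \<Sum>k<n. A a k j * (Y j i * A b i k))" by (rule sum.swap)
      also have "\<dots> = (\<Sum>j<n. \<Sum>k<n. \<Sum>i<n. A a k j * (Y j i * A b i k))"
        by (rule sum.cong[OF refl], rule sum.swap)
      also have "\<dots> = (\<Sum>k<n. \<Sum>j<n. \<Sum>i<n. A a k j * (Y j i * A b i k))" by (rule sum.swap)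
      finally show ?thesis by (simp add: sum_distrib_left)
    qed
    also have "(\<Sum>i<n. \<Sum>k<n. A a i k * (\<Sum>j<n. A b k j * Y j i)) -
        (\<Sum>k<n. \<Sum>j<n. A a k j * (\<Sum>i<n. Y j i * A b i k)) =
        - (\<Sum>i<n. \<Sum>k<n. A a i k * ((\<Sum>j<n. Y k j * A b j i) - (\<Sum>j<n. A b k j * Y j i)))"
      by (simp add: right_diff_distrib sum_subtractf)
    also have "\<dots> = - (\<Sum>i<n. \<Sum>k<n. \<Sum>m<n. app Y (\<lambda>j. co j b) m * (A a i k * c m i k))"
    proof -
      have "A a i k * ((\<Sum>j<n. Y k j * A b j i) - (\<Sum>j<n. A b k j * Y j i)) =
          (\<Sum>m<n. app Y (\<lambda>j. co j b) m * (A a i k * c m i k))" if "i < n" "k < n" for i k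
        unfolding bY[OF that] by (simp add: sum_distrib_left mult_ac)
      then show ?thesis by (intro arg_cong[where f = uminus] sum.cong) auto
    qed
    also have "\<dots> = - (\<Sum>i<n. \<Sum>m<n. \<Sum>k<n. app Y (\<lambda>j. co j b) m * (A a i k * c m i k))"
      by (rule arg_cong[where f = uminus], rule sum.cong[OF refl], rule sum.swap)
    also have "\<dots> = - (\<Sum>m<n. \<Sum>i<n. \<Sum>k<n. app Y (\<lambda>j. co j b) m * (A a i k * c m i k))"
      by (rule arg_cong[where f = uminus], rule sum.swap)
    also have "\<dots> = 0" by (simp add: Kil flip: sum_distrib_left)
    finally have z0: "(\<Sum>i<n. \<Sum>j<n. A z i j * Y j i) = 0" .
    have "A (scale r z + y) i j = \<phi> r * A z i j + A y i j" for i j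
      by (simp add: A_def br_add_left br_scale_left co_add co_scale)
    then have "(\<Sum>i<n. \<Sum>j<n. A (scale r z + y) i j * Y j i) =
        \<phi> r * (\<Sum>i<n. \<Sum>j<n. A z i j * Y j i) + (\<Sum>i<n. \<Sum>j<n. A y i j * Y j i)"
      by (simp add: distrib_left distrib_right sum.distrib sum_distrib_left mult_ac)
    then show ?case using z0 step.IH by simp
  qed
  then have nil: "(app (A X) ^^ n) u i = 0" if "i < n" for u i
    using nilpotent_if_orthogonal_to_derivations[of n "A X" c i u] A_der[of X] that
    unfolding derivation_def app_def B_def by blast
  have "(app (A X) ^^ m) (\<lambda>i. co i x) = (\<lambda>i. co i ((br X ^^ m) x))" for m
    by (induction m) (auto simp: app_co)
  then have "co i ((br X ^^ n) x) = 0" if "i < n" for i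
    using nil[OF that, of "\<lambda>i. co i x"] by simp
  then show ?thesis
    unfolding n_def[symmetric] by (intro co_eqI) (simp add: co_def)
qed

section \<open>Engel's theorem for ad-nilpotent subalgebras\<close>

definition subalgebra :: "'g set \<Rightarrow> bool" where
  "subalgebra M \<longleftrightarrow> subspace M \<and> (\<forall>x\<in>M. \<forall>y\<in>M. br x y \<in> M)"

definition ad_nilpotent :: "'g \<Rightarrow> bool" where
  "ad_nilpotent x \<longleftrightarrow> (\<exists>N. \<forall>z. (br x ^^ N) z = 0)"

definition stable :: "'g set \<Rightarrow> 'g set \<Rightarrow> bool" where
  "stable M W \<longleftrightarrow> subspace W \<and> (\<forall>m\<in>M. \<forall>w\<in>W. br m w \<in> W)"

text \<open>The conclusion of Engel's theorem for the action of \<open>M\<close> on a subquotient \<open>U/W\<close> of \<open>\<gg>\<close>, phrased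
  without quotients.\<close>

definition engel :: "'g set \<Rightarrow> bool" where
  "engel M \<longleftrightarrow> (\<forall>W U. stable M W \<longrightarrow> stable M U \<longrightarrow> W \<subset> U \<longrightarrow> (\<exists>u\<in>U - W. \<forall>m\<in>M. br m u \<in> W))"

lemma dim_less: "subspace S \<Longrightarrow> subspace T \<Longrightarrow> S \<subset> T \<Longrightarrow> dim S < dim T"
  by (rule fdv.dim_psubset) (simp add: span_eq_iff[THEN iffD2])

text \<open>\<open>M'\<close> is a proper subalgebra of maximal dimension. Adjoining an
  \<open>X\<close> that normalizes it gives a larger subalgebra, which must be \<open>M\<close>.
  Engel's theorem is a hypothesis for proper subalgebras only, so that the lemma can serve inside
  its inductive proof.\<close>

lemma codim_one_subalgebra:
  assumes M: "subalgebra M" "M \<noteq> {0}"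
    and engel: "\<And>M'. subalgebra M' \<Longrightarrow> M' \<subset> M \<Longrightarrow> engel M'"
  obtains M' X where "subalgebra M'" "M' \<subset> M" "X \<in> M" "\<And>m. m \<in> M' \<Longrightarrow> br m X \<in> M'"
    "\<And>y. y \<in> M \<Longrightarrow> \<exists>m c. m \<in> M' \<and> y = m + scale c X"
proof -
  have sM: "subspace M" using M by (simp add: subalgebra_def)
  let ?P = "\<lambda>M'. subalgebra M' \<and> M' \<subset> M"
  have "?P {0}" using M subspace_0[OF sM] by (auto simp: subalgebra_def subspace_def)
  moreover have "\<forall>M'. ?P M' \<longrightarrow> dim M' < dim M"
    using dim_less sM by (auto simp: subalgebra_def)
  ultimately obtain M' where M': "?P M'" and max: "\<And>N. ?P N \<Longrightarrow> dim N \<le> dim M'"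
    using ex_has_greatest_nat[of ?P "{0}" dim "dim M"] by blast
  have sM': "subspace M'" using M' by (simp add: subalgebra_def)
  \<comment> \<open>Engel's theorem for the action of \<open>M'\<close> on the quotient of
    \<open>M\<close> by \<open>M'\<close> yields \<open>X\<close> outside \<open>M'\<close> with
    \<open>[M', X]\<close> in \<open>M'\<close>.\<close>
  have "stable M' M'" "stable M' M"
    using M' M by (auto simp: stable_def subalgebra_def)
  then obtain X where X: "X \<in> M - M'" "\<And>m. m \<in> M' \<Longrightarrow> br m X \<in> M'"
    using engel[of M'] M' unfolding engel_def by blast
  define N where "N = {m + scale c X | m c. m \<in> M'}"
  have Ni: "m + scale c X \<in> N" if "m \<in> M'" for m c using that by (auto simp: N_def)
  have "subspace N"
    unfolding subspace_def
  proof (intro conjI ballI allI)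
    show "0 \<in> N" using Ni[of 0 0] subspace_0[OF sM'] by simp
  next
    fix x y assume "x \<in> N" "y \<in> N"
    then obtain m c m' c' where "m \<in> M'" "m' \<in> M'" "x = m + scale c X" "y = m' + scale c' X"
      by (auto simp: N_def)
    then show "x + y \<in> N"
      using Ni[of "m + m'" "c + c'"] subspace_add[OF sM'] by (simp add: algebra_simps)
  next
    fix r x assume "x \<in> N"
    then obtain m c where "m \<in> M'" "x = m + scale c X" by (auto simp: N_def)
    then show "scale r x \<in> N"
      using Ni[of "scale r m" "r * c"] subspace_scale[OF sM'] by (simp add: algebra_simps)
  qed
  moreover have "br x y \<in> N" if xy: "x \<in> N" "y \<in> N" for x y
  proof -
    obtain m c m' c' where m: "m \<in> M'" "m' \<in> M'" "x = m + scale c X" "y = m' + scale c' X"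
      using xy by (auto simp: N_def)
    have "br x y = br m m' + scale c' (br m X) - scale c (br m' X)"
      by (simp add: m br_add_left br_add_right br_scale_left br_scale_right br_self br_anti[of X])
    also have "\<dots> \<in> M'"
      using m X(2) M' by (intro subspace_diff[OF sM'] subspace_add[OF sM'] subspace_scale[OF sM'])
        (auto simp: subalgebra_def)
    finally show ?thesis using Ni[of _ 0] by simp
  qed
  ultimately have N: "subalgebra N" by (simp add: subalgebra_def)
  have "M' \<subset> N" using Ni[of _ 0] Ni[of 0 1] X(1) subspace_0[OF sM'] by auto
  then have "\<not> ?P N" using max[of N] dim_less[of M' N] N sM' by (auto simp: subalgebra_def)
  moreover have "N \<subseteq> M"
    using M' X(1) subspace_add[OF sM] subspace_scale[OF sM] by (auto simp: N_def)
  ultimately have "N = M" using N by blast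
  then have dec: "\<exists>m c. m \<in> M' \<and> y = m + scale c X" if "y \<in> M" for y
    using that by (auto simp: N_def)
  have "X \<in> M" "subalgebra M'" "M' \<subset> M" using M' X(1) by blast+
  then show thesis using that X(2) dec by metis
qed

text \<open>Induction on the dimension. The hypothesis for \<open>M'\<close> of codimension one
  gives a vector killed by \<open>M'\<close> modulo \<open>W\<close>. Since \<open>[M', X]\<close>
  is in \<open>M'\<close>, its images under powers of \<open>br X\<close> share this property, and
  the last of them outside \<open>W\<close> is killed by \<open>X\<close> as well.\<close>

lemma engel_ad_nilpotent:
  "subalgebra M \<Longrightarrow> (\<And>x. x \<in> M \<Longrightarrow> ad_nilpotent x) \<Longrightarrow> engel M"
proof (induction "dim M" arbitrary: M rule: less_induct)
  case less
  note M = less.prems(1) and nil = less.prems(2)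
  show ?case
  proof (cases "M = {0}")
    case True
    then show ?thesis by (auto simp: engel_def stable_def subspace_0)
  next
    case False
    have IH: "engel M'" if "subalgebra M'" "M' \<subset> M" for M'
      using less.hyps[of M'] that dim_less[of M' M] M nil by (auto simp: subalgebra_def)
    obtain M' X where M': "subalgebra M'" "M' \<subset> M" and X: "X \<in> M" "\<And>m. m \<in> M' \<Longrightarrow> br m X \<in> M'"
      and dec: "\<And>y. y \<in> M \<Longrightarrow> \<exists>m c. m \<in> M' \<and> y = m + scale c X"
      using codim_one_subalgebra[OF M False IH] by metis
    show ?thesis
      unfolding engel_def
    proof (intro allI impI)
      fix W U assume WU: "stable M W" "stable M U" "W \<subset> U"
      have sW: "subspace W" using WU by (simp add: stable_def)
      have "stable M' W" "stable M' U" using WU M' by (auto simp: stable_def)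
      then obtain u0 where u0: "u0 \<in> U" "u0 \<notin> W" "\<forall>m\<in>M'. br m u0 \<in> W"
        using IH[OF M'] WU(3) unfolding engel_def by blast
      have U': "(br X ^^ k) u0 \<in> U \<and> (\<forall>m\<in>M'. br m ((br X ^^ k) u0) \<in> W)" for k
      proof (induction k)
        case (Suc k)
        let ?u = "(br X ^^ k) u0"
        have "br m (br X ?u) \<in> W" if m: "m \<in> M'" for m
        proof -
          have "br m (br X ?u) = br (br m X) ?u + br X (br m ?u)" by (simp add: jacobi')
          moreover have "br (br m X) ?u \<in> W" "br X (br m ?u) \<in> W"
            using Suc.IH X m WU(1) by (auto simp: stable_def)
          ultimately show ?thesis using subspace_add[OF sW] by simp
        qed
        then show ?case using Suc.IH X WU(2) by (auto simp: stable_def)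
      qed (use u0 in auto)
      obtain k where "(br X ^^ k) u0 = 0" using nil[OF X(1)] by (auto simp: ad_nilpotent_def)
      then have ex: "\<exists>k. (br X ^^ k) u0 \<in> W" using subspace_0[OF sW] by metis
      \<comment> \<open>The first power that falls into \<open>W\<close>; it is not the zeroth, as
        \<open>u0\<close> is outside \<open>W\<close>, so it has a predecessor.\<close>
      define k where "k = (LEAST k. (br X ^^ k) u0 \<in> W)"
      have k: "(br X ^^ k) u0 \<in> W" unfolding k_def using ex by (rule LeastI_ex)
      with u0 obtain l where l: "k = Suc l" by (cases k) auto
      let ?u = "(br X ^^ l) u0"
      have "?u \<notin> W" using not_less_Least[of l "\<lambda>k. (br X ^^ k) u0 \<in> W"] l by (simp add: k_def)
      moreover have "br y ?u \<in> W" if "y \<in> M" for y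
      proof -
        obtain m c where "m \<in> M'" "y = m + scale c X" using dec[OF \<open>y \<in> M\<close>] by blast
        then show ?thesis
          using U'[of l] k l by (auto simp: br_add_left br_scale_left intro!: subspace_add[OF sW] subspace_scale[OF sW])
      qed
      ultimately show "\<exists>u\<in>U - W. \<forall>m\<in>M. br m u \<in> W" using U'[of l] by blast
    qed
  qed
qed

text \<open>The subalgebra \<open>M'\<close> of codimension one is an ideal of \<open>M\<close> with
  quotient of dimension one, which is abelian, so all brackets land in \<open>M'\<close>.\<close>

lemma derived_less:
  assumes M: "subalgebra M" "M \<noteq> {0}" and nil: "\<And>x. x \<in> M \<Longrightarrow> ad_nilpotent x"
  shows "span {br x y | x y. x \<in> M \<and> y \<in> M} \<subset> M"
proof -
  have "engel M'" if "subalgebra M'" "M' \<subset> M" for M'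
    using engel_ad_nilpotent[OF that(1)] that(2) nil by blast
  then obtain M' X where M': "subalgebra M'" "M' \<subset> M" and X: "X \<in> M" "\<And>m. m \<in> M' \<Longrightarrow> br m X \<in> M'"
    and dec: "\<And>y. y \<in> M \<Longrightarrow> \<exists>m c. m \<in> M' \<and> y = m + scale c X"
    using codim_one_subalgebra[OF M] by metis
  have sM': "subspace M'" using M' by (simp add: subalgebra_def)
  have "span {br x y | x y. x \<in> M \<and> y \<in> M} \<subseteq> M'"
  proof (rule span_minimal[OF _ sM'], clarify)
    fix x y assume "x \<in> M" "y \<in> M"
    then obtain m c m' c' where m: "m \<in> M'" "m' \<in> M'" "x = m + scale c X" "y = m' + scale c' X"
      using dec by metis
    have "br x y = br m m' + scale c' (br m X) - scale c (br m' X)"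
      by (simp add: m br_add_left br_add_right br_scale_left br_scale_right br_self br_anti[of X])
    also have "\<dots> \<in> M'"
      using m X(2) M' by (intro subspace_diff[OF sM'] subspace_add[OF sM'] subspace_scale[OF sM'])
        (auto simp: subalgebra_def)
    finally show "br x y \<in> M'" .
  qed
  then show ?thesis using M'(2) by blast
qed

lemma derived_series_subalgebra:
  assumes "subalgebra I"
  shows "subalgebra (derived_series I n) \<and> derived_series I (Suc n) \<subseteq> derived_series I n"
proof (induction n)
  case 0
  then show ?case
    using assms span_minimal[of "{br x y | x y. x \<in> I \<and> y \<in> I}" I] by (auto simp: subalgebra_def)
next
  case (Suc n)
  then have "br x y \<in> derived_series I (Suc n)"
    if "x \<in> derived_series I (Suc n)" "y \<in> derived_series I (Suc n)" for x y
    using that by (auto intro!: span_base)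
  then have *: "subalgebra (derived_series I (Suc n))"
    by (simp add: subalgebra_def)
  let ?D = "derived_series I (Suc n)"
  have "span {br x y | x y. x \<in> ?D \<and> y \<in> ?D} \<subseteq> ?D"
    using * by (intro span_minimal) (auto simp: subalgebra_def)
  then show ?case using * by simp
qed

text \<open>From the first derived term on every element is ad-nilpotent, so each nonzero term
  strictly contains the next. If no term were zero, the dimension would drop forever.\<close>

lemma solvable_if_derived_ad_nilpotent:
  assumes I: "subalgebra I" and nil: "\<And>x. x \<in> derived_series I 1 \<Longrightarrow> ad_nilpotent x"
  shows "solvable I"
proof (rule ccontr)
  assume ns: "\<not> solvable I"
  have sub: "subalgebra (derived_series I n)" for n using derived_series_subalgebra[OF I] by blast
  have "derived_series I (Suc n) \<subseteq> derived_series I 1" for n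
  proof (induction n)
    case (Suc n)
    then show ?case using derived_series_subalgebra[OF I, of "Suc n"] by blast
  qed simp
  then have "ad_nilpotent x" if "x \<in> derived_series I (Suc n)" for x n
    using nil that by blast
  moreover have "derived_series I (Suc n) \<noteq> {0}" for n
    using ns by (metis solvable_def)
  ultimately have "derived_series I (Suc (Suc n)) \<subset> derived_series I (Suc n)" for n
    unfolding derived_series.simps(2)[of I "Suc n"] by (intro derived_less sub)
  then have less: "dim (derived_series I (Suc (Suc n))) < dim (derived_series I (Suc n))" for n
    using dim_less sub unfolding subalgebra_def by blast
  have "dim (derived_series I (Suc n)) + n \<le> dim (derived_series I 1)" for n
  proof (induction n)
    case (Suc n)
    then show ?case using less[of n] by linarith
  qed simp
  from this[of "Suc (dim (derived_series I 1))"] show False by simp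
qed

section \<open>Cartan's criterion\<close>

lemma ideal_killing_radical: "ideal killing_radical"
proof -
  have "killing (br x y) z = 0" if "y \<in> killing_radical" for x y z
  proof -
    have "killing (br x y) z = - killing (br y x) z"
      using killing_linear(3)[of "-1" "br y x" z] by (simp add: br_anti[of x y])
    then show ?thesis using that by (simp add: killing_br killing_radical_def)
  qed
  then show ?thesis
    by (auto simp: ideal_def killing_radical_def subspace_def)
qed

lemma subalgebra_ideal: "ideal I \<Longrightarrow> subalgebra I"
  by (auto simp: ideal_def subalgebra_def)

text \<open>The radical of the Killing form is an ideal whose derived algebra is ad-nilpotent; it is
  therefore solvable, hence zero. The embedding of the field is an explicit hypothesis because the
  locale allows any field.\<close>

theorem cartan_criterion:
  assumes ss: semisimple
    and \<phi>: "\<exists>\<phi> :: 'k \<Rightarrow> complex. inj \<phi> \<and> (\<forall>x y. \<phi> (x + y) = \<phi> x + \<phi> y) \<and> (\<forall>x y. \<phi> (x * y) = \<phi> x * \<phi> y)"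
    and x: "\<And>y. killing x y = 0"
  shows "x = 0"
proof -
  obtain \<phi> :: "'k \<Rightarrow> complex" where
    \<phi>: "inj \<phi>" "\<And>x y. \<phi> (x + y) = \<phi> x + \<phi> y" "\<And>x y. \<phi> (x * y) = \<phi> x * \<phi> y"
    using \<phi> by blast
  have "solvable killing_radical"
  proof (rule solvable_if_derived_ad_nilpotent)
    fix y assume "y \<in> derived_series killing_radical 1"
    moreover have "derived_series killing_radical 1 \<subseteq> span {br a b | a b. a \<in> killing_radical}"
      by (auto intro!: span_mono)
    ultimately have "y \<in> span {br a b | a b. a \<in> killing_radical}" by blast
    then show "ad_nilpotent y"
      using ad_nilpotent_if_bracket_of_killing_radical[OF \<phi>] by (auto simp: ad_nilpotent_def)
  qed (intro subalgebra_ideal ideal_killing_radical)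
  then have "killing_radical = {0}"
    using ss ideal_killing_radical by (auto simp: semisimple_def)
  then show ?thesis using x by (auto simp: killing_radical_def)
qed

end


section \<open>Signed shuffle algebra and Schouten bracket\<close>

interpretation amult: Modules.module amult
  by unfold_locales (auto simp: amult_def fun_eq_iff algebra_simps)

lemma amult_minus_one [simp]: "amult (-1) u = - u" "amult (- f) u = - amult f u"
  by (auto simp: amult_def)

lemma amult_apply: "amult f u \<alpha>s = f * u \<alpha>s"
  by (simp add: amult_def)

section \<open>The product of functions on lists\<close>

definition contract :: "('g \<Rightarrow> 'k) \<Rightarrow> ('k::field, 'g) multivector \<Rightarrow> ('k, 'g) multivector" where
  "contract \<alpha> u = (\<lambda>\<beta>s. u (\<alpha> # \<beta>s))"

text \<open>The main involution. It carries the sign of the antiderivation rule, so that no degree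
  has to enter the product formula.\<close>

definition grade_inv :: "('k::field, 'g) multivector \<Rightarrow> ('k, 'g) multivector" where
  "grade_inv u = (\<lambda>\<beta>s. (-1) ^ length \<beta>s * u \<beta>s)"

definition coeff_deriv :: "('k::field, 'g) multivector \<Rightarrow> ('k, 'g) multivector" where
  "coeff_deriv u = (\<lambda>\<beta>s. pderiv (u \<beta>s))"

text \<open>The value at \<open>[]\<close> and all contractions determine a multivector, so
  bilinearity, associativity and graded commutativity become inductions on the argument list, and no
  shuffle is ever written down.\<close>

lemma wedge_Cons: "(u \<and>\<^sub>A v) (\<alpha> # \<alpha>s) = (contract \<alpha> u \<and>\<^sub>A v) \<alpha>s + (grade_inv u \<and>\<^sub>A contract \<alpha> v) \<alpha>s"
  by (simp add: contract_def grade_inv_def)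

declare wedge.simps(2) [simp del]

lemma contract_linear [simp]:
  "contract \<alpha> (u + v) = contract \<alpha> u + contract \<alpha> v" "contract \<alpha> (u - v) = contract \<alpha> u - contract \<alpha> v"
  "contract \<alpha> (- u) = - contract \<alpha> u" "contract \<alpha> 0 = 0" "contract \<alpha> (amult f u) = amult f (contract \<alpha> u)"
  by (auto simp: contract_def fun_eq_iff amult_apply)

lemma grade_inv_linear [simp]:
  "grade_inv (u + v) = grade_inv u + grade_inv v" "grade_inv (u - v) = grade_inv u - grade_inv v"
  "grade_inv (- u) = - grade_inv u" "grade_inv 0 = 0" "grade_inv (amult f u) = amult f (grade_inv u)"
  by (auto simp: grade_inv_def fun_eq_iff amult_apply algebra_simps)

lemma grade_inv_grade_inv [simp]: "grade_inv (grade_inv u) = u"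
  by (auto simp: grade_inv_def fun_eq_iff simp flip: mult.assoc power_add)

lemma contract_grade_inv [simp]: "contract \<alpha> (grade_inv u) = - grade_inv (contract \<alpha> u)"
  by (auto simp: grade_inv_def contract_def fun_eq_iff)

lemma coeff_deriv_linear [simp]:
  "coeff_deriv (u + v) = coeff_deriv u + coeff_deriv v" "coeff_deriv (u - v) = coeff_deriv u - coeff_deriv v"
  "coeff_deriv (- u) = - coeff_deriv u" "coeff_deriv 0 = 0"
  "coeff_deriv (amult f u) = amult f (coeff_deriv u) + amult (pderiv f) u"
  by (auto simp: coeff_deriv_def fun_eq_iff pderiv_add pderiv_diff pderiv_minus pderiv_mult amult_apply algebra_simps)

lemma contract_coeff_deriv [simp]: "contract \<alpha> (coeff_deriv u) = coeff_deriv (contract \<alpha> u)"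
  by (simp add: contract_def coeff_deriv_def)

lemma pderiv_minus_one_power [simp]: "pderiv ((-1) ^ n) = (0 :: 'a::idom poly)"
  by (induction n) (simp_all add: pderiv_minus)

lemma grade_inv_coeff_deriv [simp]: "grade_inv (coeff_deriv u) = coeff_deriv (grade_inv u)"
  by (simp add: grade_inv_def coeff_deriv_def pderiv_mult fun_eq_iff)

lemma wedge_add_left: "(u + v) \<and>\<^sub>A w = u \<and>\<^sub>A w + v \<and>\<^sub>A w"
proof -
  have "((u + v) \<and>\<^sub>A w) \<alpha>s = (u \<and>\<^sub>A w) \<alpha>s + (v \<and>\<^sub>A w) \<alpha>s" for \<alpha>s
    by (induction \<alpha>s arbitrary: u v w) (simp_all add: wedge_Cons amult_apply algebra_simps)
  then show ?thesis by (simp add: fun_eq_iff amult_apply)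
qed

lemma wedge_add_right: "w \<and>\<^sub>A (u + v) = w \<and>\<^sub>A u + w \<and>\<^sub>A v"
proof -
  have "(w \<and>\<^sub>A (u + v)) \<alpha>s = (w \<and>\<^sub>A u) \<alpha>s + (w \<and>\<^sub>A v) \<alpha>s" for \<alpha>s
    by (induction \<alpha>s arbitrary: u v w) (simp_all add: wedge_Cons amult_apply algebra_simps)
  then show ?thesis by (simp add: fun_eq_iff amult_apply)
qed

lemma wedge_amult_left [simp]: "amult f u \<and>\<^sub>A w = amult f (u \<and>\<^sub>A w)"
proof -
  have "(amult f u \<and>\<^sub>A w) \<alpha>s = f * (u \<and>\<^sub>A w) \<alpha>s" for \<alpha>s
    by (induction \<alpha>s arbitrary: u w) (simp_all add: wedge_Cons amult_apply algebra_simps)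
  then show ?thesis by (simp add: fun_eq_iff amult_apply)
qed

lemma wedge_amult_right [simp]: "u \<and>\<^sub>A amult f w = amult f (u \<and>\<^sub>A w)"
proof -
  have "(u \<and>\<^sub>A amult f w) \<alpha>s = f * (u \<and>\<^sub>A w) \<alpha>s" for \<alpha>s
    by (induction \<alpha>s arbitrary: u w) (simp_all add: wedge_Cons amult_apply algebra_simps)
  then show ?thesis by (simp add: fun_eq_iff amult_apply)
qed

lemma wedge_minus [simp]: "(- u) \<and>\<^sub>A w = - (u \<and>\<^sub>A w)" "u \<and>\<^sub>A (- w) = - (u \<and>\<^sub>A w)"
  using wedge_amult_left[of "-1" u w] wedge_amult_right[of u "-1" w] by simp_all

lemma wedge_zero [simp]: "0 \<and>\<^sub>A w = 0" "w \<and>\<^sub>A 0 = 0"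
  using wedge_amult_left[of 0 0 w] wedge_amult_right[of w 0 0] by simp_all

lemma wedge_diff_left: "(u - v) \<and>\<^sub>A w = u \<and>\<^sub>A w - v \<and>\<^sub>A w"
  using wedge_add_left[of "u - v" v w] by simp

lemma wedge_diff_right: "w \<and>\<^sub>A (u - v) = w \<and>\<^sub>A u - w \<and>\<^sub>A v"
  using wedge_add_right[of w "u - v" v] by simp

lemma wedge_sum_left: "sum f A \<and>\<^sub>A w = (\<Sum>a\<in>A. f a \<and>\<^sub>A w)"
  using sum_comp_morphism[of "\<lambda>u. u \<and>\<^sub>A w" f A] by (simp add: wedge_add_left o_def)

lemma wedge_sum_right: "w \<and>\<^sub>A sum f A = (\<Sum>a\<in>A. w \<and>\<^sub>A f a)"
  using sum_comp_morphism[of "\<lambda>u. w \<and>\<^sub>A u" f A] by (simp add: wedge_add_right o_def)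

lemmas wedge_distribs = wedge_add_left wedge_add_right wedge_diff_left wedge_diff_right

lemma contract_wedge: "contract \<alpha> (u \<and>\<^sub>A v) = contract \<alpha> u \<and>\<^sub>A v + grade_inv u \<and>\<^sub>A contract \<alpha> v"
  by (simp add: fun_eq_iff contract_def[of _ "u \<and>\<^sub>A v"] wedge_Cons)

lemma grade_inv_wedge: "grade_inv (u \<and>\<^sub>A v) = grade_inv u \<and>\<^sub>A grade_inv v"
proof -
  have "(-1) ^ length \<alpha>s * (u \<and>\<^sub>A v) \<alpha>s = (grade_inv u \<and>\<^sub>A grade_inv v) \<alpha>s" for \<alpha>s
  proof (induction \<alpha>s arbitrary: u v)
    case Nil
    then show ?case by (simp add: grade_inv_def)
  next
    case (Cons \<alpha> \<alpha>s)
    show ?case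
      using Cons[of "contract \<alpha> u" v] Cons[of "grade_inv u" "contract \<alpha> v"]
      by (simp add: wedge_Cons algebra_simps)
  qed
  then show ?thesis by (simp add: fun_eq_iff grade_inv_def[of "u \<and>\<^sub>A v"])
qed

lemma wedge_assoc: "(u \<and>\<^sub>A v) \<and>\<^sub>A w = u \<and>\<^sub>A v \<and>\<^sub>A w"
proof -
  have "((u \<and>\<^sub>A v) \<and>\<^sub>A w) \<alpha>s = (u \<and>\<^sub>A v \<and>\<^sub>A w) \<alpha>s" for \<alpha>s
    by (induction \<alpha>s arbitrary: u v w)
      (simp_all add: wedge_Cons contract_wedge grade_inv_wedge wedge_distribs algebra_simps)
  then show ?thesis by (simp add: fun_eq_iff)
qed

lemma coeff_deriv_wedge: "coeff_deriv (u \<and>\<^sub>A v) = coeff_deriv u \<and>\<^sub>A v + u \<and>\<^sub>A coeff_deriv v"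
proof -
  have "pderiv ((u \<and>\<^sub>A v) \<alpha>s) = (coeff_deriv u \<and>\<^sub>A v) \<alpha>s + (u \<and>\<^sub>A coeff_deriv v) \<alpha>s" for \<alpha>s
  proof (induction \<alpha>s arbitrary: u v)
    case Nil
    then show ?case by (simp add: coeff_deriv_def pderiv_mult)
  next
    case (Cons \<alpha> \<alpha>s)
    then show ?case by (simp add: wedge_Cons pderiv_add)
  qed
  then show ?thesis by (simp add: fun_eq_iff coeff_deriv_def[of "u \<and>\<^sub>A v"])
qed

lemma of_fun_linear:
  "of_fun (f + g) = of_fun f + of_fun g" "of_fun (f - g) = of_fun f - of_fun g"
  "of_fun (- f) = - of_fun f" "of_fun 0 = 0" "amult g (of_fun f) = of_fun (g * f)"
  by (auto simp: of_fun_def fun_eq_iff amult_apply)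

lemma contract_of_fun [simp]: "contract \<alpha> (of_fun f) = 0"
  by (simp add: contract_def of_fun_def fun_eq_iff)

lemma grade_inv_of_fun [simp]: "grade_inv (of_fun f) = of_fun f"
  by (simp add: grade_inv_def of_fun_def fun_eq_iff)

lemma coeff_deriv_of_fun [simp]: "coeff_deriv (of_fun f) = of_fun (pderiv f)"
  by (auto simp: coeff_deriv_def of_fun_def fun_eq_iff)

lemma wedge_of_fun_left [simp]: "of_fun f \<and>\<^sub>A u = amult f u"
proof -
  have "(of_fun f \<and>\<^sub>A u) \<alpha>s = f * u \<alpha>s" for \<alpha>s
    by (induction \<alpha>s arbitrary: u) (simp_all add: wedge_Cons, simp_all add: of_fun_def contract_def)
  then show ?thesis by (simp add: fun_eq_iff amult_apply)
qed

lemma wedge_of_fun_right [simp]: "u \<and>\<^sub>A of_fun f = amult f u"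
proof -
  have "(u \<and>\<^sub>A of_fun f) \<alpha>s = f * u \<alpha>s" for \<alpha>s
    by (induction \<alpha>s arbitrary: u) (simp_all add: wedge_Cons, simp_all add: of_fun_def contract_def)
  then show ?thesis by (simp add: fun_eq_iff amult_apply)
qed

text \<open>Only the parity of \<open>p\<close> matters, which avoids the truncated degree \<open>k - 1\<close> of a contraction.\<close>

definition parity :: "nat \<Rightarrow> ('k::field, 'g) multivector \<Rightarrow> bool" where
  "parity p u \<longleftrightarrow> (\<forall>\<alpha>s. even (length \<alpha>s + p) \<or> u \<alpha>s = 0)"

lemma grade_inv_parity: "parity p u \<Longrightarrow> grade_inv u = amult ((-1) ^ p) u"
proof (rule ext)
  fix \<alpha>s assume "parity p u"
  then show "grade_inv u \<alpha>s = amult ((-1) ^ p) u \<alpha>s"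
    by (cases "even (length \<alpha>s + p)") (auto simp: grade_inv_def parity_def minus_one_power_iff amult_apply)
qed

lemma parity_zero [simp]: "parity p 0"
  by (simp add: parity_def)

lemma parity_add [intro]: "parity p u \<Longrightarrow> parity p v \<Longrightarrow> parity p (u + v)"
  by (metis (mono_tags, lifting) parity_def plus_fun_apply add_0)

lemma parity_uminus [intro]: "parity p u \<Longrightarrow> parity p (- u)"
  by (auto simp: parity_def)

lemma parity_diff [intro]: "parity p u \<Longrightarrow> parity p v \<Longrightarrow> parity p (u - v)"
  using parity_add[OF _ parity_uminus] by (metis add_uminus_conv_diff)

lemma parity_amult [intro]: "parity p u \<Longrightarrow> parity p (amult f u)"
  by (auto simp: parity_def amult_apply)

lemma parity_sum [intro]: "(\<And>a. a \<in> A \<Longrightarrow> parity p (f a)) \<Longrightarrow> parity p (sum f A)"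
  by (induction A rule: infinite_finite_induct) auto

lemma parity_contract [intro]: "parity p u \<Longrightarrow> parity (Suc p) (contract \<alpha> u)"
  by (simp add: parity_def contract_def) (metis add_Suc even_Suc length_Cons)

lemma parity_grade_inv [intro]: "parity p u \<Longrightarrow> parity p (grade_inv u)"
  by (auto simp: parity_def grade_inv_def)

lemma parity_coeff_deriv [intro]: "parity p u \<Longrightarrow> parity p (coeff_deriv u)"
  by (auto simp: parity_def coeff_deriv_def dest: arg_cong[of _ 0 pderiv])

lemma parity_cong: "even (p + q) \<Longrightarrow> parity p u \<longleftrightarrow> parity q u"
  by (auto simp: parity_def)

lemma parity_wedge [intro]: "parity p u \<Longrightarrow> parity q v \<Longrightarrow> parity (p + q) (u \<and>\<^sub>A v)"
proof -
  have "parity p u \<Longrightarrow> parity q v \<Longrightarrow> odd (length \<alpha>s + (p + q)) \<Longrightarrow> (u \<and>\<^sub>A v) \<alpha>s = 0" for \<alpha>s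
  proof (induction \<alpha>s arbitrary: u v p q)
    case Nil
    then show ?case by (auto simp: parity_def)
  next
    case (Cons \<alpha> \<alpha>s)
    have "(contract \<alpha> u \<and>\<^sub>A v) \<alpha>s = 0"
      using Cons.prems by (intro Cons.IH[of "Suc p" _ q] parity_contract) auto
    moreover have "(grade_inv u \<and>\<^sub>A contract \<alpha> v) \<alpha>s = 0"
      using Cons.prems by (intro Cons.IH[of p _ "Suc q"] parity_contract parity_grade_inv) auto
    ultimately show ?case by (simp add: wedge_Cons)
  qed
  then show "parity p u \<Longrightarrow> parity q v \<Longrightarrow> parity (p + q) (u \<and>\<^sub>A v)"
    by (auto simp: parity_def)
qed

text \<open>The signed shuffle product is graded commutative on all functions on lists, alternating
  or not, so only parities matter. Contraction raises one parity by one, and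
  \<open>grade_inv\<close> supplies the missing sign.\<close>

lemma wedge_commute: "parity p u \<Longrightarrow> parity q v \<Longrightarrow> u \<and>\<^sub>A v = amult ((-1) ^ (p * q)) (v \<and>\<^sub>A u)"
proof -
  have "parity p u \<Longrightarrow> parity q v \<Longrightarrow> (u \<and>\<^sub>A v) \<alpha>s = (-1) ^ (p * q) * (v \<and>\<^sub>A u) \<alpha>s" for \<alpha>s
  proof (induction \<alpha>s arbitrary: u v p q)
    case Nil
    then show ?case
      by (cases "odd p \<or> odd q") (auto simp: parity_def minus_one_power_iff)
  next
    case (Cons \<alpha> \<alpha>s)
    have "(contract \<alpha> u \<and>\<^sub>A v) \<alpha>s = (-1) ^ (Suc p * q) * (v \<and>\<^sub>A contract \<alpha> u) \<alpha>s"
      by (intro Cons.IH parity_contract Cons.prems)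
    moreover have "(u \<and>\<^sub>A contract \<alpha> v) \<alpha>s = (-1) ^ (p * Suc q) * (contract \<alpha> v \<and>\<^sub>A u) \<alpha>s"
      by (intro Cons.IH parity_contract Cons.prems)
    ultimately show ?case
      unfolding wedge_Cons grade_inv_parity[OF Cons.prems(1)] grade_inv_parity[OF Cons.prems(2)]
        wedge_amult_left amult_apply
      by (cases "even p"; cases "even q") (simp_all add: minus_one_power_iff)
  qed
  then show "parity p u \<Longrightarrow> parity q v \<Longrightarrow> u \<and>\<^sub>A v = amult ((-1) ^ (p * q)) (v \<and>\<^sub>A u)"
    by (simp add: fun_eq_iff amult_apply)
qed

lemma parity_of_fun [simp]: "parity 0 (of_fun f)"
  by (auto simp: parity_def of_fun_def)

section \<open>Wedge powers and homogeneous multivectors\<close>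

lemma wedges_simps [simp]: "wedges [] = of_fun 1" "wedges (u # us) = u \<and>\<^sub>A wedges us"
  by (simp_all add: wedges_def)

lemma wedges_append: "wedges (us @ vs) = wedges us \<and>\<^sub>A wedges vs"
  by (induction us) (simp_all add: wedge_assoc)

lemma wedge_powerI: "length us = k \<Longrightarrow> set us \<subseteq> M \<Longrightarrow> amult f (wedges us) \<in> wedge_power M k"
  unfolding wedge_power_def by (intro amult.span_scale amult.span_base) blast

lemma wedge_power_closed:
  "u \<in> wedge_power M k \<Longrightarrow> v \<in> wedge_power M k \<Longrightarrow> u + v \<in> wedge_power M k"
  "u \<in> wedge_power M k \<Longrightarrow> v \<in> wedge_power M k \<Longrightarrow> u - v \<in> wedge_power M k"
  "u \<in> wedge_power M k \<Longrightarrow> - u \<in> wedge_power M k"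
  "u \<in> wedge_power M k \<Longrightarrow> amult f u \<in> wedge_power M k"
  "0 \<in> wedge_power M k"
  "(\<And>a. a \<in> A \<Longrightarrow> F a \<in> wedge_power M k) \<Longrightarrow> sum F A \<in> wedge_power M k"
  unfolding wedge_power_def
  by (auto intro: amult.span_add amult.span_diff amult.span_neg amult.span_scale amult.span_zero amult.span_sum)

lemma wedge_power_mono: "M \<subseteq> N \<Longrightarrow> wedge_power M k \<subseteq> wedge_power N k"
  unfolding wedge_power_def by (intro amult.span_mono) blast

text \<open>The step also receives membership of \<open>v\<close>, which the axioms of the bracket
  require before they can be applied to the sum.\<close>

lemma wedge_power_induct [consumes 1, case_names zero add]:
  assumes "u \<in> wedge_power M k" "P 0"
    and "\<And>f us v. length us = k \<Longrightarrow> set us \<subseteq> M \<Longrightarrow> v \<in> wedge_power M k \<Longrightarrow> P v \<Longrightarrow> P (amult f (wedges us) + v)"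
  shows "P u"
proof -
  have "P u \<and> u \<in> wedge_power M k"
    using assms(1) unfolding wedge_power_def
  proof (induction rule: amult.span_induct_alt)
    case base
    then show ?case using assms(2) amult.span_zero by blast
  next
    case (step c x y)
    then obtain us where us: "x = wedges us" "length us = k" "set us \<subseteq> M" by blast
    have "P (amult c (wedges us) + y)"
      using assms(3)[OF us(2,3)] step(2) by (simp only: wedge_power_def)
    moreover have "amult c (wedges us) + y \<in> wedge_power M k"
      using step(2) by (intro wedge_power_closed wedge_powerI us) (simp only: wedge_power_def)
    ultimately show ?case by (simp only: us wedge_power_def)
  qed
  then show ?thesis by blast
qed

lemma wedge_power_wedge:
  assumes "u \<in> wedge_power M k" "v \<in> wedge_power M l"
  shows "u \<and>\<^sub>A v \<in> wedge_power M (k + l)"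
  using assms(1)
proof (induction rule: wedge_power_induct)
  case (add f us u)
  note us = add
  have "wedges us \<and>\<^sub>A v \<in> wedge_power M (k + l)"
    using assms(2)
  proof (induction rule: wedge_power_induct)
    case (add g vs v)
    have "amult g (wedges (us @ vs)) \<in> wedge_power M (k + l)"
      using add us by (intro wedge_powerI) auto
    then show ?case
      unfolding wedge_add_right wedge_amult_right wedges_append[symmetric]
      using add.IH by (rule wedge_power_closed(1))
  qed (simp only: wedge_zero wedge_power_closed)
  then show ?case
    unfolding wedge_add_left wedge_amult_left using add by (intro wedge_power_closed)
qed (simp only: wedge_zero wedge_power_closed)

lemmas fun_pointwise = plus_fun_apply zero_fun_apply minus_apply uminus_apply

declare fun_pointwise [simp del]

lemma of_fun_sum: "of_fun (sum f A) = (\<Sum>a\<in>A. of_fun (f a))"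
  by (rule sum_comp_morphism[unfolded o_def, symmetric]) (simp_all only: of_fun_linear)

context fd_lie_algebra
begin

lemma functional_iff:
  "Vector_Spaces.linear scale (*) \<alpha> \<longleftrightarrow> (\<forall>x y. \<alpha> (x + y) = \<alpha> x + \<alpha> y) \<and> (\<forall>c x. \<alpha> (scale c x) = c * \<alpha> x)"
proof -
  have "vector_space ((*) :: 'k \<Rightarrow> 'k \<Rightarrow> 'k)" by unfold_locales (auto simp: algebra_simps)
  then show ?thesis using vector_space_axioms by (auto simp: Vector_Spaces.linear_iff)
qed

lemma functional_coord [simp]: "Vector_Spaces.linear scale (*) (coord b)"
  by (simp add: functional_iff)

lemma vec_add: "vec (X + Y) = vec X + vec Y"
  by (auto simp: vec_def fun_eq_iff functional_iff fun_pointwise split: list.splits)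

lemma vec_scale: "vec (scale c X) = amult [:c:] (vec X)"
  by (auto simp: vec_def fun_eq_iff functional_iff amult_apply split: list.splits)

lemma vec_zero [simp]: "vec 0 = 0"
  using vec_scale[of 0 0] by simp

lemma vec_minus: "vec (- X) = - vec X"
  using vec_add[of X "- X"] by (simp add: add_eq_0_iff)

lemma vec_diff: "vec (X - Y) = vec X - vec Y"
  using vec_add[of X "- Y"] by (simp add: vec_minus)

lemma vec_sum: "vec (sum f A) = (\<Sum>a\<in>A. vec (f a))"
  using sum_comp_morphism[of vec f A] by (simp add: vec_add o_def)

lemma sum_coord_vec: "(\<Sum>b\<in>some_basis. amult [:coord b X:] (vec b)) = vec X"
  using arg_cong[OF sum_coord[of X], of vec] by (simp only: vec_sum vec_scale)

lemma contract_vec [simp]: "contract (coord b) (vec X) = of_fun [:coord b X:]"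
  by (auto simp: contract_def vec_def of_fun_def fun_eq_iff split: list.splits)

lemma coeff_deriv_vec [simp]: "coeff_deriv (vec X) = 0"
  by (auto simp: coeff_deriv_def vec_def fun_eq_iff pderiv_pCons fun_pointwise split: list.splits)

lemma parity_vec [simp]: "parity (Suc 0) (vec X)"
  by (auto simp: parity_def vec_def split: list.splits)

lemma grade_inv_vec [simp]: "grade_inv (vec X) = - vec X"
  using grade_inv_parity[OF parity_vec, of X] by simp

lemma mvec_induct [consumes 1, case_names zero add]:
  assumes "u \<in> mvec k" "P 0"
    and "\<And>f Xs v. length Xs = k \<Longrightarrow> v \<in> mvec k \<Longrightarrow> P v \<Longrightarrow> P (amult f (wedges (map vec Xs)) + v)"
  shows "P u"
  using assms(1) unfolding mvec_def
proof (induction rule: wedge_power_induct)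
  case zero
  show ?case by (rule assms(2))
next
  case (add f us v)
  obtain Xs where "us = map vec Xs" using add(2) by (metis ex_map_conv subset_iff rangeE)
  then show ?case using assms(3)[of Xs v f] add by (simp only: length_map mvec_def)
qed

lemmas mvec_closed = wedge_power_closed[where M = "range vec", folded mvec_def]

lemma mvecI: "length Xs = k \<Longrightarrow> amult f (wedges (map vec Xs)) \<in> mvec k"
  unfolding mvec_def by (rule wedge_powerI) auto

lemma mvec_wedge: "u \<in> mvec k \<Longrightarrow> v \<in> mvec l \<Longrightarrow> u \<and>\<^sub>A v \<in> mvec (k + l)"
  unfolding mvec_def by (rule wedge_power_wedge)

lemma mvec_in_mvecs: "u \<in> mvec k \<Longrightarrow> u \<in> mvecs"
  unfolding mvecs_def by (intro amult.span_base) blast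

lemma of_fun_mvec [simp]: "of_fun f \<in> mvec 0"
  using mvecI[of "[]" 0 f] by (simp add: of_fun_linear)

lemma vec_mvec [simp]: "vec X \<in> mvec (Suc 0)" "vec X \<in> mvec 1"
  using mvecI[of "[X]" "Suc 0" 1] by simp_all

lemma mvec_parity: "u \<in> mvec k \<Longrightarrow> parity k u"
proof (induction rule: mvec_induct)
  case (add f Xs v)
  have "parity (length Xs) (wedges (map vec Xs))"
  proof (induction Xs)
    case (Cons X Xs)
    then show ?case using parity_wedge[OF parity_vec[of X] Cons] by simp
  qed simp
  with add show ?case by (metis parity_add parity_amult)
qed (rule parity_zero)

lemma mvec_0: "u \<in> mvec 0 \<Longrightarrow> \<exists>f. u = of_fun f"
proof (induction rule: mvec_induct)
  case zero
  show ?case by (rule exI[of _ 0]) (simp only: of_fun_linear)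
next
  case (add f Xs v)
  then obtain g where "v = of_fun g" by blast
  then have "amult f (wedges (map vec Xs)) + v = of_fun (f + g)"
    using add by (simp add: of_fun_linear)
  then show ?case by blast
qed

lemma mvec_contract: "u \<in> mvec (Suc k) \<Longrightarrow> contract (coord b) u \<in> mvec k"
proof (induction rule: mvec_induct)
  case zero
  show ?case by (simp only: contract_linear mvec_closed)
next
  case (add f Xs v)
  have "contract (coord b) (wedges (map vec Xs)) \<in> mvec (length Xs - 1)" if "Xs \<noteq> []" for Xs
    using that
  proof (induction Xs)
    case (Cons X Xs)
    have "contract (coord b) (wedges (map vec (X # Xs))) =
        amult [:coord b X:] (wedges (map vec Xs)) - vec X \<and>\<^sub>A contract (coord b) (wedges (map vec Xs))"
      by (simp add: contract_wedge)
    moreover have "vec X \<and>\<^sub>A contract (coord b) (wedges (map vec Xs)) \<in> mvec (length Xs)"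
    proof (cases "Xs = []")
      case False
      then show ?thesis using mvec_wedge[OF vec_mvec(1) Cons.IH[OF False], of X] by simp
    qed (simp add: mvec_closed)
    ultimately show ?case by (simp add: mvec_closed mvecI)
  qed simp
  moreover have "Xs \<noteq> []" "length Xs - 1 = k" using add(1) by auto
  ultimately have "contract (coord b) (wedges (map vec Xs)) \<in> mvec k" by metis
  then show ?case using add unfolding contract_linear by (intro mvec_closed)
qed

lemma mvec_contract_0: "u \<in> mvec 0 \<Longrightarrow> contract (coord b) u = 0"
  by (auto dest!: mvec_0)

lemma coeff_deriv_wedges [simp]: "coeff_deriv (wedges (map vec Xs)) = 0"
proof (induction Xs)
  case Nil
  show ?case by (simp add: of_fun_linear flip: one_pCons)
qed (simp add: coeff_deriv_wedge)

lemma mvec_coeff_deriv: "u \<in> mvec k \<Longrightarrow> coeff_deriv u \<in> mvec k"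
proof (induction rule: mvec_induct)
  case zero
  show ?case by (simp only: coeff_deriv_linear mvec_closed)
next
  case (add f Xs v)
  have "coeff_deriv (amult f (wedges (map vec Xs)) + v) = amult (pderiv f) (wedges (map vec Xs)) + coeff_deriv v"
    by simp
  then show ?case using add by (metis mvec_closed(1) mvecI)
qed

end

section \<open>The explicit Schouten bracket\<close>

context fd_lie_action
begin

lemma action_linear [simp]: "\<theta> 0 = 0" "\<theta> (- x) = - \<theta> x" "\<theta> (x - y) = \<theta> x - \<theta> y"
proof -
  show "\<theta> 0 = 0" using action_scale[of 0 0] by simp
  show *: "\<theta> (- x) = - \<theta> x" for x using action_scale[of "-1" x] by simp
  show "\<theta> (x - y) = \<theta> x - \<theta> y" using action_add[of x "- y"] * by simp
qed

lemma action_sum: "\<theta> (sum f A) = (\<Sum>a\<in>A. \<theta> (f a))"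
  using sum_comp_morphism[of \<theta> f A] by (simp add: action_add o_def)

lemma sum_coord_action: "(\<Sum>b\<in>some_basis. [:coord b x:] * \<theta> b) = \<theta> x"
proof -
  have "\<theta> x = \<theta> (\<Sum>b\<in>some_basis. scale (coord b x) b)" by (simp add: sum_coord)
  also have "\<dots> = (\<Sum>b\<in>some_basis. [:coord b x:] * \<theta> b)" by (simp only: action_sum) (simp add: action_scale)
  finally show ?thesis by simp
qed

text \<open>The second summand extends \<open>br b\<close> to a derivation of the exterior algebra:
  contracting with the dual vector of \<open>c\<close> and wedging with \<open>[b, c]\<close>
  replaces a factor \<open>c\<close> by \<open>[b, c]\<close>.\<close>

definition lie_deriv :: "'g \<Rightarrow> ('k, 'g) multivector \<Rightarrow> ('k, 'g) multivector" where
  "lie_deriv b Q = amult (\<theta> b) (coeff_deriv Q) + (\<Sum>c\<in>some_basis. vec (br b c) \<and>\<^sub>A contract (coord c) Q)"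

text \<open>For alternating \<open>P\<close> the sign in
  \<open>grade_inv (contract \<alpha> P)\<close> moves the contracted slot from the first to the
  last place; this is the right contraction, in a form that fits the left recursion of the
  product.\<close>

definition sbracket :: "('k, 'g) multivector \<Rightarrow> ('k, 'g) multivector \<Rightarrow> ('k, 'g) multivector" where
  "sbracket P Q = (\<Sum>b\<in>some_basis. grade_inv (contract (coord b) P) \<and>\<^sub>A lie_deriv b Q
     - amult (\<theta> b) (coeff_deriv P) \<and>\<^sub>A contract (coord b) Q)"

lemma lie_deriv_linear:
  "lie_deriv b (u + v) = lie_deriv b u + lie_deriv b v"
  "lie_deriv b (amult [:c:] u) = amult [:c:] (lie_deriv b u)"
  by (simp_all add: lie_deriv_def wedge_distribs sum.distrib amult.scale_right_distrib algebra_simps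
      pderiv_pCons amult.scale_sum_right)

lemma sbracket_add: "sbracket (u + v) w = sbracket u w + sbracket v w" "sbracket w (u + v) = sbracket w u + sbracket w v"
  by (simp_all add: sbracket_def lie_deriv_linear wedge_distribs sum.distrib sum_subtractf
      amult.scale_right_distrib)

lemma sbracket_scale: "sbracket (amult [:c:] u) w = amult [:c:] (sbracket u w)"
  "sbracket w (amult [:c:] u) = amult [:c:] (sbracket w u)"
  by (simp_all add: sbracket_def lie_deriv_linear amult.scale_sum_right pderiv_pCons
      amult.scale_right_diff_distrib amult.scale_left_commute)

lemma sbracket_minus: "sbracket (- u) w = - sbracket u w" "sbracket w (- u) = - sbracket w u"
proof -
  have "[:-1:] = (-1 :: 'k poly)" by (simp add: one_pCons)
  then show "sbracket (- u) w = - sbracket u w" "sbracket w (- u) = - sbracket w u"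
    using sbracket_scale(1)[of "-1" u w] sbracket_scale(2)[of w "-1" u] by simp_all
qed

lemma sbracket_zero [simp]: "sbracket 0 w = 0" "sbracket w 0 = 0"
  using sbracket_scale(1)[of 0 0 w] sbracket_scale(2)[of w 0 0] by simp_all

text \<open>Wedging with a vector and contracting are both odd, so their composite obeys the Leibniz
  rule without a sign.\<close>

lemma lie_deriv_wedge:
  assumes "parity p u"
  shows "lie_deriv b (u \<and>\<^sub>A v) = lie_deriv b u \<and>\<^sub>A v + u \<and>\<^sub>A lie_deriv b v"
proof -
  have "vec X \<and>\<^sub>A contract \<alpha> (u \<and>\<^sub>A v) = (vec X \<and>\<^sub>A contract \<alpha> u) \<and>\<^sub>A v + u \<and>\<^sub>A vec X \<and>\<^sub>A contract \<alpha> v" for X \<alpha>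
  proof -
    have "vec X \<and>\<^sub>A grade_inv u \<and>\<^sub>A contract \<alpha> v = u \<and>\<^sub>A vec X \<and>\<^sub>A contract \<alpha> v"
      unfolding wedge_assoc[symmetric] grade_inv_parity[OF assms] wedge_amult_right
        wedge_commute[OF parity_vec assms, of X]
      by (cases "even p") (simp_all add: minus_one_power_iff)
    then show ?thesis by (simp add: contract_wedge wedge_distribs wedge_assoc)
  qed
  then show ?thesis
    by (simp add: lie_deriv_def coeff_deriv_wedge wedge_distribs sum.distrib wedge_sum_left wedge_sum_right
        amult.scale_right_distrib algebra_simps)
qed

text \<open>Holds for each basis vector \<open>b\<close> separately. The sign comes from moving
  \<open>y\<close> past the contraction of \<open>x\<close>, of parity \<open>k + 1\<close>; in the
  second term it arises from moving \<open>y\<close> past \<open>coeff_deriv x\<close>, together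
  with \<open>grade_inv y\<close>.\<close>

lemma sbracket_leibniz:
  assumes x: "parity k x" and y: "parity l y"
  shows "sbracket x (y \<and>\<^sub>A z) = sbracket x y \<and>\<^sub>A z + amult ((-1) ^ ((k + 1) * l)) (y \<and>\<^sub>A sbracket x z)"
proof -
  have *: "grade_inv (contract (coord b) x) \<and>\<^sub>A lie_deriv b (y \<and>\<^sub>A z)
     - amult (\<theta> b) (coeff_deriv x) \<and>\<^sub>A contract (coord b) (y \<and>\<^sub>A z) =
     (grade_inv (contract (coord b) x) \<and>\<^sub>A lie_deriv b y - amult (\<theta> b) (coeff_deriv x) \<and>\<^sub>A contract (coord b) y) \<and>\<^sub>A z +
     amult ((-1) ^ ((k + 1) * l)) (y \<and>\<^sub>A (grade_inv (contract (coord b) x) \<and>\<^sub>A lie_deriv b z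
       - amult (\<theta> b) (coeff_deriv x) \<and>\<^sub>A contract (coord b) z))" for b
  proof -
    let ?R = "grade_inv (contract (coord b) x)" and ?D = "coeff_deriv x"
    have 1: "?R \<and>\<^sub>A y \<and>\<^sub>A lie_deriv b z = amult ((-1) ^ ((k + 1) * l)) (y \<and>\<^sub>A ?R \<and>\<^sub>A lie_deriv b z)"
      unfolding wedge_assoc[symmetric]
      using wedge_commute[OF parity_grade_inv[OF parity_contract[OF x]] y, of "coord b"] by simp
    have 2: "?D \<and>\<^sub>A grade_inv y \<and>\<^sub>A contract (coord b) z = amult ((-1) ^ ((k + 1) * l)) (y \<and>\<^sub>A ?D \<and>\<^sub>A contract (coord b) z)"
      unfolding wedge_assoc[symmetric] grade_inv_parity[OF y]
      using wedge_commute[OF parity_coeff_deriv[OF x] y]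
      by (cases "even k"; cases "even l") (simp_all add: minus_one_power_iff)
    show ?thesis
      by (simp add: lie_deriv_wedge[OF y] contract_wedge wedge_distribs wedge_assoc 1 2
          amult.scale_right_distrib amult.scale_right_diff_distrib)
        (simp add: mult_ac)
  qed
  show ?thesis
    unfolding sbracket_def * sum.distrib wedge_sum_left wedge_sum_right amult.scale_sum_right ..
qed

text \<open>Expanded, the bracket has three sums. Exchanging \<open>x\<close> and \<open>y\<close>
  interchanges the two with coefficient derivatives up to sign, while the third returns to itself up
  to sign because \<open>br b c\<close> is antisymmetric.\<close>

lemma sbracket_commute:
  assumes x: "parity k x" and y: "parity l y"
  shows "sbracket x y = - amult ((-1) ^ ((k + 1) * (l + 1))) (sbracket y x)"
proof -
  let ?c = "\<lambda>b. contract (coord b)"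
  let ?s = "(-1) ^ ((k + 1) * (l + 1)) :: 'k poly"
  have expand: "sbracket x y = (\<Sum>b\<in>some_basis. amult (\<theta> b) (grade_inv (?c b x) \<and>\<^sub>A coeff_deriv y))
      - (\<Sum>b\<in>some_basis. amult (\<theta> b) (coeff_deriv x \<and>\<^sub>A ?c b y))
      + (\<Sum>b\<in>some_basis. \<Sum>c\<in>some_basis. grade_inv (?c b x) \<and>\<^sub>A vec (br b c) \<and>\<^sub>A ?c c y)" for x y
    by (simp add: sbracket_def lie_deriv_def wedge_distribs sum.distrib sum_subtractf wedge_sum_right)
  have swap: "grade_inv (?c b x) \<and>\<^sub>A coeff_deriv y = amult ((-1) ^ ((k + 1) * (l + 1))) (coeff_deriv y \<and>\<^sub>A ?c b x)"
    if x: "parity k x" and y: "parity l y" for b x y k l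
    unfolding grade_inv_parity[OF parity_contract[OF x]] wedge_amult_left
      wedge_commute[OF parity_contract[OF x] parity_coeff_deriv[OF y]]
    by (cases "even k"; cases "even l") (simp_all add: minus_one_power_iff)
  have swap3: "grade_inv (?c b x) \<and>\<^sub>A vec (br b c) \<and>\<^sub>A ?c c y =
      - amult ?s (grade_inv (?c c y) \<and>\<^sub>A vec (br c b) \<and>\<^sub>A ?c b x)" for b c
  proof -
    let ?a = "?c b x" and ?d = "?c c y" and ?v = "vec (br c b)"
    have 1: "?a \<and>\<^sub>A ?v \<and>\<^sub>A ?d = amult ((-1) ^ (Suc k * (Suc 0 + Suc l))) ((?v \<and>\<^sub>A ?d) \<and>\<^sub>A ?a)"
      by (intro wedge_commute parity_contract parity_wedge parity_vec x y)
    have 2: "?v \<and>\<^sub>A ?d = amult ((-1) ^ (Suc 0 * Suc l)) (?d \<and>\<^sub>A ?v)"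
      by (intro wedge_commute parity_contract parity_vec y)
    have "?a \<and>\<^sub>A ?v \<and>\<^sub>A ?d =
        amult ((-1) ^ (Suc k * (Suc 0 + Suc l))) (amult ((-1) ^ (Suc 0 * Suc l)) (?d \<and>\<^sub>A ?v \<and>\<^sub>A ?a))"
      by (subst 1, subst 2) (simp only: wedge_amult_left wedge_assoc)
    then show ?thesis
      unfolding grade_inv_parity[OF parity_contract[OF x]] grade_inv_parity[OF parity_contract[OF y]]
        br_anti[of b c] vec_minus
      by (cases "even k"; cases "even l") (simp_all add: minus_one_power_iff)
  qed
  have T3: "(\<Sum>b\<in>some_basis. \<Sum>c\<in>some_basis. grade_inv (?c b x) \<and>\<^sub>A vec (br b c) \<and>\<^sub>A ?c c y) =
      - amult ?s (\<Sum>b\<in>some_basis. \<Sum>c\<in>some_basis. grade_inv (?c b y) \<and>\<^sub>A vec (br b c) \<and>\<^sub>A ?c c x)"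
    unfolding swap3 by (subst sum.swap) (simp only: sum_negf amult.scale_sum_right)
  have "?s = 1 \<or> ?s = - 1" by (simp add: minus_one_power_iff)
  then show ?thesis
    unfolding expand[of x y] expand[of y x] T3 swap[OF x y] swap[OF y x] mult.commute[of "l + 1"]
    by (elim disjE) (simp_all add: sum_negf algebra_simps)
qed

lemma sbracket_of_fun_right: "sbracket x (of_fun f) = (\<Sum>b\<in>some_basis. amult (\<theta> b * pderiv f) (grade_inv (contract (coord b) x)))"
  by (simp add: sbracket_def lie_deriv_def of_fun_linear)

lemma sbracket_of_fun_of_fun [simp]: "sbracket (of_fun f) (of_fun g) = 0"
  by (simp add: sbracket_of_fun_right)

lemma sbracket_vec_of_fun [simp]: "sbracket (vec X) (of_fun f) = of_fun (\<theta> X * pderiv f)"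
proof -
  have "sbracket (vec X) (of_fun f) = (\<Sum>b\<in>some_basis. of_fun ([:coord b X:] * \<theta> b * pderiv f))"
    by (simp add: sbracket_of_fun_right of_fun_linear mult_ac)
  also have "\<dots> = of_fun ((\<Sum>b\<in>some_basis. [:coord b X:] * \<theta> b) * pderiv f)"
    by (simp only: of_fun_sum sum_distrib_right)
  finally show ?thesis by (simp only: sum_coord_action)
qed

lemma sbracket_of_fun_vec [simp]: "sbracket (of_fun f) (vec X) = - of_fun (\<theta> X * pderiv f)"
  using sbracket_commute[OF parity_of_fun parity_vec, of f X] by simp

lemma sbracket_vec_vec [simp]: "sbracket (vec X) (vec Y) = vec (br X Y)"
proof -
  have 1: "(\<Sum>c\<in>some_basis. amult [:coord c Y:] (vec (br b c))) = vec (br b Y)" for b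
    using arg_cong[OF sum_coord[of Y], of "\<lambda>y. vec (br b y)"]
    by (simp only: br_sum_right br_scale_right vec_sum vec_scale)
  have "sbracket (vec X) (vec Y) = (\<Sum>b\<in>some_basis. amult [:coord b X:] (vec (br b Y)))"
    by (simp add: sbracket_def lie_deriv_def 1)
  also have "\<dots> = vec (br X Y)"
    using arg_cong[OF sum_coord[of X], of "\<lambda>x. vec (br x Y)"]
    by (simp only: br_sum_left br_scale_left vec_sum vec_scale)
  finally show ?thesis .
qed

lemma parity_sbracket:
  assumes x: "parity k x" and y: "parity l y"
  shows "parity (k + l + 1) (sbracket x y)"
proof -
  have L: "parity l (lie_deriv b y)" for b
  proof -
    have "parity l (vec (br b c) \<and>\<^sub>A contract (coord c) y)" for c
    proof -
      have "parity (Suc 0 + Suc l) (vec (br b c) \<and>\<^sub>A contract (coord c) y)"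
        by (intro parity_wedge parity_vec parity_contract y)
      then show ?thesis by (subst parity_cong[of l "Suc 0 + Suc l"]) auto
    qed
    then show ?thesis unfolding lie_deriv_def using y by (intro parity_add parity_sum parity_amult parity_coeff_deriv)
  qed
  have "parity (k + l + 1) (grade_inv (contract (coord b) x) \<and>\<^sub>A lie_deriv b y)" for b
    using parity_wedge[OF parity_grade_inv[OF parity_contract[OF x]] L] by simp
  moreover have "parity (k + l + 1) (amult (\<theta> b) (coeff_deriv x) \<and>\<^sub>A contract (coord b) y)" for b
    using parity_wedge[OF parity_amult[OF parity_coeff_deriv[OF x]] parity_contract[OF y]] by simp
  ultimately show ?thesis unfolding sbracket_def by (intro parity_sum parity_diff)
qed

section \<open>The graded Jacobi identity\<close>

definition jacobiator where
  "jacobiator k l x y z = sbracket x (sbracket y z) - sbracket (sbracket x y) z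
     - amult ((-1) ^ ((k + 1) * (l + 1))) (sbracket y (sbracket x z))"

lemma sbracket_sign: "sbracket x (amult ((-1) ^ n) y) = amult ((-1) ^ n) (sbracket x y)"
  "sbracket (amult ((-1) ^ n) x) y = amult ((-1) ^ n) (sbracket x y)"
  by (cases "even n"; simp add: sbracket_minus)+

text \<open>With its companion for the last two arguments it brings any argument into the last slot,
  in which the jacobiator is a derivation.\<close>

lemma jacobiator_swap_left:
  assumes "parity k x" "parity l y"
  shows "jacobiator l k y x z = - amult ((-1) ^ ((k + 1) * (l + 1))) (jacobiator k l x y z)"
  unfolding jacobiator_def sbracket_commute[OF assms(2,1)]
  by (cases "even k"; cases "even l") (simp_all add: minus_one_power_iff sbracket_minus)

lemma jacobiator_swap_right:
  assumes "parity k x" "parity l y" "parity m z"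
  shows "jacobiator k m x z y = - amult ((-1) ^ ((l + 1) * (m + 1))) (jacobiator k l x y z)"
  unfolding jacobiator_def sbracket_commute[OF assms(3,2)]
    sbracket_commute[OF parity_sbracket[OF assms(1,3)] assms(2)]
    sbracket_commute[OF assms(3) parity_sbracket[OF assms(1,2)]]
  by (cases "even k"; cases "even l"; cases "even m") (simp_all add: minus_one_power_iff sbracket_minus)

text \<open>Each double bracket obeys the Leibniz rule twice; the mixed terms, with one bracket on
  each factor, cancel.\<close>

lemma jacobiator_wedge:
  assumes x: "parity k x" and y: "parity l y" and z: "parity m z"
  shows "jacobiator k l x y (z \<and>\<^sub>A w) =
    jacobiator k l x y z \<and>\<^sub>A w + amult ((-1) ^ ((k + l) * m)) (z \<and>\<^sub>A jacobiator k l x y w)"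
proof -
  note L = sbracket_leibniz
  have 1: "sbracket x (sbracket y (z \<and>\<^sub>A w)) =
      sbracket x (sbracket y z) \<and>\<^sub>A w + amult ((-1) ^ ((k + 1) * (l + m + 1))) (sbracket y z \<and>\<^sub>A sbracket x w) +
      amult ((-1) ^ ((l + 1) * m)) (sbracket x z \<and>\<^sub>A sbracket y w +
        amult ((-1) ^ ((k + 1) * m)) (z \<and>\<^sub>A sbracket x (sbracket y w)))"
    if x: "parity k x" and y: "parity l y" for k l x y
    by (simp only: L[OF y z] sbracket_add sbracket_sign L[OF x parity_sbracket[OF y z]] L[OF x z])
  have 2: "sbracket (sbracket x y) (z \<and>\<^sub>A w) =
      sbracket (sbracket x y) z \<and>\<^sub>A w + amult ((-1) ^ ((k + l + 1 + 1) * m)) (z \<and>\<^sub>A sbracket (sbracket x y) w)"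
    by (rule L[OF parity_sbracket[OF x y] z])
  show ?thesis
    unfolding jacobiator_def 1[OF x y] 1[OF y x] 2 wedge_distribs wedge_amult_left wedge_amult_right
    by (cases "even k"; cases "even l"; cases "even m")
      (simp_all add: minus_one_power_iff amult.scale_right_distrib algebra_simps)
qed

lemma jacobiator_add: "jacobiator k l x y (u + v) = jacobiator k l x y u + jacobiator k l x y v"
  by (simp add: jacobiator_def sbracket_add amult.scale_right_distrib)

text \<open>Up to order these are all cases: the Jacobi identity of the Lie algebra, the morphism
  property of \<open>\<theta>\<close>, and two cases in which every term contains a bracket of two
  functions.\<close>

lemma jacobiator_generators:
  "jacobiator (Suc 0) (Suc 0) (vec X) (vec Y) (vec Z) = 0"
  "jacobiator (Suc 0) (Suc 0) (vec X) (vec Y) (of_fun f) = 0"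
  "jacobiator (Suc 0) 0 (vec X) (of_fun f) (of_fun g) = 0"
  "jacobiator 0 0 (of_fun f) (of_fun g) (of_fun h) = 0"
proof -
  show "jacobiator (Suc 0) (Suc 0) (vec X) (vec Y) (vec Z) = 0"
    by (simp add: jacobiator_def jacobi' flip: vec_diff)
  show "jacobiator (Suc 0) (Suc 0) (vec X) (vec Y) (of_fun f) = 0"
    by (simp add: jacobiator_def action_br pderiv_mult algebra_simps flip: of_fun_linear(1-3))
qed (simp_all add: jacobiator_def sbracket_minus)

text \<open>A derivation in \<open>z\<close> that vanishes on functions and on Lie algebra elements
  vanishes on all they generate; the coefficient \<open>g\<close> counts as a factor of degree
  zero.\<close>

lemma jacobi_sbracket_extend:
  assumes x: "parity k x" and y: "parity l y"
    and f: "\<And>f. jacobiator k l x y (of_fun f) = 0" and v: "\<And>X. jacobiator k l x y (vec X) = 0"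
    and z: "z \<in> mvec m"
  shows "jacobiator k l x y z = 0"
  using z
proof (induction rule: mvec_induct)
  case zero
  show ?case using jacobiator_add[of k l x y 0 0] by simp
next
  case (add g Xs u)
  have "jacobiator k l x y (wedges (map vec Xs)) = 0"
  proof (induction Xs)
    case (Cons X Xs)
    then show ?case by (simp add: jacobiator_wedge[OF x y parity_vec] v)
  qed (simp add: f)
  then have "jacobiator k l x y (of_fun g \<and>\<^sub>A wedges (map vec Xs)) = 0"
    unfolding jacobiator_wedge[OF x y parity_of_fun] by (simp add: f del: wedge_of_fun_left wedge_of_fun_right)
  then show ?case using add by (simp add: jacobiator_add)
qed

definition generator :: "nat \<Rightarrow> ('k, 'g) multivector \<Rightarrow> bool" where
  "generator k x \<longleftrightarrow> (k = 0 \<and> (\<exists>f. x = of_fun f)) \<or> (k = Suc 0 \<and> (\<exists>X. x = vec X))"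

lemma generator_parity: "generator k x \<Longrightarrow> parity k x"
  by (auto simp: generator_def)

text \<open>The arguments are freed from being generators one at a time: \<open>extend\<close>
  reduces the last one to a generator, and swaps turn the result into the case settled
  before.\<close>

lemma sbracket_jacobi:
  assumes "x \<in> mvec k" "y \<in> mvec l" "z \<in> mvec m"
  shows "jacobiator k l x y z = 0"
proof -
  have extend: "jacobiator k l x y z = 0"
    if "parity k x" "parity l y" "\<And>m w. generator m w \<Longrightarrow> jacobiator k l x y w = 0" "z \<in> mvec m" for k l m x y z
    using jacobi_sbracket_extend[OF that(1,2) _ _ that(4)] that(3) by (auto simp: generator_def)
  have flipr: "jacobiator k m x z y = 0"
    if "parity k x" "parity l y" "parity m z" "jacobiator k l x y z = 0" for k l m x y z
    using jacobiator_swap_right[OF that(1-3)] that(4) by simp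
  have flipl: "jacobiator l k y x z = 0"
    if "parity k x" "parity l y" "jacobiator k l x y z = 0" for k l x y z
    using jacobiator_swap_left[OF that(1,2)] that(3) by simp
  note pg = generator_parity and pm = mvec_parity
  have ggg: "jacobiator k l x y z = 0" if g: "generator k x" "generator l y" "generator m z" for k l m x y z
  proof -
    note v = parity_vec and f = parity_of_fun
    have vfv: "jacobiator (Suc 0) 0 (vec X) (of_fun f) (vec Y) = 0" for X Y f
      using flipr[OF v v f jacobiator_generators(2)] .
    have fvv: "jacobiator 0 (Suc 0) (of_fun f) (vec X) (vec Y) = 0" for X Y f
      using flipl[OF v f vfv] .
    have fvf: "jacobiator 0 (Suc 0) (of_fun f) (vec X) (of_fun h) = 0" for X f h
      using flipl[OF v f jacobiator_generators(3)] .
    have ffv: "jacobiator 0 0 (of_fun f) (of_fun h) (vec X) = 0" for X f h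
      using flipr[OF f v f fvf] .
    show ?thesis
      using g jacobiator_generators vfv fvv fvf ffv by (auto simp: generator_def)
  qed
  have ggm: "jacobiator k l x y z = 0" if "generator k x" "generator l y" "z \<in> mvec m" for k l m x y z
    using extend[OF pg[OF that(1)] pg[OF that(2)] _ that(3)] ggg[OF that(1,2)] by blast
  have gmm: "jacobiator k l x y z = 0" if "generator k x" "y \<in> mvec l" "z \<in> mvec m" for k l m x y z
  proof (rule extend[OF pg[OF that(1)] pm[OF that(2)] _ that(3)])
    fix n w assume "generator n w"
    then show "jacobiator k l x y w = 0"
      using flipr[OF pg[OF that(1)] pg pm[OF that(2)] ggm[OF that(1) _ that(2)]] by blast
  qed
  show ?thesis
  proof (rule extend[OF pm[OF assms(1)] pm[OF assms(2)] _ assms(3)])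
    fix n w assume w: "generator n w"
    show "jacobiator k l x y w = 0"
      using flipr[OF pm[OF assms(1)] pg[OF w] pm[OF assms(2)]
          flipl[OF pg[OF w] pm[OF assms(1)] gmm[OF w assms(1,2)]]] .
  qed
qed

lemma sbracket_mvec:
  assumes x: "x \<in> mvec k" and y: "y \<in> mvec l"
  shows "if k + l = 0 then sbracket x y = 0 else sbracket x y \<in> mvec (k + l - 1)"
proof (cases "k + l = 0")
  case True
  then obtain f g where "x = of_fun f" "y = of_fun g" using assms mvec_0 by (metis add_is_0)
  then show ?thesis using True by simp
next
  case False
  have gi: "grade_inv u \<in> mvec n" if "u \<in> mvec n" for u n
    using grade_inv_parity[OF mvec_parity[OF that]] that by (simp add: mvec_closed)
  have c: "vec (br b c) \<and>\<^sub>A contract (coord c) y \<in> mvec l" for b c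
  proof (cases l)
    case 0
    then show ?thesis using y by (simp add: mvec_contract_0 mvec_closed)
  next
    case (Suc n)
    then show ?thesis using mvec_wedge[OF vec_mvec(1) mvec_contract[of y n]] y by simp
  qed
  have L: "lie_deriv b y \<in> mvec l" for b
    unfolding lie_deriv_def using c y by (intro mvec_closed mvec_coeff_deriv)
  have 1: "grade_inv (contract (coord b) x) \<and>\<^sub>A lie_deriv b y \<in> mvec (k + l - 1)" for b
  proof (cases k)
    case 0
    then show ?thesis using x by (simp add: mvec_contract_0 mvec_closed)
  next
    case (Suc n)
    then show ?thesis using mvec_wedge[OF gi[OF mvec_contract] L, of x n] x by simp
  qed
  have 2: "amult (\<theta> b) (coeff_deriv x) \<and>\<^sub>A contract (coord b) y \<in> mvec (k + l - 1)" for b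
  proof (cases l)
    case 0
    then show ?thesis using y by (simp add: mvec_contract_0 mvec_closed)
  next
    case (Suc n)
    then show ?thesis
      using mvec_wedge[OF mvec_closed(4)[OF mvec_coeff_deriv[OF x]] mvec_contract[of y n]] y by simp
  qed
  show ?thesis
    unfolding sbracket_def if_not_P[OF False] by (intro mvec_closed(6) mvec_closed(2) 1 2)
qed

lemma mvec_1_expand: "x \<in> mvec 1 \<Longrightarrow> x = (\<Sum>b\<in>some_basis. amult (x [coord b]) (vec b))"
proof (induction rule: mvec_induct)
  case zero
  have "(0 :: ('k, 'g) multivector) = (\<Sum>b\<in>some_basis. amult (0 [coord b]) (vec b))"
    by (simp add: zero_fun_apply)
  then show ?case .
next
  case (add f Xs v)
  obtain X where X: "Xs = [X]" using add(1) by (auto simp: length_Suc_conv)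
  have 1: "amult f (vec X) = (\<Sum>b\<in>some_basis. amult (f * [:coord b X:]) (vec b))"
    by (subst sum_coord_vec[symmetric]) (simp only: amult.scale_sum_right amult.scale_scale)
  have "amult f (wedges (map vec Xs)) = amult f (vec X)" by (simp add: X)
  moreover have "(amult f (vec X) + v) [coord b] = f * [:coord b X:] + v [coord b]" for b
    by (simp add: amult_apply fun_pointwise) (simp add: vec_def)
  ultimately have "(\<Sum>b\<in>some_basis. amult ((amult f (wedges (map vec Xs)) + v) [coord b]) (vec b)) =
      (\<Sum>b\<in>some_basis. amult (f * [:coord b X:]) (vec b)) + (\<Sum>b\<in>some_basis. amult (v [coord b]) (vec b))"
    by (simp only: amult.scale_left_distrib sum.distrib)
  also have "\<dots> = amult f (vec X) + v" by (simp only: 1[symmetric] add(3)[symmetric])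
  finally show ?case by (simp only: X list.map wedges_simps wedge_of_fun_right amult.scale_one)
qed

lemma anchor_vec [simp]: "anchor (vec X) = \<theta> X"
proof -
  have "anchor (vec X) = (\<Sum>b\<in>some_basis. [:coord b X:] * \<theta> b)"
    unfolding anchor_def by (simp add: vec_def)
  then show ?thesis by (simp only: sum_coord_action)
qed

lemma anchor_linear [simp]:
  "anchor (u + v) = anchor u + anchor v" "anchor (amult f u) = f * anchor u" "anchor 0 = 0"
  "anchor (u - v) = anchor u - anchor v" "anchor (- u) = - anchor u"
  by (simp_all add: anchor_def fun_pointwise amult_apply algebra_simps sum.distrib sum_distrib_left
      sum_negf sum_subtractf)

lemma sbracket_of_fun_anchor:
  assumes "x \<in> mvec 1"
  shows "sbracket x (of_fun f) = of_fun (anchor x * pderiv f)"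
proof -
  have c: "contract (coord b) x = of_fun (x [coord b])" for b
  proof -
    have "contract (coord b) x \<in> mvec 0" using mvec_contract[of x 0] assms by simp
    then obtain g where "contract (coord b) x = of_fun g" using mvec_0 by blast
    moreover from this have "g = x [coord b]" by (metis contract_def of_fun_def)
    ultimately show ?thesis by simp
  qed
  have "sbracket x (of_fun f) = (\<Sum>b\<in>some_basis. of_fun (x [coord b] * \<theta> b * pderiv f))"
    by (simp add: sbracket_of_fun_right of_fun_linear mult_ac c)
  also have "\<dots> = of_fun (\<Sum>b\<in>some_basis. x [coord b] * \<theta> b * pderiv f)"
    by (simp only: of_fun_sum)
  finally show ?thesis by (simp only: anchor_def sum_distrib_right)
qed

text \<open>Existence of a bracket with the required properties, which gives the choice in
  \<open>schouten\<close> its meaning.\<close>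

lemma sbracket_is_schouten: "is_schouten_bracket sbracket"
  unfolding is_schouten_bracket_def
proof (intro conjI allI ballI)
  fix k l m x y z assume xyz: "x \<in> mvec k" "y \<in> mvec l" "z \<in> mvec m"
  show "sbracket x (sbracket y z) = sbracket (sbracket x y) z + amult ((- 1) ^ ((k + 1) * (l + 1))) (sbracket y (sbracket x z))"
    using sbracket_jacobi[OF xyz] by (simp add: jacobiator_def algebra_simps)
  show "sbracket x (y \<and>\<^sub>A z) = sbracket x y \<and>\<^sub>A z + amult ((- 1) ^ ((k + 1) * l)) (y \<and>\<^sub>A sbracket x z)"
    using xyz by (intro sbracket_leibniz mvec_parity)
next
  fix k l x y assume xy: "x \<in> mvec k" "y \<in> mvec l"
  show "if k + l = 0 then sbracket x y = 0 else sbracket x y \<in> mvec (k + l - 1)"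
    using xy by (rule sbracket_mvec)
  show "sbracket x y = - amult ((- 1) ^ ((k + 1) * (l + 1))) (sbracket y x)"
    using xy by (intro sbracket_commute mvec_parity)
next
  fix a b X Y
  have f1: "sbracket (amult a (vec X)) (of_fun b) = of_fun (a * \<theta> X * pderiv b)" for a b X
  proof -
    have "amult a (vec X) \<in> mvec 1" by (intro mvec_closed vec_mvec)
    moreover have "anchor (amult a (vec X)) = a * \<theta> X"
      by simp
    ultimately show ?thesis by (simp only: sbracket_of_fun_anchor)
  qed
  \<comment> \<open>The coefficient is moved to the second slot by antisymmetry, where the Leibniz
    rule for the product of a function and a vector applies.\<close>
  have f2: "sbracket (amult a (vec X)) (vec Y) = amult a (vec (br X Y)) - amult (\<theta> Y * pderiv a) (vec X)"
  proof -
    have "sbracket (vec Y) (of_fun a \<and>\<^sub>A vec X) = amult (\<theta> Y * pderiv a) (vec X) - amult a (vec (br X Y))"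
      unfolding sbracket_leibniz[OF parity_vec parity_of_fun] using br_anti[of Y X]
      by (simp add: vec_minus)
    moreover have "sbracket (amult a (vec X)) (vec Y) = - sbracket (vec Y) (amult a (vec X))"
      using sbracket_commute[OF parity_amult[OF parity_vec] parity_vec, of a X Y] by simp
    ultimately show ?thesis by simp
  qed
  have f3: "sbracket (amult a (vec X)) (of_fun b \<and>\<^sub>A vec Y) =
      sbracket (amult a (vec X)) (of_fun b) \<and>\<^sub>A vec Y + amult b (sbracket (amult a (vec X)) (vec Y))"
    unfolding sbracket_leibniz[OF parity_amult[OF parity_vec] parity_of_fun] by simp
  show "sbracket (amult a (vec X)) (amult b (vec Y)) =
      amult (a * b) (vec (br X Y)) + amult (a * (\<theta> X * pderiv b)) (vec Y) - amult (b * (\<theta> Y * pderiv a)) (vec X)"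
    using f3 by (simp add: f1 f2 amult.scale_right_diff_distrib mult_ac)
qed (simp_all add: sbracket_add sbracket_scale sbracket_of_fun_anchor)

lemma schouten_is_schouten: "is_schouten_bracket schouten"
  unfolding schouten_def by (rule someI[of is_schouten_bracket, OF sbracket_is_schouten])

end


section \<open>Structure of a semisimple Lie algebra acting on \<open>K[t]\<close>\<close>

locale semisimple_action = fd_lie_action scale br \<theta>
  for scale :: "'k::real_or_complex_field \<Rightarrow> 'g::ab_group_add \<Rightarrow> 'g" and br :: "'g \<Rightarrow> 'g \<Rightarrow> 'g"
    and \<theta> :: "'g \<Rightarrow> 'k poly" +
  assumes ss: semisimple and nontrivial: "\<exists>X. \<theta> X \<noteq> 0"
begin

lemma killing_nondegenerate: "(\<And>y. killing x y = 0) \<Longrightarrow> x = 0"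
  using cartan_criterion[OF ss, of x] real_or_complex by blast

text \<open>\<open>T\<close> records the functional given by \<open>x\<close> on \<open>V\<close> as
  a vector of \<open>V\<close>, through its values on a basis \<open>C\<close>. Nondegeneracy makes
  \<open>T\<close> injective on \<open>V\<close>, hence onto \<open>V\<close>, so the functional of
  an arbitrary \<open>z\<close> is represented inside \<open>V\<close>.\<close>

lemma killing_represents_on_subspace:
  assumes V: "subspace V" and nondeg: "\<And>x. x \<in> V \<Longrightarrow> (\<And>y. y \<in> V \<Longrightarrow> killing x y = 0) \<Longrightarrow> x = 0"
  shows "\<exists>x\<in>V. \<forall>y\<in>V. killing x y = killing z y"
proof -
  obtain C where C: "C \<subseteq> V" "independent C" "V \<subseteq> span C"
    using maximal_independent_subset by blast
  have spanC: "span C = V" using C V by (metis span_minimal subset_antisym)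
  have finC: "finite C" using C(2) by (rule fdv.finiteI_independent)
  define T where "T = (\<lambda>x. \<Sum>c\<in>C. scale (killing x c) c)"
  interpret P: finite_dimensional_vector_space_pair_1 scale some_basis scale
    by unfold_locales
  have lin: "Vector_Spaces.linear scale scale T"
    using vector_space_axioms
    by (auto simp: Vector_Spaces.linear_iff T_def scale_left_distrib sum.distrib scale_sum_right)
  have T_eqD: "killing x y = killing x' y" if "T x = T x'" "y \<in> V" for x x' y
  proof -
    have "(\<Sum>c\<in>C. scale (killing (x - x') c) c) = 0"
      using that(1) by (simp add: T_def scale_left_diff_distrib sum_subtractf)
    then have "\<forall>c\<in>C. killing (x - x') c = 0"
      using independentD[OF C(2) finC subset_refl] by blast
    then have "span C \<subseteq> {y. killing (x - x') y = 0}"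
      by (intro span_minimal) (auto simp: subspace_def)
    then have "killing (x - x') y = 0" using that spanC by blast
    then show ?thesis by simp
  qed
  have inj: "inj_on T V"
  proof (rule inj_onI)
    fix x y assume xy: "x \<in> V" "y \<in> V" "T x = T y"
    have "x - y = 0"
      using xy T_eqD[OF xy(3)] by (intro nondeg subspace_diff[OF V]) auto
    then show "x = y" by simp
  qed
  have TV: "T x \<in> V" for x
    unfolding T_def using C V by (intro subspace_sum subspace_scale) auto
  interpret T: Vector_Spaces.linear scale scale T by (rule lin)
  have "subspace (T ` V)" using V by (rule T.subspace_image)
  moreover have "dim (T ` V) = dim V"
    using P.dim_image_eq[OF lin, of V] inj V by (simp add: span_eq_iff[THEN iffD2])
  ultimately have "T ` V = V" using TV V by (intro fdv.subspace_dim_equal) auto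
  then obtain x where "x \<in> V" "T x = T z" using TV[of z] by (metis imageE)
  then show ?thesis using T_eqD by blast
qed

section \<open>The ideal complementary to the kernel of the action\<close>

lemma ideal_kernel: "ideal kernel"
  by (auto simp: ideal_def subspace_def kernel_def action_add action_scale action_br)

definition kernel_orth :: "'g set" where
  "kernel_orth = {x. \<forall>y\<in>kernel. killing x y = 0}"

lemma idealD: "ideal I \<Longrightarrow> y \<in> I \<Longrightarrow> br x y \<in> I" "ideal I \<Longrightarrow> y \<in> I \<Longrightarrow> br y x \<in> I" "ideal I \<Longrightarrow> subspace I"
  by (auto simp: ideal_def br_anti[of y x] intro: subspace_neg)

lemma ideal_kernel_orth: "ideal kernel_orth"
proof -
  have "killing (br x y) z = 0" if "y \<in> kernel_orth" "z \<in> kernel" for x y z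
  proof -
    have "killing (br x y) z = - killing (br y x) z"
      using killing_linear(3)[of "-1" "br y x" z] by (simp add: br_anti[of x y])
    also have "\<dots> = 0"
      using that idealD(1)[OF ideal_kernel that(2), of x] by (simp add: killing_br kernel_orth_def)
    finally show ?thesis .
  qed
  then show ?thesis by (auto simp: ideal_def subspace_def kernel_orth_def)
qed

text \<open>By invariance \<open>[x, y]\<close> is orthogonal to everything for \<open>x\<close>,
  \<open>y\<close> in the intersection, which is therefore an abelian ideal.\<close>

lemma kernel_orth_Int_kernel: "kernel_orth \<inter> kernel = {0}"
proof -
  let ?J = "kernel_orth \<inter> kernel"
  have J: "ideal ?J"
    using ideal_kernel ideal_kernel_orth by (auto simp: ideal_def intro: subspace_inter)
  have "br x y = 0" if "x \<in> ?J" "y \<in> ?J" for x y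
  proof (rule killing_nondegenerate)
    fix z
    have "br y z \<in> kernel" using that idealD(2)[OF ideal_kernel] by blast
    then show "killing (br x y) z = 0" using that by (auto simp: killing_br kernel_orth_def)
  qed
  then have "derived_series ?J 1 \<subseteq> {0}"
    unfolding One_nat_def derived_series.simps by (intro span_minimal) auto
  moreover have "0 \<in> derived_series ?J 1" by (simp add: span_zero)
  ultimately have "derived_series ?J 1 = {0}" by blast
  then have "solvable ?J" unfolding solvable_def by blast
  then show ?thesis using ss J unfolding semisimple_def by blast
qed

text \<open>The trivial intersection makes the Killing form nondegenerate on \<open>kernel\<close>,
  so orthogonal projection to \<open>kernel\<close> exists.\<close>

lemma sl2_decomposition: "\<exists>x\<in>kernel_orth. \<exists>y\<in>kernel. z = x + y"
proof -
  have "\<exists>x\<in>kernel. \<forall>y\<in>kernel. killing x y = killing z y"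
    using kernel_orth_Int_kernel
    by (intro killing_represents_on_subspace idealD(3) ideal_kernel) (auto simp: kernel_orth_def)
  then obtain x where "x \<in> kernel" "z - x \<in> kernel_orth" by (auto simp: kernel_orth_def)
  then show ?thesis by (metis diff_add_cancel)
qed

text \<open>A complementary ideal \<open>s\<close> commutes with \<open>kernel\<close>. For
  \<open>x\<close> in \<open>s\<close> and \<open>y\<close> in \<open>kernel\<close> the operator
  \<open>br x (br y _)\<close> is then zero, so \<open>s\<close> is orthogonal to
  \<open>kernel\<close>; the decomposition along \<open>s\<close> gives the other inclusion.\<close>

lemma sl2_ideal_eq: "sl2_ideal = kernel_orth"
  unfolding sl2_ideal_def
proof (rule the_equality)
  show "ideal kernel_orth \<and> kernel_orth \<inter> kernel = {0} \<and> {x + y |x y. x \<in> kernel_orth \<and> y \<in> kernel} = UNIV"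
    using ideal_kernel_orth kernel_orth_Int_kernel sl2_decomposition by blast
next
  fix s assume s: "ideal s \<and> s \<inter> kernel = {0} \<and> {x + y |x y. x \<in> s \<and> y \<in> kernel} = UNIV"
  have comm: "br x y = 0" if "x \<in> s" "y \<in> kernel" for x y
    using idealD(1)[OF ideal_kernel that(2), of x] idealD(2)[of s x y] s that by blast
  have "killing x y = 0" if "x \<in> s" "y \<in> kernel" for x y
    using comm[OF that(1) idealD(2)[OF ideal_kernel that(2)]] by (simp add: killing_def trace_def)
  then have sub: "s \<subseteq> kernel_orth" by (auto simp: kernel_orth_def)
  moreover have "x \<in> s" if x: "x \<in> kernel_orth" for x
  proof -
    obtain a k where "a \<in> s" "k \<in> kernel" "x = a + k" using s by blast
    then have "k \<in> kernel_orth \<inter> kernel"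
      using subspace_diff[OF idealD(3)[OF ideal_kernel_orth] x, of a] sub by auto
    then show ?thesis using \<open>x = a + k\<close> \<open>a \<in> s\<close> kernel_orth_Int_kernel by auto
  qed
  ultimately show "s = kernel_orth" by blast
qed

lemma sl2_ideal: "ideal sl2_ideal"
  by (simp add: sl2_ideal_eq ideal_kernel_orth)

lemmas sl2_subspace = idealD(3)[OF sl2_ideal]

lemma sl2_action_inj: "x \<in> sl2_ideal \<Longrightarrow> y \<in> sl2_ideal \<Longrightarrow> \<theta> x = \<theta> y \<Longrightarrow> x = y"
proof -
  assume "x \<in> sl2_ideal" "y \<in> sl2_ideal" "\<theta> x = \<theta> y"
  then have "x - y \<in> kernel_orth \<inter> kernel"
    using subspace_diff[OF sl2_subspace, of x y] by (simp add: sl2_ideal_eq kernel_def)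
  then show "x = y" using kernel_orth_Int_kernel by simp
qed

lemma sl2_action_surj: "\<exists>x\<in>sl2_ideal. \<theta> x = \<theta> z"
  using sl2_decomposition[of z] by (auto simp: sl2_ideal_eq kernel_def action_add)

lemma not_solvable_sl2: "\<not> solvable sl2_ideal"
proof
  assume "solvable sl2_ideal"
  then have "sl2_ideal = {0}" using ss sl2_ideal by (auto simp: semisimple_def)
  then show False using nontrivial sl2_action_surj by force
qed

text \<open>The second derived term would vanish, making the ideal solvable. Every exclusion of a
  small image of \<open>\<theta>\<close> below ends in this contradiction.\<close>

lemma not_metabelian_sl2:
  assumes "\<And>x y. x \<in> sl2_ideal \<Longrightarrow> y \<in> sl2_ideal \<Longrightarrow> br x y \<in> A" and "subspace A"
    and "\<And>x y. x \<in> A \<Longrightarrow> y \<in> A \<Longrightarrow> br x y = 0"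
  shows False
proof -
  have 1: "derived_series sl2_ideal 1 \<subseteq> A"
    unfolding One_nat_def derived_series.simps using assms(1) by (intro span_minimal assms(2)) auto
  have "derived_series sl2_ideal (Suc 1) \<subseteq> {0}"
    unfolding derived_series.simps using assms(3) 1 by (intro span_minimal) auto
  moreover have "0 \<in> derived_series sl2_ideal (Suc 1)" by (simp add: span_zero)
  ultimately have "derived_series sl2_ideal (Suc 1) = {0}" by blast
  then show False using not_solvable_sl2 unfolding solvable_def by blast
qed

text \<open>All brackets of combinations of \<open>F\<close> and \<open>w\<close> are multiples of
  \<open>br F w\<close>, so they span an abelian subalgebra.\<close>

lemma sl2_not_two_dimensional:
  assumes "F \<in> sl2_ideal" "w \<in> sl2_ideal" and "\<And>x. x \<in> sl2_ideal \<Longrightarrow> \<exists>a b. x = scale a F + scale b w"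
  shows False
proof (rule not_metabelian_sl2)
  show "subspace (range (\<lambda>c. scale c (br F w)))"
  proof (rule subspaceI)
    show "0 \<in> range (\<lambda>c. scale c (br F w))" by (rule image_eqI[of _ _ 0]) auto
  qed (auto simp flip: scale_left_distrib)
  show "br x y \<in> range (\<lambda>c. scale c (br F w))" if xy: "x \<in> sl2_ideal" "y \<in> sl2_ideal" for x y
  proof -
    obtain a b a' b' where "x = scale a F + scale b w" "y = scale a' F + scale b' w"
      using assms(3) xy by meson
    then have "br x y = scale (a * b' - b * a') (br F w)"
      by (simp add: br_add_left br_add_right br_scale_left br_scale_right br_self br_anti[of w F]
          scale_left_diff_distrib mult.commute)
    then show ?thesis by blast
  qed
qed (auto simp: br_scale_left br_scale_right br_self)

text \<open>The leading terms give \<open>(m - n) t^(n + m - 1)\<close>, so two polynomials of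
  different positive degrees have a bracket of exactly this degree.\<close>

lemma coeff_bracket_top:
  fixes f g :: "'k poly"
  assumes "degree f = n" "degree g = m" "0 < m" "0 < n"
  shows "coeff (f * pderiv g - pderiv f * g) (n + m - 1) = (of_nat m - of_nat n) * (coeff f n * coeff g m)"
proof -
  have d: "coeff (pderiv h) (degree h - 1) = of_nat (degree h) * coeff h (degree h)"
    if "0 < degree h" for h :: "'k poly"
    unfolding coeff_pderiv using that by simp
  have "coeff (f * pderiv g) (degree f + degree (pderiv g)) = coeff f n * (of_nat m * coeff g m)"
    unfolding coeff_mult_degree_sum unfolding degree_pderiv using d[of g] assms by simp
  moreover have "coeff (pderiv f * g) (degree (pderiv f) + degree g) = (of_nat n * coeff f n) * coeff g m"
    unfolding coeff_mult_degree_sum unfolding degree_pderiv using d[of f] assms by simp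
  moreover have "degree f + degree (pderiv g) = n + m - 1" "degree (pderiv f) + degree g = n + m - 1"
    using assms by (simp_all add: degree_pderiv)
  ultimately show ?thesis by (simp add: algebra_simps)
qed

lemma degree_le_1_eq: "degree p \<le> 1 \<Longrightarrow> p = [:coeff p 0, coeff p 1:]"
  for p :: "'k poly"
  by (rule poly_eqI) (auto simp: coeff_pCons coeff_eq_0 split: nat.split)

text \<open>Finite dimension bounds the degrees, and brackets would raise them: with
  \<open>F\<close> of maximal degree \<open>n\<close>, elements of smaller degree have degree at
  most one. Solvability of smaller algebras then forces constants and linear polynomials to occur,
  and differentiating \<open>F\<close> gives \<open>n = 2\<close>.\<close>

lemma sl2_triple_exists:
  obtains H Ep Em where "H \<in> sl2_ideal" "Ep \<in> sl2_ideal" "Em \<in> sl2_ideal"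
    "\<theta> H = [:0, 1:]" "\<theta> Ep = [:0, 0, 1:]" "\<theta> Em = 1" "\<And>x. degree (\<theta> x) \<le> 2"
proof -
  let ?s = sl2_ideal
  note sub = sl2_subspace
  have "\<exists>N. \<forall>x. degree (\<theta> x) \<le> N"
  proof (intro exI allI)
    fix x
    have "degree (\<theta> x) = degree (\<Sum>b\<in>some_basis. [:coord b x:] * \<theta> b)" by (simp only: sum_coord_action)
    also have "\<dots> \<le> (\<Sum>b\<in>some_basis. degree (\<theta> b))"
    proof (rule degree_sum_le)
      fix b assume b: "b \<in> some_basis"
      have "degree ([:coord b x:] * \<theta> b) \<le> degree (\<theta> b)" by simp
      also have "\<dots> \<le> (\<Sum>b\<in>some_basis. degree (\<theta> b))" using b by (intro member_le_sum) auto
      finally show "degree ([:coord b x:] * \<theta> b) \<le> (\<Sum>b\<in>some_basis. degree (\<theta> b))" .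
    qed simp
    finally show "degree (\<theta> x) \<le> (\<Sum>b\<in>some_basis. degree (\<theta> b))" .
  qed
  then obtain N where N: "\<And>x. degree (\<theta> x) \<le> N" by blast
  have "\<exists>F. F \<in> ?s \<and> (\<forall>x. x \<in> ?s \<longrightarrow> degree (\<theta> x) \<le> degree (\<theta> F))"
    using ex_has_greatest_nat[of "\<lambda>x. x \<in> ?s" 0 "\<lambda>x. degree (\<theta> x)" "Suc N"] N subspace_0[OF sub]
    by (auto simp: less_Suc_eq_le)
  then obtain F where F: "F \<in> ?s" and max: "\<And>x. x \<in> ?s \<Longrightarrow> degree (\<theta> x) \<le> degree (\<theta> F)" by blast
  define n where "n = degree (\<theta> F)"
  \<comment> \<open>With degrees at most one all brackets are constant, and constants
    commute.\<close>
  have n2: "n \<ge> 2"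
  proof (rule ccontr)
    assume "\<not> n \<ge> 2"
    then have deg1: "degree (\<theta> x) \<le> 1" if "x \<in> ?s" for x using max[OF that] by (simp add: n_def)
    show False
    proof (rule not_metabelian_sl2)
      show "subspace {x \<in> ?s. degree (\<theta> x) = 0}"
        using subspace_add[OF sub] subspace_scale[OF sub] subspace_0[OF sub] degree_add_le[of _ 0]
        by (intro subspaceI) (auto simp: action_add action_scale)
    next
      fix x y assume xy: "x \<in> ?s" "y \<in> ?s"
      have "\<theta> (br x y) = [:coeff (\<theta> x) 0 * coeff (\<theta> y) 1 - coeff (\<theta> x) 1 * coeff (\<theta> y) 0:]"
        unfolding action_br
        by (subst (1 2) degree_le_1_eq[OF deg1[OF xy(1)]], subst (1 2) degree_le_1_eq[OF deg1[OF xy(2)]])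
          (simp add: pderiv_pCons)
      then show "br x y \<in> {x \<in> ?s. degree (\<theta> x) = 0}" using idealD(1)[OF sl2_ideal xy(2)] by simp
    next
      fix x y assume xy: "x \<in> {x \<in> ?s. degree (\<theta> x) = 0}" "y \<in> {x \<in> ?s. degree (\<theta> x) = 0}"
      then have "pderiv (\<theta> x) = 0" "pderiv (\<theta> y) = 0" by (simp_all add: pderiv_eq_0_iff)
      then have "\<theta> (br x y) = 0" by (simp add: action_br)
      then show "br x y = 0"
        using xy idealD(1)[OF sl2_ideal] subspace_0[OF sub] by (intro sl2_action_inj) auto
    qed
  qed
  define l where "l = coeff (\<theta> F) n"
  have l0: "l \<noteq> 0" unfolding l_def n_def using n2 n_def by auto
  define W where "W = {x \<in> ?s. degree (\<theta> x) < n}"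
  \<comment> \<open>Otherwise the bracket of \<open>F\<close> with an element of degree
    \<open>m\<close>, \<open>2 \<le> m < n\<close>, would have degree at least
    \<open>n + m - 1\<close>, more than the maximum.\<close>
  have W1: "degree (\<theta> w) \<le> 1" if w: "w \<in> W" for w
  proof (rule ccontr)
    define m where "m = degree (\<theta> w)"
    assume "\<not> degree (\<theta> w) \<le> 1"
    then have m: "2 \<le> m" "m < n" using w by (auto simp: m_def W_def)
    have "coeff (\<theta> (br F w)) (n + m - 1) = (of_nat m - of_nat n) * (l * coeff (\<theta> w) m)"
      unfolding action_br l_def using n2 m by (intro coeff_bracket_top) (auto simp: n_def m_def)
    moreover have "coeff (\<theta> w) m \<noteq> 0" unfolding m_def using m by (auto simp: m_def)
    ultimately have "coeff (\<theta> (br F w)) (n + m - 1) \<noteq> 0" using l0 m by simp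
    then have "n + m - 1 \<le> degree (\<theta> (br F w))" by (rule le_degree)
    moreover have "br F w \<in> ?s" using idealD(1)[OF sl2_ideal] w by (auto simp: W_def)
    ultimately show False using max[of "br F w"] m by (simp add: n_def)
  qed
  have W_dec: "x - scale (coeff (\<theta> x) n / l) F \<in> W" if x: "x \<in> ?s" for x
  proof -
    let ?y = "x - scale (coeff (\<theta> x) n / l) F"
    have y: "?y \<in> ?s" using x F by (intro subspace_diff[OF sub] subspace_scale[OF sub])
    have "coeff (\<theta> ?y) n = 0" using l0 by (simp add: action_scale l_def)
    moreover have "degree (\<theta> ?y) \<le> n" using max[OF y] by (simp add: n_def)
    ultimately have "degree (\<theta> ?y) < n"
      using n2 by (metis degree_0 eq_zero_or_degree_less less_le_trans pos2)
    then show ?thesis using y by (simp add: W_def)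
  qed
  have W_add: "scale a x + scale b y \<in> W" if "x \<in> W" "y \<in> W" for x y a b
  proof -
    have "degree (Polynomial.smult a (\<theta> x)) < n" "degree (Polynomial.smult b (\<theta> y)) < n"
      using that le_less_trans[OF degree_smult_le] by (auto simp: W_def)
    then have "degree (\<theta> (scale a x + scale b y)) < n"
      by (simp only: action_add action_scale degree_add_less)
    moreover have "scale a x + scale b y \<in> ?s"
      using that by (intro subspace_add[OF sub] subspace_scale[OF sub]) (auto simp: W_def)
    ultimately show ?thesis by (simp add: W_def)
  qed
  \<comment> \<open>\<open>F\<close> and \<open>W\<close> together span the ideal, so it would have
    dimension at most two.\<close>
  have no_line: "\<not> (\<exists>w\<in>W. \<forall>x\<in>W. \<exists>c. x = scale c w)"
  proof
    assume "\<exists>w\<in>W. \<forall>x\<in>W. \<exists>c. x = scale c w"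
    then obtain w where w: "w \<in> W" "\<And>x. x \<in> W \<Longrightarrow> \<exists>c. x = scale c w" by blast
    show False
    proof (rule sl2_not_two_dimensional[OF F])
      show "w \<in> ?s" using w by (simp add: W_def)
      fix x assume "x \<in> ?s"
      then obtain c where "x - scale (coeff (\<theta> x) n / l) F = scale c w" using w(2)[OF W_dec] by blast
      then show "\<exists>a b. x = scale a F + scale b w" by (metis add.commute diff_add_cancel)
    qed
  qed
  have Ws: "x \<in> ?s" if "x \<in> W" for x using that by (simp add: W_def)
  have W0: "0 \<in> W" using subspace_0[OF sub] n2 by (simp add: W_def)
  \<comment> \<open>Without constants an element of \<open>W\<close> is determined by its linear
    coefficient, so \<open>W\<close> would be a line.\<close>
  have "\<exists>w0\<in>W. degree (\<theta> w0) = 0 \<and> \<theta> w0 \<noteq> 0"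
  proof (rule ccontr)
    assume none: "\<not> ?thesis"
    have "\<exists>w1\<in>W. \<forall>x\<in>W. \<exists>c. x = scale c w1"
    proof (cases "\<exists>w1\<in>W. coeff (\<theta> w1) 1 \<noteq> 0")
      case True
      then obtain w1 where w1: "w1 \<in> W" "coeff (\<theta> w1) 1 \<noteq> 0" by blast
      have "x = scale (coeff (\<theta> x) 1 / coeff (\<theta> w1) 1) w1" if x: "x \<in> W" for x
      proof -
        let ?c = "coeff (\<theta> x) 1 / coeff (\<theta> w1) 1"
        let ?y = "scale 1 x + scale (- ?c) w1"
        have y: "?y \<in> W" using W_add[OF x w1(1)] .
        have "coeff (\<theta> ?y) 1 = 0" using w1 by (simp add: action_add action_scale)
        then have "degree (\<theta> ?y) = 0" using degree_le_1_eq[OF W1[OF y]] by (metis degree_pCons_0 pCons_0_0)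
        then have "\<theta> ?y = 0" using none y by blast
        then have "\<theta> x = \<theta> (scale ?c w1)" by (simp add: action_add action_scale)
        then show ?thesis using Ws[OF x] Ws[OF w1(1)] subspace_scale[OF sub] by (intro sl2_action_inj) auto
      qed
      then show ?thesis using w1 by blast
    next
      case False
      \<comment> \<open>Here \<open>W\<close> is zero, and the zero vector plays the part of
        \<open>w1\<close>.\<close>
      have "x = scale 0 0" if x: "x \<in> W" for x
      proof -
        have "degree (\<theta> x) = 0" using degree_le_1_eq[OF W1[OF x]] False x by (metis degree_pCons_0 pCons_0_0)
        then have "\<theta> x = \<theta> 0" using none x by auto
        then show ?thesis using Ws[OF x] Ws[OF W0] by (simp add: sl2_action_inj)
      qed
      then show ?thesis using W0 by blast
    qed
    then show False using no_line by blast
  qed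
  then obtain w0 where w0: "w0 \<in> W" "degree (\<theta> w0) = 0" "\<theta> w0 \<noteq> 0" by blast
  then obtain a where a: "\<theta> w0 = [:a:]" "a \<noteq> 0" by (metis degree_0_id pCons_0_0)
  define Em where "Em = scale (1 / a) w0"
  have Em: "\<theta> Em = 1" "Em \<in> ?s" "Em \<in> W"
    using a w0 Ws subspace_scale[OF sub] W_add[OF w0(1) W0, of "1 / a" 0]
    by (auto simp: Em_def action_scale one_pCons)
  have "\<exists>w1\<in>W. coeff (\<theta> w1) 1 \<noteq> 0"
  proof (rule ccontr)
    assume none: "\<not> ?thesis"
    have "x = scale (coeff (\<theta> x) 0) Em" if x: "x \<in> W" for x
    proof (rule sl2_action_inj)
      have "\<theta> x = [:coeff (\<theta> x) 0:]"
        using degree_le_1_eq[OF W1[OF x]] none x by (metis pCons_0_0)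
      then show "\<theta> x = \<theta> (scale (coeff (\<theta> x) 0) Em)"
        using Em(1) by (simp add: action_scale)
    qed (use Ws[OF x] Em subspace_scale[OF sub] in auto)
    then show False using no_line Em(3) by blast
  qed
  then obtain w1 where w1: "w1 \<in> W" "coeff (\<theta> w1) 1 \<noteq> 0" by blast
  define H where "H = scale (1 / coeff (\<theta> w1) 1) (w1 - scale (coeff (\<theta> w1) 0) Em)"
  have H: "\<theta> H = [:0, 1:]" "H \<in> ?s"
  proof -
    have "\<theta> w1 - Polynomial.smult (coeff (\<theta> w1) 0) 1 = [:0, coeff (\<theta> w1) 1:]"
      by (subst (1) degree_le_1_eq[OF W1[OF w1(1)]]) (simp add: one_pCons)
    then show "\<theta> H = [:0, 1:]" using w1(2) Em(1) by (simp add: H_def action_scale)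
    show "H \<in> ?s"
      unfolding H_def using Ws[OF w1(1)] Em by (intro subspace_scale[OF sub] subspace_diff[OF sub])
  qed
  \<comment> \<open>Bracketing with \<open>Em\<close> differentiates, so \<open>F\<close> yields an
    element of \<open>W\<close> of degree \<open>n - 1\<close>, which is at most one.\<close>
  have n: "n = 2"
  proof -
    have d: "\<theta> (br Em F) = pderiv (\<theta> F)" by (simp add: action_br Em)
    then have "br Em F \<in> W"
      using idealD(1)[OF sl2_ideal F] n2 by (simp add: W_def degree_pderiv n_def)
    then show ?thesis using W1[of "br Em F"] d n2 by (simp add: degree_pderiv n_def)
  qed
  have deg: "degree (\<theta> x) \<le> 2" for x
    using sl2_action_surj[of x] max n by (metis n_def)
  define Ep where "Ep = scale (1 / l) (F - scale (coeff (\<theta> F) 1) H - scale (coeff (\<theta> F) 0) Em)"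
  have "\<theta> F - Polynomial.smult (coeff (\<theta> F) 1) [:0, 1:] - Polynomial.smult (coeff (\<theta> F) 0) 1 = [:0, 0, l:]"
    using deg[of F] n
    by (intro poly_eqI)
      (auto simp: l_def one_pCons coeff_pCons coeff_eq_0 numeral_2_eq_2 split: nat.split)
  then have "\<theta> Ep = [:0, 0, 1:]" using l0 Em(1) H(1) by (simp add: Ep_def action_scale)
  moreover have "Ep \<in> ?s"
    unfolding Ep_def using F H Em by (intro subspace_scale[OF sub] subspace_diff[OF sub])
  ultimately show thesis using that H Em deg by blast
qed

end

section \<open>The Killing form with polynomial coefficients\<close>

context fd_lie_algebra
begin

lemma const_poly_sum: "[:sum f A:] = (\<Sum>a\<in>A. [:f a:])"
  by (rule sum_comp_morphism[unfolded o_def, symmetric]) simp_all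

lemma killing_ext_linear:
  "killing_ext (u + v) w = killing_ext u w + killing_ext v w"
  "killing_ext (u - v) w = killing_ext u w - killing_ext v w"
  "killing_ext (amult f u) w = f * killing_ext u w"
  by (simp_all add: killing_ext_def fun_pointwise amult_apply algebra_simps sum.distrib sum_subtractf sum_distrib_left)

lemma killing_ext_vec_right:
  "killing_ext u (vec X) = (\<Sum>b\<in>some_basis. u [coord b] * [:killing b X:])"
proof -
  have "(\<Sum>c\<in>some_basis. [:coord c X:] * [:killing b c:]) = [:killing b X:]" for b
  proof -
    have "killing b X = killing b (\<Sum>c\<in>some_basis. scale (coord c X) c)" by (simp add: sum_coord)
    also have "\<dots> = (\<Sum>c\<in>some_basis. coord c X * killing b c)" by (simp only: killing_sum killing_linear)
    finally show ?thesis by (simp add: const_poly_sum mult.commute)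
  qed
  then have "(\<Sum>c\<in>some_basis. u [coord b] * ([:coord c X:] * [:killing b c:])) = u [coord b] * [:killing b X:]" for b
    by (simp only: sum_distrib_left[symmetric])
  moreover have "vec X [coord c] = [:coord c X:]" for c by (simp add: vec_def)
  ultimately show ?thesis by (simp only: killing_ext_def mult.assoc)
qed

lemma killing_ext_vec: "killing_ext (vec X) (vec Y) = [:killing X Y:]"
proof -
  have "killing X Y = killing (\<Sum>b\<in>some_basis. scale (coord b X) b) Y" by (simp add: sum_coord)
  also have "\<dots> = (\<Sum>b\<in>some_basis. coord b X * killing b Y)" by (simp only: killing_sum killing_linear)
  finally have "[:killing X Y:] = (\<Sum>b\<in>some_basis. [:coord b X:] * [:killing b Y:])"
    by (simp add: const_poly_sum mult.commute)
  moreover have "vec X [coord b] = [:coord b X:]" for b by (simp add: vec_def)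
  ultimately show ?thesis by (simp only: killing_ext_vec_right)
qed

end

context semisimple_action
begin

text \<open>For each \<open>n\<close> the coefficients of \<open>t^n\<close> in \<open>d\<close>
  form an element of the Lie algebra that is orthogonal to everything.\<close>

lemma killing_ext_nondegenerate:
  assumes d: "d \<in> mvec 1" and 0: "\<And>X. killing_ext d (vec X) = 0"
  shows "d = 0"
proof -
  have "coeff (d [coord b]) n = 0" if b: "b \<in> some_basis" for b n
  proof -
    define x where "x = (\<Sum>b\<in>some_basis. scale (coeff (d [coord b]) n) b)"
    have "killing x X = coeff (\<Sum>b\<in>some_basis. d [coord b] * [:killing b X:]) n" for X
      by (simp add: x_def killing_sum coeff_sum mult.commute)
    then have "x = 0"
      using 0 by (intro killing_nondegenerate) (simp add: killing_ext_vec_right)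
    then have "coord b x = 0" by simp
    moreover have "coord b x = (\<Sum>c\<in>some_basis. if c = b then coeff (d [coord c]) n else 0)"
      unfolding x_def coord_sum by (intro sum.cong) (auto simp: coord_basis)
    ultimately show ?thesis using b by simp
  qed
  then have "d [coord b] = 0" if "b \<in> some_basis" for b
    using that by (intro poly_eqI) simp
  then have "(\<Sum>b\<in>some_basis. amult (d [coord b]) (vec b)) = 0" by (intro sum.neutral) simp
  then show ?thesis using mvec_1_expand[OF d] by simp
qed

end

definition tvar :: "'k::field poly" where "tvar = [:0, 1:]"

text \<open>Like \<open>tvar\<close> an opaque constant: calculations become identities in a
  commutative ring, with \<open>4 * quarter = 1\<close> in place of coefficient lists.\<close>

definition quarter :: "'k::field poly" where "quarter = [:1 / 4:]"

lemma pderiv_tvar [simp]: "pderiv tvar = 1"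
  by (simp add: tvar_def pderiv_pCons one_pCons)

lemma pderiv_quarter [simp]: "pderiv quarter = 0"
  by (simp add: quarter_def)

lemma quarter: "4 * quarter = (1 :: 'k::field_char_0 poly)"
  by (simp add: quarter_def one_pCons numeral_poly)

section \<open>Coordinates on the copy of sl(2)\<close>

locale sl2_triple = semisimple_action scale br \<theta>
  for scale :: "'k::real_or_complex_field \<Rightarrow> 'g::ab_group_add \<Rightarrow> 'g" and br :: "'g \<Rightarrow> 'g \<Rightarrow> 'g"
    and \<theta> :: "'g \<Rightarrow> 'k poly" +
  fixes H Ep Em :: 'g
  assumes triple_in: "H \<in> sl2_ideal" "Ep \<in> sl2_ideal" "Em \<in> sl2_ideal"
    and action_triple: "\<theta> H = tvar" "\<theta> Ep = tvar * tvar" "\<theta> Em = 1"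
    and degree_action: "degree (\<theta> x) \<le> 2"
begin

text \<open>\<open>c0\<close>, \<open>c1\<close>, \<open>c2\<close> are the coordinates along
  \<open>Em\<close>, \<open>H\<close>, \<open>Ep\<close>. They are defined on the whole Lie algebra
  and vanish on \<open>kernel\<close>.\<close>

definition c0 :: "'g \<Rightarrow> 'k" where "c0 x = coeff (\<theta> x) 0"
definition c1 :: "'g \<Rightarrow> 'k" where "c1 x = coeff (\<theta> x) 1"
definition c2 :: "'g \<Rightarrow> 'k" where "c2 x = coeff (\<theta> x) 2"

lemma action_coeffs: "\<theta> x = [:c0 x, c1 x, c2 x:]"
  using degree_action[of x]
  by (intro poly_eqI) (auto simp: c0_def c1_def c2_def coeff_pCons coeff_eq_0 numeral_2_eq_2 split: nat.split)

lemma action_expand: "\<theta> x = [:c0 x:] + [:c1 x:] * tvar + [:c2 x:] * (tvar * tvar)"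
  by (simp add: action_coeffs tvar_def)

lemma pderiv_action: "pderiv (\<theta> x) = [:c1 x:] + 2 * [:c2 x:] * tvar"
  by (simp add: action_coeffs tvar_def pderiv_pCons numeral_poly)

lemma c_linear [simp]:
  "c0 (x + y) = c0 x + c0 y" "c1 (x + y) = c1 x + c1 y" "c2 (x + y) = c2 x + c2 y"
  "c0 (scale r x) = r * c0 x" "c1 (scale r x) = r * c1 x" "c2 (scale r x) = r * c2 x"
  "c0 (x - y) = c0 x - c0 y" "c1 (x - y) = c1 x - c1 y" "c2 (x - y) = c2 x - c2 y"
  "c0 (- x) = - c0 x" "c1 (- x) = - c1 x" "c2 (- x) = - c2 x" "c0 0 = 0" "c1 0 = 0" "c2 0 = 0"
  by (simp_all add: c0_def c1_def c2_def action_add action_scale)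

lemma c_triple [simp]:
  "c0 H = 0" "c1 H = 1" "c2 H = 0" "c0 Ep = 0" "c1 Ep = 0" "c2 Ep = 1" "c0 Em = 1" "c1 Em = 0" "c2 Em = 0"
  by (simp_all add: c0_def c1_def c2_def action_triple tvar_def numeral_2_eq_2 one_pCons)

lemma c_br:
  "c0 (br x y) = c0 x * c1 y - c1 x * c0 y"
  "c1 (br x y) = 2 * (c0 x * c2 y - c2 x * c0 y)"
  "c2 (br x y) = c1 x * c2 y - c2 x * c1 y"
  unfolding c0_def[of "br x y"] c1_def[of "br x y"] c2_def[of "br x y"] action_br action_coeffs[of x] action_coeffs[of y]
  by (simp_all add: pderiv_pCons numeral_2_eq_2 algebra_simps)

lemma sl2_eqI:
  assumes "x \<in> sl2_ideal" "y \<in> sl2_ideal" "c0 x = c0 y" "c1 x = c1 y" "c2 x = c2 y"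
  shows "x = y"
  using assms by (intro sl2_action_inj) (simp_all add: action_coeffs)

lemma triple_combination [simp]: "scale a H + scale b Ep + scale c Em \<in> sl2_ideal"
  using triple_in by (intro subspace_add[OF sl2_subspace] subspace_scale[OF sl2_subspace])

lemma sl2_expand: "x \<in> sl2_ideal \<Longrightarrow> x = scale (c1 x) H + scale (c2 x) Ep + scale (c0 x) Em"
  by (rule sl2_eqI) auto

text \<open>The bracket lies in the ideal for every \<open>x\<close>, so its three coordinates
  determine it.\<close>

lemma br_triple:
  "br x H = scale 0 H + scale (- c2 x) Ep + scale (c0 x) Em"
  "br x Ep = scale (2 * c0 x) H + scale (c1 x) Ep + scale 0 Em"
  "br x Em = scale (- 2 * c2 x) H + scale 0 Ep + scale (- c1 x) Em"
  by (rule sl2_eqI[OF idealD(1)[OF sl2_ideal] triple_combination]; simp add: triple_in c_br)+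

lemma br_triple_left:
  "br H x = scale (c2 x) Ep - scale (c0 x) Em"
  "br Ep x = scale (- 2 * c0 x) H - scale (c1 x) Ep"
  "br Em x = scale (2 * c2 x) H + scale (c1 x) Em"
  unfolding br_anti[of _ x] br_triple by simp_all

text \<open>By \<open>br_triple_left\<close> each composite \<open>br H (br x _)\<close> and its
  analogues is a sum of operators of rank one, whose traces are values of \<open>c0\<close>,
  \<open>c1\<close>, \<open>c2\<close> on brackets.\<close>

lemma killing_triple:
  "killing H x = 2 * c1 x" "killing Ep x = - 4 * c0 x" "killing Em x = - 4 * c2 x"
proof -
  note r1 = trace_rank_one[of "\<lambda>w. c0 (br x w)"] trace_rank_one[of "\<lambda>w. c1 (br x w)"]
    trace_rank_one[of "\<lambda>w. c2 (br x w)"] trace_rank_one[of "\<lambda>w. - 2 * c0 (br x w)"]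
    trace_rank_one[of "\<lambda>w. 2 * c2 (br x w)"]
  show "killing H x = 2 * c1 x"
    unfolding killing_def br_triple_left trace_linear
    by (subst r1; (simp add: br_add_right br_scale_right)?; subst r1; simp add: br_add_right br_scale_right c_br)
  show "killing Ep x = - 4 * c0 x"
    unfolding killing_def br_triple_left trace_linear
    by (subst r1; (simp add: br_add_right br_scale_right algebra_simps)?; subst r1; simp add: br_add_right br_scale_right c_br)
  show "killing Em x = - 4 * c2 x"
    unfolding killing_def br_triple_left trace_linear
    by (subst r1; (simp add: br_add_right br_scale_right algebra_simps)?; subst r1; simp add: br_add_right br_scale_right c_br)
qed

text \<open>The coefficients invert \<open>killing_triple\<close>: 2 times t/2 is
  \<open>\<theta> H\<close>, -4 times -t^2/4 is \<open>\<theta> Ep\<close>, and -4 times -1/4 is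
  \<open>\<theta> Em\<close>.\<close>

definition vsharp :: "('k, 'g) multivector" where
  "vsharp = amult (2 * quarter * tvar) (vec H) - amult quarter (vec Ep) - amult (quarter * (tvar * tvar)) (vec Em)"

lemma vsharp_mvec: "vsharp \<in> mvec 1" "vsharp \<in> mvec (Suc 0)"
  unfolding vsharp_def by (intro mvec_closed vec_mvec)+

lemma killing_ext_vsharp: "killing_ext vsharp (vec X) = \<theta> X"
proof -
  have const: "[:2 * a:] = 2 * [:a:]" "[:- 4 * a:] = - 4 * [:a:]" for a :: 'k
    by (simp_all add: numeral_poly)
  have ring: "2 * q * t * (2 * b) - q * (- 4 * a) - q * (t * t) * (- 4 * c) = 4 * q * (a + b * t + c * (t * t))"
    for q t a b c :: "'k poly"
    by (simp add: algebra_simps)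
  have "killing_ext vsharp (vec X) =
      4 * quarter * ([:c0 X:] + [:c1 X:] * tvar + [:c2 X:] * (tvar * tvar))"
    unfolding vsharp_def killing_ext_linear killing_ext_vec killing_triple const ring ..
  then show ?thesis by (simp only: quarter action_expand) simp
qed

lemma sharp_eq: "sharp f = amult (pderiv f) vsharp"
  unfolding sharp_def
proof (rule the_equality)
  show "amult (pderiv f) vsharp \<in> mvec 1 \<and> (\<forall>X. killing_ext (amult (pderiv f) vsharp) (vec X) = \<theta> X * pderiv f)"
    by (simp add: killing_ext_linear killing_ext_vsharp mvec_closed vsharp_mvec mult.commute)
next
  fix v assume v: "v \<in> mvec 1 \<and> (\<forall>X. killing_ext v (vec X) = \<theta> X * pderiv f)"
  have "v - amult (pderiv f) vsharp = 0"
    using v by (intro killing_ext_nondegenerate mvec_closed vsharp_mvec)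
      (auto simp: killing_ext_linear killing_ext_vsharp mult.commute)
  then show "v = amult (pderiv f) vsharp" by simp
qed

lemma D_op_is_D: "is_D_operator D_op"
proof -
  have "is_D_operator (\<lambda>u. vsharp \<and>\<^sub>A coeff_deriv u)"
    by (simp add: is_D_operator_def wedge_distribs sharp_eq)
  then show ?thesis unfolding D_op_def by (rule someI[of is_D_operator])
qed

lemma D_op_eq: "u \<in> mvec k \<Longrightarrow> D_op u = vsharp \<and>\<^sub>A coeff_deriv u"
proof (induction rule: mvec_induct)
  case zero
  have "D_op (0 + 0) = D_op 0 + D_op 0"
    using D_op_is_D mvec_in_mvecs[OF mvec_closed(5)] unfolding is_D_operator_def by blast
  then have "D_op 0 = vsharp \<and>\<^sub>A coeff_deriv 0" by simp
  then show ?case .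
next
  case (add f Xs v)
  have "D_op (amult f (wedges (map vec Xs)) + v) = D_op (amult f (wedges (map vec Xs))) + D_op v"
    using D_op_is_D mvec_in_mvecs[OF mvecI] mvec_in_mvecs[OF add(2)] unfolding is_D_operator_def by blast
  moreover have "D_op (amult f (wedges (map vec Xs))) = amult (pderiv f) vsharp \<and>\<^sub>A wedges (map vec Xs)"
    using D_op_is_D unfolding is_D_operator_def sharp_eq by blast
  ultimately show ?case using add(3) by (simp add: wedge_distribs)
qed

text \<open>The contributions are t^2/2, -t^2/4 and -t^2/4. Thus \<open>vsharp\<close> lies in L,
  and bracketing with it commutes with multiplication by functions.\<close>

lemma anchor_vsharp [simp]: "anchor vsharp = 0"
  unfolding vsharp_def by (simp add: action_triple algebra_simps)

end


section \<open>Cocycle and dynamical \<open>r\<close>-matrix\<close>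

context fd_lie_action
begin

lemmas schouten_axioms = schouten_is_schouten[unfolded is_schouten_bracket_def]

lemma schouten_add:
  assumes "x \<in> mvec k" "y \<in> mvec k" "z \<in> mvec l"
  shows "schouten (x + y) z = schouten x z + schouten y z" "schouten z (x + y) = schouten z x + schouten z y"
  using schouten_axioms[THEN conjunct1] assms[THEN mvec_in_mvecs] by blast+

lemma schouten_zero: "z \<in> mvec l \<Longrightarrow> schouten 0 z = 0" "z \<in> mvec l \<Longrightarrow> schouten z 0 = 0"
  using schouten_add[OF mvec_closed(5) mvec_closed(5), of z l] by simp_all

lemma schouten_minus:
  assumes "x \<in> mvec k" "z \<in> mvec l"
  shows "schouten (- x) z = - schouten x z" "schouten z (- x) = - schouten z x"
  using schouten_add[OF assms(1) mvec_closed(3)[OF assms(1)] assms(2)] schouten_zero[OF assms(2)]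
  by (simp_all add: add_eq_0_iff)

lemma schouten_diff:
  assumes "x \<in> mvec k" "y \<in> mvec k" "z \<in> mvec l"
  shows "schouten (x - y) z = schouten x z - schouten y z" "schouten z (x - y) = schouten z x - schouten z y"
  using schouten_add[OF assms(1) mvec_closed(3)[OF assms(2)] assms(3)] schouten_minus[OF assms(2,3)]
  by simp_all

lemma schouten_mvec: "x \<in> mvec k \<Longrightarrow> y \<in> mvec l \<Longrightarrow> k + l \<noteq> 0 \<Longrightarrow> schouten x y \<in> mvec (k + l - 1)"
  using schouten_axioms[THEN conjunct2, THEN conjunct2, THEN conjunct1] by metis

lemma schouten_of_fun_of_fun: "schouten (of_fun f) (of_fun g) = 0"
  using schouten_axioms[THEN conjunct2, THEN conjunct2, THEN conjunct1] of_fun_mvec by (metis add_0)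

lemma schouten_commute:
  "x \<in> mvec k \<Longrightarrow> y \<in> mvec l \<Longrightarrow> schouten x y = - amult ((-1) ^ ((k + 1) * (l + 1))) (schouten y x)"
  using schouten_axioms[THEN conjunct2, THEN conjunct2, THEN conjunct2, THEN conjunct1] by blast

lemma schouten_jacobi:
  "x \<in> mvec k \<Longrightarrow> y \<in> mvec l \<Longrightarrow> z \<in> mvec m \<Longrightarrow> schouten x (schouten y z) =
     schouten (schouten x y) z + amult ((-1) ^ ((k + 1) * (l + 1))) (schouten y (schouten x z))"
  using schouten_axioms[THEN conjunct2, THEN conjunct2, THEN conjunct2, THEN conjunct2, THEN conjunct1] by blast

lemma schouten_amult_vec:
  "schouten (amult a (vec X)) (amult b (vec Y)) = amult (a * b) (vec (br X Y))
     + amult (a * (\<theta> X * pderiv b)) (vec Y) - amult (b * (\<theta> Y * pderiv a)) (vec X)"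
  using schouten_axioms[THEN conjunct2, THEN conjunct2, THEN conjunct2, THEN conjunct2, THEN conjunct2, THEN conjunct1] by blast

lemma schouten_of_fun: "x \<in> mvec 1 \<Longrightarrow> schouten x (of_fun f) = of_fun (anchor x * pderiv f)"
  using schouten_axioms[THEN conjunct2, THEN conjunct2, THEN conjunct2, THEN conjunct2, THEN conjunct2, THEN conjunct2, THEN conjunct1]
  by blast

lemma schouten_wedge:
  "x \<in> mvec k \<Longrightarrow> y \<in> mvec l \<Longrightarrow> z \<in> mvec m \<Longrightarrow>
     schouten x (y \<and>\<^sub>A z) = schouten x y \<and>\<^sub>A z + amult ((-1) ^ ((k + 1) * l)) (y \<and>\<^sub>A schouten x z)"
  using schouten_axioms[THEN conjunct2, THEN conjunct2, THEN conjunct2, THEN conjunct2, THEN conjunct2, THEN conjunct2, THEN conjunct2]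
  by blast

lemma schouten_amult_right:
  assumes "x \<in> mvec k" "y \<in> mvec l"
  shows "schouten x (amult f y) = schouten x (of_fun f) \<and>\<^sub>A y + amult f (schouten x y)"
  using schouten_wedge[OF assms(1) of_fun_mvec assms(2), of f] by simp

lemma schouten_vec: "schouten (vec X) (vec Y) = vec (br X Y)"
  using schouten_amult_vec[of 1 X 1 Y] by simp

lemma schouten_of_fun_left: "x \<in> mvec 1 \<Longrightarrow> schouten (of_fun f) x = - of_fun (anchor x * pderiv f)"
  using schouten_commute[OF of_fun_mvec, of x 1 f] schouten_of_fun[of x f] by simp

lemma wedge_anti: "x \<in> mvec 1 \<Longrightarrow> y \<in> mvec 1 \<Longrightarrow> x \<and>\<^sub>A y = - (y \<and>\<^sub>A x)"
  using wedge_commute[OF mvec_parity mvec_parity, of x 1 y 1] by simp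

lemma wedge_self: assumes "x \<in> mvec 1" shows "x \<and>\<^sub>A x = 0"
proof (rule ext)
  fix \<alpha>s
  have "(x \<and>\<^sub>A x) \<alpha>s = - (x \<and>\<^sub>A x) \<alpha>s"
    using fun_cong[OF wedge_anti[OF assms assms], of \<alpha>s] by (simp add: fun_pointwise)
  then have "2 * (x \<and>\<^sub>A x) \<alpha>s = 0" by (metis add.right_inverse mult_2)
  then show "(x \<and>\<^sub>A x) \<alpha>s = 0 \<alpha>s" by (simp add: fun_pointwise)
qed

lemma wedge_mvec_2: "x \<in> mvec 1 \<Longrightarrow> y \<in> mvec 1 \<Longrightarrow> x \<and>\<^sub>A y \<in> mvec 2"
  using mvec_wedge[of x 1 y 1] by (simp add: numeral_2_eq_2)

text \<open>With the multivector in the second slot the Leibniz rule produces \<open>[f, g]\<close>,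
  a bracket of two functions, which vanishes.\<close>

lemma schouten_amult_left_of_fun:
  assumes "u \<in> mvec 2"
  shows "schouten (amult g u) (of_fun f) = amult g (schouten u (of_fun f))"
proof -
  have "schouten (amult g u) (of_fun f) = schouten (of_fun f) (amult g u)"
    using schouten_commute[OF mvec_closed(4)[OF assms] of_fun_mvec] by simp
  also have "\<dots> = amult g (schouten (of_fun f) u)"
    using schouten_amult_right[OF of_fun_mvec assms] by (simp add: schouten_of_fun_of_fun)
  also have "schouten (of_fun f) u = schouten u (of_fun f)"
    using schouten_commute[OF of_fun_mvec assms, of f] by simp
  finally show ?thesis .
qed

lemma schouten_wedge_of_fun:
  assumes "x \<in> mvec 1" "y \<in> mvec 1"
  shows "schouten (x \<and>\<^sub>A y) (of_fun f) = amult (pderiv f) (amult (anchor y) x - amult (anchor x) y)"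
proof -
  have "schouten (x \<and>\<^sub>A y) (of_fun f) = schouten (of_fun f) (x \<and>\<^sub>A y)"
    using schouten_commute[OF wedge_mvec_2[OF assms] of_fun_mvec] by simp
  also have "\<dots> = - of_fun (anchor x * pderiv f) \<and>\<^sub>A y - x \<and>\<^sub>A - of_fun (anchor y * pderiv f)"
    using schouten_wedge[OF of_fun_mvec assms, of f] assms by (simp add: schouten_of_fun_left)
  finally show ?thesis
    by (simp add: amult.scale_right_diff_distrib mult.commute)
qed

lemma mvec_1_induct [consumes 1, case_names zero add]:
  assumes "u \<in> mvec 1" "P 0" "\<And>f X v. v \<in> mvec 1 \<Longrightarrow> P v \<Longrightarrow> P (amult f (vec X) + v)"
  shows "P u"
  using assms(1)
proof (induction rule: mvec_induct)
  case zero
  show ?case by (rule assms(2))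
next
  case (add f Xs v)
  obtain X where "Xs = [X]" using add(1) by (auto simp: length_Suc_conv)
  then have "amult f (wedges (map vec Xs)) = amult f (vec X)" by simp
  then show ?case using assms(3)[OF add(2,3)] by (simp only:)
qed

lemma mvec_2_induct [consumes 1, case_names zero add]:
  assumes "u \<in> mvec 2" "P 0" "\<And>f X Y v. v \<in> mvec 2 \<Longrightarrow> P v \<Longrightarrow> P (amult f (vec X \<and>\<^sub>A vec Y) + v)"
  shows "P u"
  using assms(1)
proof (induction rule: mvec_induct)
  case zero
  show ?case by (rule assms(2))
next
  case (add f Xs v)
  obtain X Y where "Xs = [X, Y]" using add(1) by (auto simp: length_Suc_conv numeral_2_eq_2)
  then have "amult f (wedges (map vec Xs)) = amult f (vec X \<and>\<^sub>A vec Y)" by simp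
  then show ?case using assms(3)[OF add(2,3)] by (simp only:)
qed

lemma schouten_2_of_fun:
  assumes "u \<in> mvec 2"
  shows "schouten u (of_fun f) = amult (pderiv f) (schouten u (of_fun tvar))"
  using assms
proof (induction rule: mvec_2_induct)
  case zero
  have "schouten 0 (of_fun f) = amult (pderiv f) (schouten 0 (of_fun tvar))"
    by (simp add: schouten_zero[OF of_fun_mvec])
  then show ?case .
next
  case (add g X Y v)
  have w: "vec X \<and>\<^sub>A vec Y \<in> mvec 2" by (intro wedge_mvec_2 vec_mvec)
  have "schouten (amult g (vec X \<and>\<^sub>A vec Y) + v) (of_fun h) =
      amult g (amult (pderiv h) (amult (\<theta> Y) (vec X) - amult (\<theta> X) (vec Y))) + schouten v (of_fun h)" for h
    by (simp add: schouten_add(1)[OF mvec_closed(4)[OF w] add(1) of_fun_mvec] schouten_amult_left_of_fun[OF w]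
        schouten_wedge_of_fun[OF vec_mvec(2) vec_mvec(2)])
  note * = this
  show ?case unfolding * add(2) by (simp add: amult.scale_right_distrib mult.commute)
qed

lemma anchor_kernel_closed:
  "x \<in> anchor_kernel \<Longrightarrow> y \<in> anchor_kernel \<Longrightarrow> x + y \<in> anchor_kernel"
  "x \<in> anchor_kernel \<Longrightarrow> y \<in> anchor_kernel \<Longrightarrow> x - y \<in> anchor_kernel"
  "x \<in> anchor_kernel \<Longrightarrow> amult f x \<in> anchor_kernel" "0 \<in> anchor_kernel"
  by (auto simp: anchor_kernel_def mvec_closed)

lemma wedge_anchor_kernel_mvec: "u \<in> wedge_power anchor_kernel 2 \<Longrightarrow> u \<in> mvec 2 \<and> schouten u (of_fun f) = 0"
proof (induction rule: wedge_power_induct)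
  case zero
  show ?case using mvec_closed(5) schouten_zero(1)[OF of_fun_mvec] by blast
next
  case (add g us v)
  obtain x y where us: "us = [x, y]" using add(1) by (auto simp: length_Suc_conv numeral_2_eq_2)
  then have xy: "x \<in> mvec 1" "y \<in> mvec 1" "anchor x = 0" "anchor y = 0"
    using add(2) by (auto simp: anchor_kernel_def)
  have w: "wedges us = x \<and>\<^sub>A y" by (simp add: us)
  have m: "x \<and>\<^sub>A y \<in> mvec 2" using xy by (intro wedge_mvec_2)
  have v: "v \<in> mvec 2" "schouten v (of_fun f) = 0" using add(4) by auto
  have "schouten (amult g (x \<and>\<^sub>A y)) (of_fun f) = 0"
    by (simp add: schouten_amult_left_of_fun[OF m] schouten_wedge_of_fun[OF xy(1,2)] xy)
  then have "schouten (amult g (x \<and>\<^sub>A y) + v) (of_fun f) = 0"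
    by (simp add: schouten_add(1)[OF mvec_closed(4)[OF m] v(1) of_fun_mvec] v(2))
  moreover have "amult g (x \<and>\<^sub>A y) + v \<in> mvec 2" using m v by (intro mvec_closed)
  ultimately show ?case unfolding w by blast
qed

text \<open>If the anchor takes the value \<open>1\<close> at \<open>e\<close>, then \<open>E = L \<oplus> K[t] e\<close>, so \<open>\<And>\<^sup>2E = \<And>\<^sup>2L \<oplus> e \<and> L\<close>, and bracketing
  with \<open>t\<close> picks out the second summand.\<close>

lemma schouten_tvar_eq_0_iff:
  assumes e: "\<theta> e = 1" and u: "u \<in> mvec 2"
  shows "schouten u (of_fun tvar) = 0 \<longleftrightarrow> u \<in> wedge_power anchor_kernel 2"
proof
  have "\<exists>l\<in>anchor_kernel. u - vec e \<and>\<^sub>A l \<in> wedge_power anchor_kernel 2"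
    using u
  proof (induction rule: mvec_2_induct)
    case zero
    have "(0 :: ('k, 'g) multivector) - vec e \<and>\<^sub>A 0 \<in> wedge_power anchor_kernel 2"
      by (simp add: wedge_power_closed)
    then show ?case using anchor_kernel_closed(4) by blast
  next
    case (add f X Y v)
    obtain l where l: "l \<in> anchor_kernel" "v - vec e \<and>\<^sub>A l \<in> wedge_power anchor_kernel 2" using add by blast
    \<comment> \<open>Projection of \<open>vec X\<close> to L along \<open>vec e\<close>;
      substituting it for both factors splits the wedge into a part in
      \<open>\<And>\<^sup>2L\<close> and \<open>vec e\<close> wedge an element of L.\<close>
    define h where "h = (\<lambda>X. vec X - amult (\<theta> X) (vec e))"
    have h: "h X \<in> anchor_kernel" for X
      unfolding h_def anchor_kernel_def using e by (simp add: mvec_closed)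
    have vh: "vec X = h X + amult (\<theta> X) (vec e)" for X by (simp add: h_def)
    have ee: "vec e \<and>\<^sub>A vec e = 0" by (intro wedge_self vec_mvec)
    have he: "h X \<and>\<^sub>A vec e = - (vec e \<and>\<^sub>A h X)" for X
      using h[of X] by (intro wedge_anti vec_mvec) (auto simp: anchor_kernel_def)
    have "amult f (vec X \<and>\<^sub>A vec Y) + v -
        vec e \<and>\<^sub>A (amult f (amult (\<theta> X) (h Y) - amult (\<theta> Y) (h X)) + l) =
        amult f (wedges [h X, h Y]) + (v - vec e \<and>\<^sub>A l)"
      unfolding vh[of X] vh[of Y]
      by (simp add: wedge_distribs ee he amult.scale_right_distrib amult.scale_right_diff_distrib algebra_simps)
    moreover have "amult f (wedges [h X, h Y]) + (v - vec e \<and>\<^sub>A l) \<in> wedge_power anchor_kernel 2"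
      using h l(2) by (intro wedge_power_closed(1) wedge_powerI) auto
    moreover have "amult f (amult (\<theta> X) (h Y) - amult (\<theta> Y) (h X)) + l \<in> anchor_kernel"
      using h l(1) by (intro anchor_kernel_closed)
    ultimately show ?case by metis
  qed
  then obtain l where l: "l \<in> anchor_kernel" "u - vec e \<and>\<^sub>A l \<in> wedge_power anchor_kernel 2" by blast
  then have l1: "l \<in> mvec 1" "anchor l = 0" by (auto simp: anchor_kernel_def)
  have el: "vec e \<and>\<^sub>A l \<in> mvec 2" using l1 by (intro wedge_mvec_2 vec_mvec)
  assume "schouten u (of_fun tvar) = 0"
  then have "schouten (u - vec e \<and>\<^sub>A l) (of_fun tvar) = - schouten (vec e \<and>\<^sub>A l) (of_fun tvar)"
    using schouten_diff(1)[OF u el of_fun_mvec] by simp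
  \<comment> \<open>\<open>[e \<and> l, t]\<close> is \<open>- l\<close>, as \<open>e\<close> has
    anchor one and \<open>l\<close> anchor zero. The bracket at the start of the chain is zero
    because its first argument lies in \<open>\<And>\<^sup>2L\<close>.\<close>
  also have "\<dots> = l"
    by (simp add: schouten_wedge_of_fun[OF vec_mvec(2) l1(1)] l1(2) e)
  finally have "l = 0" using wedge_anchor_kernel_mvec[OF l(2)] by simp
  then show "u \<in> wedge_power anchor_kernel 2" using l(2) by simp
qed (use wedge_anchor_kernel_mvec in blast)

lemma independent_3I:
  assumes "distinct [x, y, z]" and "\<And>a b c. scale a x + scale b y + scale c z = 0 \<Longrightarrow> a = 0 \<and> b = 0 \<and> c = 0"
  shows "independent {x, y, z}"
proof (rule independent_if_scalars_zero)
  fix f w assume "(\<Sum>x\<in>{x, y, z}. scale (f x) x) = 0" "w \<in> {x, y, z}"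
  then show "f w = 0" using assms(1) assms(2)[of "f x" "f y" "f z"] by (auto simp: add.assoc)
qed simp

lemma wedge_3_determinant:
  fixes a1 a2 a3 b1 b2 b3 c1 c2 c3 :: "'k poly"
  assumes "h \<in> mvec 1" "e \<in> mvec 1" "f \<in> mvec 1"
  shows "(amult a1 h + amult a2 e + amult a3 f) \<and>\<^sub>A (amult b1 h + amult b2 e + amult b3 f) \<and>\<^sub>A
      (amult c1 h + amult c2 e + amult c3 f) =
    amult (a1 * (b2 * c3 - b3 * c2) - a2 * (b1 * c3 - b3 * c1) + a3 * (b1 * c2 - b2 * c1)) (h \<and>\<^sub>A e \<and>\<^sub>A f)"
proof -
  note self = wedge_self[OF assms(1)] wedge_self[OF assms(2)] wedge_self[OF assms(3)]
  note anti = wedge_anti[OF assms(2,1)] wedge_anti[OF assms(3,1)] wedge_anti[OF assms(3,2)]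
  have self3: "h \<and>\<^sub>A h \<and>\<^sub>A u = 0" "e \<and>\<^sub>A e \<and>\<^sub>A u = 0" "f \<and>\<^sub>A f \<and>\<^sub>A u = 0" for u
    unfolding wedge_assoc[symmetric] self by simp_all
  have anti3: "e \<and>\<^sub>A h \<and>\<^sub>A u = - (h \<and>\<^sub>A e \<and>\<^sub>A u)" "f \<and>\<^sub>A h \<and>\<^sub>A u = - (h \<and>\<^sub>A f \<and>\<^sub>A u)"
    "f \<and>\<^sub>A e \<and>\<^sub>A u = - (e \<and>\<^sub>A f \<and>\<^sub>A u)" for u
    unfolding wedge_assoc[symmetric] anti by simp_all
  show ?thesis
    by (simp add: wedge_distribs self self3 anti anti3 amult.scale_right_distrib)
      (simp add: fun_eq_iff amult_apply fun_pointwise algebra_simps)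
qed

end

lemma amult_const_minus: "amult [:- c:] u = - amult [:c:] u"
  by (simp flip: amult_minus_one(2))

context sl2_triple
begin

text \<open>Invariance of the Killing form makes the sharp map equivariant, so \<open>X\<close>
  sends the sharp of \<open>t\<close> to the sharp of \<open>\<theta> X\<close>, which is
  \<open>pderiv (\<theta> X)\<close> times \<open>vsharp\<close>. The proof checks this in
  coordinates.\<close>

lemma schouten_vec_vsharp: "schouten (vec X) vsharp = amult (pderiv (\<theta> X)) vsharp"
proof -
  have 1: "schouten (vec X) (amult b (vec Y)) = amult b (vec (br X Y)) + amult (\<theta> X * pderiv b) (vec Y)" for b Y
    using schouten_amult_vec[of 1 X b Y] by simp
  have m: "amult b (vec Y) \<in> mvec 1" for b Y by (intro mvec_closed vec_mvec)
  have "schouten (vec X) vsharp = schouten (vec X) (amult (2 * quarter * tvar) (vec H))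
      - schouten (vec X) (amult quarter (vec Ep)) - schouten (vec X) (amult (quarter * (tvar * tvar)) (vec Em))"
    unfolding vsharp_def schouten_diff(2)[OF mvec_closed(2)[OF m m] m vec_mvec(2)]
      schouten_diff(2)[OF m m vec_mvec(2)] ..
  moreover define C0 C1 C2 where "C0 = [:c0 X:]" and "C1 = [:c1 X:]" and "C2 = [:c2 X:]"
  note C = this
  have b: "vec (br X H) = amult (- C2) (vec Ep) + amult C0 (vec Em)"
    "vec (br X Ep) = amult (2 * C0) (vec H) + amult C1 (vec Ep)"
    "vec (br X Em) = amult (- 2 * C2) (vec H) - amult C1 (vec Em)"
    by (simp_all add: br_triple vec_add vec_diff vec_minus vec_scale amult_const_minus C numeral_poly mult.commute)
  have "pderiv (2 * quarter * tvar) = 2 * (quarter :: 'k poly)"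
    "pderiv (quarter * (tvar * tvar)) = quarter * (2 * tvar :: 'k poly)"
    by (simp_all add: pderiv_mult algebra_simps)
  ultimately have "schouten (vec X) vsharp =
      amult (2 * quarter * tvar) (amult (- C2) (vec Ep) + amult C0 (vec Em)) +
      amult ((C0 + C1 * tvar + C2 * (tvar * tvar)) * (2 * quarter)) (vec H) -
      amult quarter (amult (2 * C0) (vec H) + amult C1 (vec Ep)) -
      (amult (quarter * (tvar * tvar)) (amult (- 2 * C2) (vec H) - amult C1 (vec Em)) +
       amult ((C0 + C1 * tvar + C2 * (tvar * tvar)) * (quarter * (2 * tvar))) (vec Em))"
    by (simp only: 1 b action_expand[of X] C[symmetric] pderiv_quarter mult_zero_right amult.scale_zero_left add_0_right)
  also have "\<dots> = amult (C1 + 2 * C2 * tvar) vsharp"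
    unfolding vsharp_def by (rule ext) (simp add: amult_apply fun_pointwise algebra_simps)
  finally show ?thesis by (simp only: pderiv_action C)
qed

end

text \<open>The equations say that \<open>p\<close> is an eigenvector of \<open>ad h\<close> in \<open>\<ss>\<ll>(2)\<close> with eigenvalue \<open>1\<close>; the factor
  comes from \<open>(ad h)\<^sup>3 = (h1\<^sup>2 - 4 h0 h2) ad h\<close>.\<close>

lemma eigenvector_discriminant:
  fixes h0 h1 h2 p0 p1 p2 :: "'a :: comm_ring_1"
  assumes "p0 = h0 * p1 - h1 * p0" "p1 = 2 * (h0 * p2 - h2 * p0)" "p2 = h1 * p2 - h2 * p1"
  shows "(h1 * h1 - 4 * h0 * h2 - 1) * p0 = 0" "(h1 * h1 - 4 * h0 * h2 - 1) * p1 = 0"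
    "(h1 * h1 - 4 * h0 * h2 - 1) * p2 = 0"
proof -
  \<comment> \<open>The three defects of the equations, i.e. \<open>ad h - 1\<close> applied to
    \<open>p\<close>. The factor is the determinant of \<open>ad h - 1\<close>, and the coefficients
    used below are the rows of its adjugate.\<close>
  define a where "a = h0 * p1 - h1 * p0 - p0"
  define b where "b = 2 * (h0 * p2 - h2 * p0) - p1"
  define c where "c = h1 * p2 - h2 * p1 - p2"
  have zero: "a = 0" "b = 0" "c = 0"
    unfolding a_def b_def c_def assms[symmetric] by simp_all
  have "(h1 * h1 - 4 * h0 * h2 - 1) * p0 = (1 - h1 + 2 * h0 * h2) * a - h0 * (h1 - 1) * b + 2 * h0 * h0 * c"
    unfolding a_def b_def c_def by (simp add: algebra_simps)
  then show "(h1 * h1 - 4 * h0 * h2 - 1) * p0 = 0" by (simp add: zero)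
  have "(h1 * h1 - 4 * h0 * h2 - 1) * p1 = 2 * h0 * (h1 + 1) * c - 2 * h2 * (1 - h1) * a + b - h1 * h1 * b"
    unfolding a_def b_def c_def by (simp add: algebra_simps)
  then show "(h1 * h1 - 4 * h0 * h2 - 1) * p1 = 0" by (simp add: zero)
  have "(h1 * h1 - 4 * h0 * h2 - 1) * p2 = (1 + h1 + 2 * h0 * h2) * c - h2 * (h1 + 1) * b + 2 * h2 * h2 * a"
    unfolding a_def b_def c_def by (simp add: algebra_simps)
  then show "(h1 * h1 - 4 * h0 * h2 - 1) * p2 = 0" by (simp add: zero)
qed

section \<open>The cocycle property\<close>

context sl2_triple
begin

text \<open>The \<open>K[t]\<close>-linear extension of
  \<open>X \<mapsto> pderiv (\<theta> X)\<close>: the derivatives of the coefficients cancel in the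
  difference.\<close>

definition anchor_defect :: "('k, 'g) multivector \<Rightarrow> 'k poly" where
  "anchor_defect x = pderiv (anchor x) - anchor (coeff_deriv x)"

lemma anchor_defect_simps [simp]:
  "anchor_defect (x + y) = anchor_defect x + anchor_defect y" "anchor_defect 0 = 0"
  "anchor_defect (amult f (vec X)) = f * pderiv (\<theta> X)"
  by (simp_all add: anchor_defect_def pderiv_add pderiv_mult)

text \<open>Since \<open>vsharp\<close> has anchor zero,
  \<open>[vsharp, f X] = f [vsharp, X]\<close>, so the formula for Lie algebra elements extends
  linearly.\<close>

lemma schouten_vsharp: "x \<in> mvec 1 \<Longrightarrow> schouten x vsharp = amult (anchor_defect x) vsharp"
proof (induction rule: mvec_1_induct)
  case zero
  have "schouten 0 vsharp = amult (anchor_defect 0) vsharp"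
    by (simp add: schouten_zero[OF vsharp_mvec(1)])
  then show ?case .
next
  case (add f X v)
  have m: "amult f (vec X) \<in> mvec 1" by (intro mvec_closed vec_mvec)
  have c: "schouten x vsharp = - schouten vsharp x" if "x \<in> mvec 1" for x
    using schouten_commute[OF that vsharp_mvec(1)] by simp
  have "schouten vsharp (amult f (vec X)) = amult f (schouten vsharp (vec X))"
    using schouten_amult_right[OF vsharp_mvec(1) vec_mvec(2), of f X] schouten_of_fun[OF vsharp_mvec(1), of f]
    by simp
  then have "schouten (amult f (vec X)) vsharp = amult f (schouten (vec X) vsharp)"
    using c[OF m] c[OF vec_mvec(2), of X] by simp
  then show ?case
    unfolding schouten_add(1)[OF m add(1) vsharp_mvec(1)] add(2)
    by (simp add: schouten_vec_vsharp amult.scale_left_distrib)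
qed

text \<open>d/dt is not a derivation of the bracket because the coefficients
  \<open>\<theta> X\<close> are differentiated too, which produces the defect terms. Both sides are
  biadditive, so elements \<open>a X\<close> and \<open>b Y\<close> suffice.\<close>

lemma coeff_deriv_schouten:
  assumes "x \<in> mvec 1" "y \<in> mvec 1"
  shows "coeff_deriv (schouten x y) = schouten x (coeff_deriv y) - schouten y (coeff_deriv x)
    + amult (anchor_defect x) (coeff_deriv y) - amult (anchor_defect y) (coeff_deriv x)"
  using assms
proof (induction arbitrary: y rule: mvec_1_induct)
  case zero
  have "coeff_deriv (schouten 0 y) = schouten 0 (coeff_deriv y) - schouten y (coeff_deriv 0)
    + amult (anchor_defect 0) (coeff_deriv y) - amult (anchor_defect y) (coeff_deriv 0)"
    using schouten_zero[OF zero] schouten_zero[OF mvec_coeff_deriv[OF zero]] by simp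
  then show ?case .
next
  case (add f X u)
  let ?x = "amult f (vec X)"
  have m: "amult b (vec Y) \<in> mvec 1" for b Y by (intro mvec_closed vec_mvec)
  have "coeff_deriv (schouten ?x y) = schouten ?x (coeff_deriv y) - schouten y (coeff_deriv ?x)
    + amult (anchor_defect ?x) (coeff_deriv y) - amult (anchor_defect y) (coeff_deriv ?x)"
    using add(3)
  proof (induction rule: mvec_1_induct)
    case zero
    have "coeff_deriv (schouten ?x 0) = schouten ?x (coeff_deriv 0) - schouten 0 (coeff_deriv ?x)
      + amult (anchor_defect ?x) (coeff_deriv 0) - amult (anchor_defect 0) (coeff_deriv ?x)"
      unfolding schouten_zero[OF m] schouten_zero[OF mvec_coeff_deriv[OF m]] coeff_deriv_linear
        schouten_zero[OF m] by (simp add: schouten_zero(1)[OF m])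
    then show ?case .
  next
    case (add g Y v)
    let ?y = "amult g (vec Y)"
    have "coeff_deriv (schouten ?x ?y) = schouten ?x (amult (pderiv g) (vec Y)) - schouten ?y (amult (pderiv f) (vec X))
      + amult (anchor_defect ?x) (amult (pderiv g) (vec Y)) - amult (anchor_defect ?y) (amult (pderiv f) (vec X))"
      unfolding schouten_amult_vec br_anti[of Y X]
      by (rule ext) (simp add: vec_minus amult_apply fun_pointwise pderiv_mult algebra_simps)
    moreover have "coeff_deriv ?x = amult (pderiv f) (vec X)" "coeff_deriv ?y = amult (pderiv g) (vec Y)"
      by simp_all
    ultimately have base: "coeff_deriv (schouten ?x ?y) = schouten ?x (coeff_deriv ?y) - schouten ?y (coeff_deriv ?x)
      + amult (anchor_defect ?x) (coeff_deriv ?y) - amult (anchor_defect ?y) (coeff_deriv ?x)"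
      by (simp only:)
    note S = schouten_add(2)[OF m[of g Y] add(1) m[of f X]]
      schouten_add(2)[OF mvec_coeff_deriv[OF m[of g Y]] mvec_coeff_deriv[OF add(1)] m[of f X]]
      schouten_add(1)[OF m[of g Y] add(1) mvec_coeff_deriv[OF m[of f X]]]
    have "coeff_deriv (schouten ?x (?y + v)) = schouten ?x (coeff_deriv (?y + v)) - schouten (?y + v) (coeff_deriv ?x)
      + amult (anchor_defect ?x) (coeff_deriv (?y + v)) - amult (anchor_defect (?y + v)) (coeff_deriv ?x)"
      unfolding S coeff_deriv_linear(1) base add(2) anchor_defect_simps(1)
      by (simp only: amult.scale_left_distrib amult.scale_right_distrib) (simp add: algebra_simps del: coeff_deriv_linear)
    then show ?case .
  qed
  note base = this
  note S = schouten_add(1)[OF m[of f X] add(1) add(3)]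
    schouten_add(1)[OF m[of f X] add(1) mvec_coeff_deriv[OF add(3)]]
    schouten_add(2)[OF mvec_coeff_deriv[OF m[of f X]] mvec_coeff_deriv[OF add(1)] add(3)]
  have "coeff_deriv (schouten (?x + u) y) = schouten (?x + u) (coeff_deriv y) - schouten y (coeff_deriv (?x + u))
    + amult (anchor_defect (?x + u)) (coeff_deriv y) - amult (anchor_defect y) (coeff_deriv (?x + u))"
    unfolding S coeff_deriv_linear(1) base add(2)[OF add(3)] anchor_defect_simps(1)
    by (simp only: amult.scale_left_distrib amult.scale_right_distrib) (simp add: algebra_simps del: coeff_deriv_linear)
  then show ?case .
qed

text \<open>\<open>D_op x\<close> is \<open>vsharp\<close> wedge the coefficient derivative of
  \<open>x\<close>, and the factors from \<open>schouten_vsharp\<close> match the defect terms of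
  \<open>coeff_deriv_schouten\<close>.\<close>

lemma D_op_cocycle:
  assumes x: "x \<in> mvec 1" and y: "y \<in> mvec 1"
  shows "D_op (schouten x y) = schouten x (D_op y) - schouten y (D_op x)"
proof -
  have m: "schouten x y \<in> mvec 1" using schouten_mvec[OF x y] by simp
  have 1: "schouten x (vsharp \<and>\<^sub>A coeff_deriv y) =
      amult (anchor_defect x) (vsharp \<and>\<^sub>A coeff_deriv y) + vsharp \<and>\<^sub>A schouten x (coeff_deriv y)"
    if "x \<in> mvec 1" "y \<in> mvec 1" for x y
    using schouten_wedge[OF that(1) vsharp_mvec(1) mvec_coeff_deriv[OF that(2)]] schouten_vsharp[OF that(1)]
    by simp
  show ?thesis
    unfolding D_op_eq[OF m] D_op_eq[OF x] D_op_eq[OF y] 1[OF x y] 1[OF y x] coeff_deriv_schouten[OF x y]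
    by (simp add: wedge_distribs)
qed

lemma D_op_tvar: "D_op (of_fun tvar) = vsharp"
  using D_op_eq[OF of_fun_mvec, of tvar] by simp

lemma D_op_mvec: assumes "x \<in> mvec 1" shows "D_op x \<in> mvec 2"
  unfolding D_op_eq[OF assms] by (intro wedge_mvec_2 vsharp_mvec mvec_coeff_deriv assms)

lemma schouten_mvec_2_1: "\<tau> \<in> mvec 2 \<Longrightarrow> x \<in> mvec 1 \<Longrightarrow> schouten \<tau> x \<in> mvec 2"
  using schouten_mvec[of \<tau> 2 x 1] by simp

text \<open>Both terms have the same bracket with \<open>t\<close>, namely
  \<open>anchor (coeff_deriv x)\<close> times \<open>vsharp\<close>. For the second one, the Jacobi
  identity gives \<open>[\<tau>, anchor x] - [x, vsharp]\<close>, and the derivative of the anchor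
  cancels.\<close>

lemma cocycle_values:
  assumes \<tau>: "\<tau> \<in> mvec 2" "schouten \<tau> (of_fun tvar) = vsharp" and x: "x \<in> mvec 1"
  shows "D_op x - schouten \<tau> x \<in> wedge_power anchor_kernel 2"
proof -
  let ?t = "of_fun tvar"
  have m: "D_op x - schouten \<tau> x \<in> mvec 2"
    by (intro mvec_closed D_op_mvec schouten_mvec_2_1 \<tau> x)
  have "schouten (D_op x) ?t = amult (anchor (coeff_deriv x)) vsharp"
    unfolding D_op_eq[OF x] by (simp add: schouten_wedge_of_fun[OF vsharp_mvec(1) mvec_coeff_deriv[OF x]])
  moreover have "schouten (schouten \<tau> x) ?t = amult (anchor (coeff_deriv x)) vsharp"
  proof -
    have "schouten \<tau> (schouten x ?t) = amult (pderiv (anchor x)) vsharp"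
      unfolding schouten_of_fun[OF x] schouten_2_of_fun[OF \<tau>(1), of "anchor x * _"] \<tau>(2) by simp
    moreover have "schouten \<tau> (schouten x ?t) = schouten (schouten \<tau> x) ?t + schouten x (schouten \<tau> ?t)"
      using schouten_jacobi[OF \<tau>(1) x of_fun_mvec, of tvar] by simp
    ultimately show ?thesis
      unfolding \<tau>(2) schouten_vsharp[OF x] anchor_defect_def
      by (simp add: amult.scale_left_diff_distrib algebra_simps)
  qed
  ultimately have "schouten (D_op x - schouten \<tau> x) ?t = 0"
    using schouten_diff(1)[OF D_op_mvec[OF x] schouten_mvec_2_1[OF \<tau>(1) x] of_fun_mvec] by simp
  then show ?thesis
    using schouten_tvar_eq_0_iff[OF _ m, of Em] by (simp add: action_triple)
qed

text \<open>\<open>D_op\<close> satisfies the cocycle identity, and so does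
  \<open>[\<tau>, _]\<close>, by Jacobi. Neither is linear over \<open>K[t]\<close>, but on
  \<open>f x\<close> both produce the extra term \<open>pderiv f\<close> times
  \<open>vsharp \<and> x\<close>, by the choice of \<tau>.\<close>

lemma is_cocycle_D_minus_bracket:
  assumes \<tau>: "\<tau> \<in> mvec 2" "schouten \<tau> (of_fun tvar) = vsharp"
  shows "is_cocycle (\<lambda>x. D_op x - schouten \<tau> x)"
  unfolding is_cocycle_def
proof (intro conjI ballI allI)
  fix x assume x: "x \<in> mvec 1"
  show "D_op x - schouten \<tau> x \<in> wedge_power anchor_kernel 2"
    by (rule cocycle_values[OF \<tau> x])
  fix y assume y: "y \<in> mvec 1"
  show "D_op (x + y) - schouten \<tau> (x + y) = (D_op x - schouten \<tau> x) + (D_op y - schouten \<tau> y)"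
    unfolding schouten_add(2)[OF x y \<tau>(1)] D_op_eq[OF x] D_op_eq[OF y] D_op_eq[OF mvec_closed(1)[OF x y]]
    by (simp add: wedge_distribs)
  have m: "schouten x y \<in> mvec 1" using schouten_mvec[OF x y] by simp
  have "schouten \<tau> (schouten x y) = schouten (schouten \<tau> x) y + schouten x (schouten \<tau> y)"
    using schouten_jacobi[OF \<tau>(1) x y] by simp
  moreover have "schouten (schouten \<tau> x) y = - schouten y (schouten \<tau> x)"
    using schouten_commute[OF schouten_mvec_2_1[OF \<tau>(1) x] y] by simp
  ultimately show "D_op (schouten x y) - schouten \<tau> (schouten x y) =
      schouten x (D_op y - schouten \<tau> y) - schouten y (D_op x - schouten \<tau> x)"
    unfolding D_op_cocycle[OF x y]
      schouten_diff(2)[OF D_op_mvec[OF y] schouten_mvec_2_1[OF \<tau>(1) y] x]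
      schouten_diff(2)[OF D_op_mvec[OF x] schouten_mvec_2_1[OF \<tau>(1) x] y]
    by simp
next
  fix f x assume x: "x \<in> mvec 1"
  show "D_op (amult f x) - schouten \<tau> (amult f x) = amult f (D_op x - schouten \<tau> x)"
    unfolding schouten_amult_right[OF \<tau>(1) x] D_op_eq[OF x] D_op_eq[OF mvec_closed(4)[OF x]]
      schouten_2_of_fun[OF \<tau>(1), of f] \<tau>(2)
    by (simp add: wedge_distribs amult.scale_right_diff_distrib)
qed

lemma bracket_solution_unique:
  assumes "\<tau> \<in> mvec 2" "schouten \<tau> (of_fun tvar) = vsharp" "\<tau>' \<in> mvec 2"
  shows "vsharp = schouten \<tau>' (of_fun tvar) \<longleftrightarrow> \<tau>' - \<tau> \<in> wedge_power anchor_kernel 2"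
  using schouten_tvar_eq_0_iff[OF _ mvec_closed(2)[OF assms(3,1)], of Em]
    schouten_diff(1)[OF assms(3,1) of_fun_mvec, of tvar] assms(2)
  by (auto simp: action_triple)

section \<open>Independence of the volume element from the basis\<close>

lemma is_sl2_basis_triple: "is_sl2_basis H Ep Em"
proof -
  have "H \<noteq> Ep" "H \<noteq> Em" "Ep \<noteq> Em" using c_triple by (metis zero_neq_one)+
  then have d: "distinct [H, Ep, Em]" by simp
  moreover have "independent {H, Ep, Em}"
  proof (rule independent_3I[OF d])
    fix a b c assume "scale a H + scale b Ep + scale c Em = 0"
    then have "c1 (scale a H + scale b Ep + scale c Em) = 0" "c2 (scale a H + scale b Ep + scale c Em) = 0"
      "c0 (scale a H + scale b Ep + scale c Em) = 0" by simp_all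
    then show "a = 0 \<and> b = 0 \<and> c = 0" by simp
  qed
  moreover have "span {H, Ep, Em} = sl2_ideal"
  proof
    show "span {H, Ep, Em} \<subseteq> sl2_ideal"
      using triple_in by (intro span_minimal sl2_subspace) auto
    show "sl2_ideal \<subseteq> span {H, Ep, Em}"
    proof
      fix x assume "x \<in> sl2_ideal"
      then show "x \<in> span {H, Ep, Em}"
        by (subst sl2_expand, assumption) (intro span_add span_scale span_base; simp)
    qed
  qed
  ultimately show ?thesis
    unfolding is_sl2_basis_def by (simp add: br_triple)
qed

text \<open>\<open>[Ep', Em'] = -2 H'\<close> expresses the 2 by 2 minors of the last two vectors
  through \<open>H'\<close>, so the determinant of the change of basis is the discriminant
  \<open>\<delta>\<close> of \<open>H'\<close>. The eigenvector \<open>Ep'\<close> is nonzero, which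
  forces \<open>\<delta> = 1\<close>.\<close>

lemma sl2_basis_volume:
  assumes "is_sl2_basis H' Ep' Em'"
  shows "vec H' \<and>\<^sub>A vec Ep' \<and>\<^sub>A vec Em' = vec H \<and>\<^sub>A vec Ep \<and>\<^sub>A vec Em"
proof -
  have ind: "independent {H', Ep', Em'}" and sp: "span {H', Ep', Em'} = sl2_ideal"
    and b: "br H' Ep' = Ep'" "br Ep' Em' = scale (-2) H'"
    using assms by (auto simp: is_sl2_basis_def)
  have "H' \<in> span {H', Ep', Em'}" "Ep' \<in> span {H', Ep', Em'}" "Em' \<in> span {H', Ep', Em'}"
    by (auto intro: span_base)
  then have s: "H' \<in> sl2_ideal" "Ep' \<in> sl2_ideal" "Em' \<in> sl2_ideal"
    unfolding sp .
  have "Ep' \<noteq> 0" using ind dependent_zero by force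
  then have nz: "c0 Ep' \<noteq> 0 \<or> c1 Ep' \<noteq> 0 \<or> c2 Ep' \<noteq> 0"
    using sl2_eqI[OF s(2) subspace_0[OF sl2_subspace]] by auto
  have e: "c0 Ep' = c0 H' * c1 Ep' - c1 H' * c0 Ep'" "c1 Ep' = 2 * (c0 H' * c2 Ep' - c2 H' * c0 Ep')"
    "c2 Ep' = c1 H' * c2 Ep' - c2 H' * c1 Ep'"
    using c_br[of H' Ep'] unfolding b by simp_all
  have f: "- 2 * c0 H' = c0 Ep' * c1 Em' - c1 Ep' * c0 Em'"
    "- 2 * c1 H' = 2 * (c0 Ep' * c2 Em' - c2 Ep' * c0 Em')"
    "- 2 * c2 H' = c1 Ep' * c2 Em' - c2 Ep' * c1 Em'"
    using c_br[of Ep' Em'] unfolding b by simp_all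
  define \<delta> where "\<delta> = c1 H' * c1 H' - 4 * c0 H' * c2 H'"
  have "(\<delta> - 1) * c0 Ep' = 0" "(\<delta> - 1) * c1 Ep' = 0" "(\<delta> - 1) * c2 Ep' = 0"
    unfolding \<delta>_def by (rule eigenvector_discriminant[OF e])+
  with nz have \<delta>: "\<delta> = 1" by auto
  \<comment> \<open>Expansion along the first row, with the coordinates in the order
    \<open>c1\<close>, \<open>c2\<close>, \<open>c0\<close> of \<open>H\<close>, \<open>Ep\<close>,
    \<open>Em\<close>; \<open>f\<close> evaluates the minors.\<close>
  have det: "c1 H' * (c2 Ep' * c0 Em' - c0 Ep' * c2 Em') - c2 H' * (c1 Ep' * c0 Em' - c0 Ep' * c1 Em')
      + c0 H' * (c1 Ep' * c2 Em' - c2 Ep' * c1 Em') = 1"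
  proof -
    have "c2 Ep' * c0 Em' - c0 Ep' * c2 Em' = c1 H'"
    proof -
      have "2 * (c2 Ep' * c0 Em' - c0 Ep' * c2 Em') = 2 * c1 H'" using f(2) by (simp add: algebra_simps)
      then show ?thesis by (simp only: mult_cancel_left) simp
    qed
    moreover have "c1 Ep' * c0 Em' - c0 Ep' * c1 Em' = 2 * c0 H'" using f(1) by (simp add: algebra_simps)
    ultimately show ?thesis using f(3) \<delta> by (simp add: \<delta>_def algebra_simps)
  qed
  have ex: "vec x = amult [:c1 x:] (vec H) + amult [:c2 x:] (vec Ep) + amult [:c0 x:] (vec Em)"
    if "x \<in> sl2_ideal" for x
    using arg_cong[OF sl2_expand[OF that], of vec] by (simp only: vec_add vec_scale)
  have "vec H' \<and>\<^sub>A vec Ep' \<and>\<^sub>A vec Em' =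
      amult ([:c1 H':] * ([:c2 Ep':] * [:c0 Em':] - [:c0 Ep':] * [:c2 Em':])
        - [:c2 H':] * ([:c1 Ep':] * [:c0 Em':] - [:c0 Ep':] * [:c1 Em':])
        + [:c0 H':] * ([:c1 Ep':] * [:c2 Em':] - [:c2 Ep':] * [:c1 Em':]))
      (vec H \<and>\<^sub>A vec Ep \<and>\<^sub>A vec Em)"
    by (subst ex[OF s(1)], subst ex[OF s(2)], subst ex[OF s(3)]) (rule wedge_3_determinant, rule vec_mvec, rule vec_mvec, rule vec_mvec)
  also have "[:c1 H':] * ([:c2 Ep':] * [:c0 Em':] - [:c0 Ep':] * [:c2 Em':])
        - [:c2 H':] * ([:c1 Ep':] * [:c0 Em':] - [:c0 Ep':] * [:c1 Em':])
        + [:c0 H':] * ([:c1 Ep':] * [:c2 Em':] - [:c2 Ep':] * [:c1 Em':]) = [:1:]"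
    using det by (simp add: mult.commute)
  finally show ?thesis by (simp flip: one_pCons)
qed

lemma Omega_sl2_eq: "Omega_sl2 = amult 4 (vec H \<and>\<^sub>A vec Ep \<and>\<^sub>A vec Em)"
  unfolding Omega_sl2_def
proof (rule the_equality)
  show "\<exists>H' Ep' Em'. is_sl2_basis H' Ep' Em' \<and>
      amult 4 (vec H \<and>\<^sub>A vec Ep \<and>\<^sub>A vec Em) = amult 4 (vec H' \<and>\<^sub>A vec Ep' \<and>\<^sub>A vec Em')"
    using is_sl2_basis_triple by blast
qed (use sl2_basis_volume in metis)

section \<open>The explicit dynamical r-matrix\<close>

definition \<tau>0 :: "('k, 'g) multivector" where
  "\<tau>0 = (amult (2 * quarter * tvar) (vec H) - amult quarter (vec Ep)) \<and>\<^sub>A vec Em"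

lemma \<tau>0_sl2: "\<tau>0 \<in> wedge_power (vec ` sl2_ideal) 2"
proof -
  have "\<tau>0 = amult (2 * quarter * tvar) (wedges [vec H, vec Em]) - amult quarter (wedges [vec Ep, vec Em])"
    by (simp add: \<tau>0_def wedge_distribs)
  also have "\<dots> \<in> wedge_power (vec ` sl2_ideal) 2"
    using triple_in by (intro wedge_power_closed(2) wedge_powerI) auto
  finally show ?thesis .
qed

lemma \<tau>0_mvec: "\<tau>0 \<in> mvec 2"
  using wedge_power_mono[of "vec ` sl2_ideal" "range vec" 2] \<tau>0_sl2 by (auto simp: mvec_def)

lemma schouten_\<tau>0_tvar: "schouten \<tau>0 (of_fun tvar) = vsharp"
proof -
  have "amult (2 * quarter * tvar) (vec H) - amult quarter (vec Ep) \<in> mvec 1"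
    by (intro mvec_closed vec_mvec)
  then have "schouten \<tau>0 (of_fun tvar) = amult (pderiv tvar) (amult (anchor (vec Em)) (amult (2 * quarter * tvar) (vec H) - amult quarter (vec Ep))
      - amult (anchor (amult (2 * quarter * tvar) (vec H) - amult quarter (vec Ep))) (vec Em))"
    unfolding \<tau>0_def by (intro schouten_wedge_of_fun vec_mvec)
  also have "\<dots> = vsharp"
    unfolding vsharp_def
    by (rule ext) (simp add: action_triple amult_apply fun_pointwise algebra_simps)
  finally show ?thesis .
qed

text \<open>In \<open>\<tau>0 = w \<and> e\<close> the terms along \<open>H\<close> in
  \<open>[w, e]\<close> cancel and leave a multiple of \<open>e\<close>. Hence
  \<open>[e, \<tau>0] = 0\<close>, while both terms of \<open>[w, \<tau>0]\<close> end in
  \<open>e\<close> and die when wedged with \<open>e\<close>.\<close>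

lemma schouten_\<tau>0_\<tau>0: "schouten \<tau>0 \<tau>0 = 0"
proof -
  define w where "w = amult (2 * quarter * tvar) (vec H) - amult quarter (vec Ep)"
  let ?e = "vec Em"
  have m: "amult b (vec Y) \<in> mvec 1" for b Y by (intro mvec_closed vec_mvec)
  have w: "w \<in> mvec 1" unfolding w_def by (intro mvec_closed m)
  have e: "?e \<in> mvec 1" by (rule vec_mvec)
  have \<tau>: "\<tau>0 = w \<and>\<^sub>A ?e" by (simp add: \<tau>0_def w_def)
  have ee: "?e \<and>\<^sub>A ?e = 0" by (rule wedge_self[OF e])
  have 1: "schouten (amult b (vec Y)) ?e = amult b (vec (br Y Em)) - amult (pderiv b) (vec Y)" for b Y
    using schouten_amult_vec[of b Y 1 Em] by (simp add: action_triple)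
  have brs: "vec (br H Em) = - ?e" "vec (br Ep Em) = amult (- 2) (vec H)"
    by (simp_all add: br_triple vec_minus vec_scale amult_const_minus numeral_poly)
  have we: "schouten w ?e = amult (- 2 * quarter * tvar) ?e"
    unfolding w_def schouten_diff(1)[OF m m e] 1 brs
    by (rule ext) (simp add: amult_apply fun_pointwise pderiv_mult algebra_simps)
  have ew: "schouten ?e w = amult (2 * quarter * tvar) ?e"
    using schouten_commute[OF e w] we by simp
  have "schouten ?e \<tau>0 = 0"
    unfolding \<tau> using schouten_wedge[OF e w e] ew by (simp add: ee schouten_vec br_self)
  then have \<tau>e: "schouten \<tau>0 ?e = 0"
    using schouten_commute[OF \<tau>0_mvec e] by simp
  have "schouten w \<tau>0 = schouten w w \<and>\<^sub>A ?e + amult (- 2 * quarter * tvar) (w \<and>\<^sub>A ?e)"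
    unfolding \<tau> using schouten_wedge[OF w w e] we by simp
  then have "schouten w \<tau>0 \<and>\<^sub>A ?e = 0"
    by (simp add: wedge_distribs wedge_assoc ee)
  then have \<tau>w: "schouten \<tau>0 w \<and>\<^sub>A ?e = 0"
    using schouten_commute[OF \<tau>0_mvec w] by simp
  show ?thesis
    using schouten_wedge[OF \<tau>0_mvec w e] \<tau>e \<tau>w by (simp flip: \<tau>)
qed

text \<open>The coefficient derivative of \<open>\<tau>0\<close> is 1/2 H \<and> Em, so only the
  term -1/4 Ep of \<open>vsharp\<close> survives; exchanging it with \<open>H\<close> changes the
  sign and gives 1/8.\<close>

lemma D_op_\<tau>0: "D_op \<tau>0 = amult (2 * quarter * quarter) (vec H \<and>\<^sub>A vec Ep \<and>\<^sub>A vec Em)"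
proof -
  have self: "vec X \<and>\<^sub>A vec X = 0" "vec X \<and>\<^sub>A vec X \<and>\<^sub>A u = 0" for X u
    unfolding wedge_assoc[symmetric] by (simp_all add: wedge_self vec_mvec)
  have anti: "vec Em \<and>\<^sub>A vec H \<and>\<^sub>A vec Em = 0" "vec Ep \<and>\<^sub>A vec H \<and>\<^sub>A vec Em = - (vec H \<and>\<^sub>A vec Ep \<and>\<^sub>A vec Em)"
    unfolding wedge_assoc[symmetric] wedge_anti[OF vec_mvec(2) vec_mvec(2), of Em H]
      wedge_anti[OF vec_mvec(2) vec_mvec(2), of Ep H]
    by (simp_all add: wedge_assoc self)
  have "coeff_deriv \<tau>0 = amult (2 * quarter) (vec H \<and>\<^sub>A vec Em)"
    by (simp add: \<tau>0_def coeff_deriv_wedge pderiv_mult)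
  then show ?thesis
    unfolding D_op_eq[OF \<tau>0_mvec] vsharp_def
    by (simp add: wedge_distribs self anti mult_ac)
qed

text \<open>The Casimir element is zero: -1/8 from \<open>D_op\<close> cancels 4/32 from
  \<open>Omega_sl2\<close>, and the self-bracket vanishes.\<close>

lemma \<tau>0_dynamical: "dynamical_r_matrix (-1) \<tau>0"
proof -
  have zero: "casimir 0"
    unfolding casimir_def wedge_power_const_def
  proof (intro conjI ballI)
    have "Modules.module (\<lambda>c :: 'k. amult [:c:] :: ('k, 'g) multivector \<Rightarrow> _)"
      by unfold_locales (auto simp: amult_def fun_eq_iff fun_pointwise algebra_simps simp flip: one_pCons)
    then show "0 \<in> Modules.module.span (\<lambda>c. amult [:c:]) {wedges us |us. length us = 3 \<and> set us \<subseteq> vec ` kernel}"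
      by (rule Modules.module.span_zero)
  qed (rule schouten_zero(2)[OF vec_mvec(2)])
  have "[:(-1)\<^sup>2 / 32:] * 4 = (2 * quarter * quarter :: 'k poly)"
    by (simp add: quarter_def numeral_poly)
  moreover have "[:-1:] = (-1 :: 'k poly)" by (simp add: one_pCons)
  ultimately have "amult [:1 / 2:] (schouten \<tau>0 \<tau>0) + amult [:-1:] (D_op \<tau>0) + amult [:(-1)\<^sup>2 / 32:] Omega_sl2 = 0"
    unfolding schouten_\<tau>0_\<tau>0 D_op_\<tau>0 Omega_sl2_eq amult.scale_scale by simp
  then show ?thesis
    unfolding dynamical_r_matrix_def using zero \<tau>0_mvec by blast
qed

end

theorem proposition4p10:
  fixes scale :: "'k::real_or_complex_field \<Rightarrow> 'g::ab_group_add \<Rightarrow> 'g"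
    and br :: "'g \<Rightarrow> 'g \<Rightarrow> 'g"
    and \<theta> :: "'g \<Rightarrow> 'k poly"
  assumes "fd_lie_algebra scale br"
    and "fd_lie_algebra.semisimple scale br"
    and "fd_lie_action scale br \<theta>"
    and "\<exists>X. \<theta> X \<noteq> 0"
  shows
    "let D = fd_lie_action.D_op scale br \<theta>;
         S = fd_lie_action.schouten scale br \<theta>;
         t = of_fun [:0, 1:];
         \<Lambda>2 = fd_lie_algebra.mvec scale 2;
         \<Lambda>2L = wedge_power (fd_lie_action.anchor_kernel scale \<theta>) 2
     in (\<exists>\<tau>\<in>\<Lambda>2. D t = S \<tau> t) \<and>
        (\<forall>\<tau>\<in>\<Lambda>2. D t = S \<tau> t \<longrightarrow>
           (\<forall>\<tau>'\<in>\<Lambda>2. D t = S \<tau>' t \<longleftrightarrow> \<tau>' - \<tau> \<in> \<Lambda>2L) \<and>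
           fd_lie_action.is_cocycle scale br \<theta> (\<lambda>x. D x - S \<tau> x)) \<and>
        (\<exists>\<tau>\<in>wedge_power (fd_lie_algebra.vec scale ` fd_lie_action.sl2_ideal scale br \<theta>) 2.
           D t = S \<tau> t \<and> fd_lie_action.dynamical_r_matrix scale br \<theta> (-1) \<tau>)"
proof -
  interpret fd_lie_action scale br \<theta> by fact
  interpret semisimple_action scale br \<theta>
    using assms by unfold_locales auto
  show ?thesis
  proof (rule sl2_triple_exists)
    fix H Ep Em
    assume *: "H \<in> sl2_ideal" "Ep \<in> sl2_ideal" "Em \<in> sl2_ideal"
      "\<theta> H = [:0, 1:]" "\<theta> Ep = [:0, 0, 1:]" "\<theta> Em = 1" "\<And>x. degree (\<theta> x) \<le> 2"
    interpret sl2_triple scale br \<theta> H Ep Em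
      using * by unfold_locales (auto simp: tvar_def)
    show ?thesis
      unfolding Let_def tvar_def[symmetric] D_op_tvar
    proof (intro conjI ballI impI)
      \<comment> \<open>\<open>\<tau>0\<close> settles both existence claims, here and inside the
        wedge square of the copy of sl(2); the middle claims hold for every solution.\<close>
      show "\<exists>\<tau>\<in>mvec 2. vsharp = schouten \<tau> (of_fun tvar)"
        by (intro bexI[of _ \<tau>0] schouten_\<tau>0_tvar[symmetric] \<tau>0_mvec)
      fix \<tau> assume \<tau>: "\<tau> \<in> mvec 2" "vsharp = schouten \<tau> (of_fun tvar)"
      show "is_cocycle (\<lambda>x. D_op x - schouten \<tau> x)"
        by (rule is_cocycle_D_minus_bracket[OF \<tau>(1) \<tau>(2)[symmetric]])
      fix \<tau>' assume "\<tau>' \<in> mvec 2"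
      then show "vsharp = schouten \<tau>' (of_fun tvar) \<longleftrightarrow> \<tau>' - \<tau> \<in> wedge_power anchor_kernel 2"
        by (rule bracket_solution_unique[OF \<tau>(1) \<tau>(2)[symmetric]])
    next
      show "\<exists>\<tau>\<in>wedge_power (vec ` sl2_ideal) 2.
          vsharp = schouten \<tau> (of_fun tvar) \<and> dynamical_r_matrix (- 1) \<tau>"
        by (intro bexI[of _ \<tau>0] conjI schouten_\<tau>0_tvar[symmetric] \<tau>0_dynamical \<tau>0_sl2)
    qed
  qed
qed

end
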